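(* Let $S$ be a generalized Krull domain and $J$ an ideal of $S$ of height at least two, such that $\dim S/J=0$ and $J$ has only finitely many minimal primes over it. Let $A\subseteq S/J$ be a subring over which $S/J$ is integral, and let $R$ be the pullback of $A\hookrightarrow S/J\twoheadleftarrow S$, i.e. $R=\{s\in S:\ s+J\in A\}$. Then $R$ is perinormal if and only if $A$ is a fragile subring of $S/J$ (i.e. the extension $A\subseteq S/J$ is fragile).
   Context: All rings are commutative with identity; "local" means having a unique maximal ideal (no Noetherian assumption). Generalized Krull domain: for a ring $R$ let $\operatorname{Spec}^1(R)$ be the set of height one primes. An integral domain $R$ is a generalized Krull domain if (1) $R=\bigcap_{\mathfrak p\in\operatorname{Spec}^1(R)}R_{\mathfrak p}$; (2) for each nonzero $r\in R$ the set $\{\mathfrak p\in\operatorname{Spec}^1(R): r\in\mathfrak p\}$ is finite; (3) $R_{\mathfrak p}$ is a (not necessarily discrete) valuation domain for every $\mathfrak p\in\operatorname{Spec}^1(R)$. Fragility: an integral extension $A\subseteq B$ of commutative rings is apparently fragile if for any ring $C$ with $A\subsetneq C\subseteq B$ there exist a minimal prime $\mathfrak p$ of $A$ and primes $P\ne Q$ of $C$ with $P\cap A=Q\cap A=\mathfrak p$ (the case $A=B$ being vacuously allowed). It is fragile if $A_P\subseteq B_{A\setminus P}$ is apparently fragile for every $P\in\operatorname{Spec}A$. Perinormality: an overring of an integral domain $R$ is a ring between $R$ and its fraction field. An extension $R\subseteq T$ satisfies going-down if whenever $\mathfrak p_1\subseteq\mathfrak p_2$ are primes of $R$ and $Q_2\in\operatorname{Spec}T$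 satisfies $Q_2\cap R=\mathfrak p_2$, there is $Q_1\in\operatorname{Spec}T$ with $Q_1\subseteq Q_2$ and $Q_1\cap R=\mathfrak p_1$. An integral domain $R$ is perinormal if every local overring $L$ of $R$ such that $R\subseteq L$ satisfies going-down is a localization of $R$ (i.e. $L=R_{\mathfrak p}$ for some $\mathfrak p\in\operatorname{Spec}R$). *)

theory Defs
  imports "HOL-Algebra.Algebra" "HOL-Library.Extended_Real"
begin

text \<open>
  A subset \<open>H\<close> with \<open>subring H R\<close> is regarded as a ring via \<open>R\<lparr>carrier := H\<rparr>\<close>.
  Rings are HOL-Algebra records; no Noetherian hypothesis is built in anywhere.
\<close>

section \<open>Prime ideals, height, dimension\<close>

definition Spec :: "('a, 'm) ring_scheme \<Rightarrow> 'a set set" where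
  "Spec R = {P. primeideal P R}"

definition primes_over :: "('a, 'm) ring_scheme \<Rightarrow> 'a set \<Rightarrow> 'a set set" where
  "primes_over R I = {P \<in> Spec R. I \<subseteq> P}"

definition minimal_primes_over :: "('a, 'm) ring_scheme \<Rightarrow> 'a set \<Rightarrow> 'a set set" where
  "minimal_primes_over R I =
     {P \<in> primes_over R I. \<forall>Q \<in> primes_over R I. Q \<subseteq> P \<longrightarrow> Q = P}"

definition minimal_primes :: "('a, 'm) ring_scheme \<Rightarrow> 'a set set" where
  "minimal_primes R = {P \<in> Spec R. \<forall>Q \<in> Spec R. Q \<subseteq> P \<longrightarrow> Q = P}"

definition prime_height :: "('a, 'm) ring_scheme \<Rightarrow> 'a set \<Rightarrow> enat" where
  "prime_height R P =
     Sup {enat n | n. \<exists>c. (\<forall>i\<le>n. c i \<in> Spec R) \<and> (\<forall>i<n. c i \<subset> c (Suc i)) \<and> c n = P}"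

definition ideal_height :: "('a, 'm) ring_scheme \<Rightarrow> 'a set \<Rightarrow> enat" where
  "ideal_height R I = (INF P \<in> primes_over R I. prime_height R P)"

text \<open>The value is an \<^typ>\<open>ereal\<close> so that the zero ring has dimension \<open>-\<infinity>\<close> rather than \<open>0\<close>.\<close>

definition krull_dim :: "('a, 'm) ring_scheme \<Rightarrow> ereal" where
  "krull_dim R = (SUP P \<in> Spec R. ereal_of_enat (prime_height R P))"

definition Spec1 :: "('a, 'm) ring_scheme \<Rightarrow> 'a set set" where
  "Spec1 R = {P \<in> Spec R. prime_height R P = 1}"

definition local_ring :: "('a, 'm) ring_scheme \<Rightarrow> bool" where
  "local_ring R \<longleftrightarrow> cring R \<and> (\<exists>!M. maximalideal M R)"


section \<open>Rings of fractions\<close>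

text \<open>
  The localization of a commutative ring \<open>R\<close>, possibly with zero divisors, at a
  multiplicatively closed subset \<open>M\<close> containing \<open>\<one>\<close>.
\<close>

definition loc_rel :: "('a, 'm) ring_scheme \<Rightarrow> 'a set \<Rightarrow> (('a \<times> 'a) \<times> ('a \<times> 'a)) set" where
  "loc_rel R M =
     {((a, s), (b, t)). a \<in> carrier R \<and> s \<in> M \<and> b \<in> carrier R \<and> t \<in> M \<and>
        (\<exists>u \<in> M. u \<otimes>\<^bsub>R\<^esub> (a \<otimes>\<^bsub>R\<^esub> t \<ominus>\<^bsub>R\<^esub> b \<otimes>\<^bsub>R\<^esub> s) = \<zero>\<^bsub>R\<^esub>)}"

definition fraction :: "('a, 'm) ring_scheme \<Rightarrow> 'a set \<Rightarrow> 'a \<Rightarrow> 'a \<Rightarrow> ('a \<times> 'a) set" where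
  "fraction R M a s = loc_rel R M `` {(a, s)}"

definition localization :: "('a, 'm) ring_scheme \<Rightarrow> 'a set \<Rightarrow> ('a \<times> 'a) set ring" where
  "localization R M =
     \<lparr>carrier = (carrier R \<times> M) // loc_rel R M,
      monoid.mult = (\<lambda>x y. \<Union>(a, s) \<in> x. \<Union>(b, t) \<in> y. fraction R M (a \<otimes>\<^bsub>R\<^esub> b) (s \<otimes>\<^bsub>R\<^esub> t)),
      one = fraction R M \<one>\<^bsub>R\<^esub> \<one>\<^bsub>R\<^esub>,
      ring.zero = fraction R M \<zero>\<^bsub>R\<^esub> \<one>\<^bsub>R\<^esub>,
      add = (\<lambda>x y. \<Union>(a, s) \<in> x. \<Union>(b, t) \<in> y.
               fraction R M (a \<otimes>\<^bsub>R\<^esub> t \<oplus>\<^bsub>R\<^esub> b \<otimes>\<^bsub>R\<^esub> s) (s \<otimes>\<^bsub>R\<^esub> t))\<rparr>"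

text \<open>The elements of \<open>localization R M\<close> with numerator in \<open>B\<close> and denominator in \<open>N \<subseteq> M\<close>.\<close>

definition fractions ::
    "('a, 'm) ring_scheme \<Rightarrow> 'a set \<Rightarrow> 'a set \<Rightarrow> 'a set \<Rightarrow> ('a \<times> 'a) set set" where
  "fractions R M B N = {fraction R M x s | x s. x \<in> B \<and> s \<in> N}"

definition localization_at :: "('a, 'm) ring_scheme \<Rightarrow> 'a set \<Rightarrow> ('a \<times> 'a) set ring" where
  "localization_at R P = localization R (carrier R - P)"

definition Frac :: "('a, 'm) ring_scheme \<Rightarrow> ('a \<times> 'a) set ring" where
  "Frac R = localization R (carrier R - {\<zero>\<^bsub>R\<^esub>})"

text \<open>For a domain \<open>R\<close>: the copies of \<open>R\<close> and of \<open>R\<^sub>P\<close> inside the fraction field.\<close>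

definition base_in_Frac :: "('a, 'm) ring_scheme \<Rightarrow> ('a \<times> 'a) set set" where
  "base_in_Frac R = fractions R (carrier R - {\<zero>\<^bsub>R\<^esub>}) (carrier R) {\<one>\<^bsub>R\<^esub>}"

definition loc_in_Frac :: "('a, 'm) ring_scheme \<Rightarrow> 'a set \<Rightarrow> ('a \<times> 'a) set set" where
  "loc_in_Frac R P = fractions R (carrier R - {\<zero>\<^bsub>R\<^esub>}) (carrier R) (carrier R - P)"


section \<open>Generalized Krull domains\<close>

definition valuation_domain :: "('a, 'm) ring_scheme \<Rightarrow> bool" where
  "valuation_domain V \<longleftrightarrow>
     domain V \<and> (\<forall>a \<in> carrier V. \<forall>b \<in> carrier V. a divides\<^bsub>V\<^esub> b \<or> b divides\<^bsub>V\<^esub> a)"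

text \<open>
  The intersection is taken inside \<open>Frac R\<close>; if there are no height one primes it is
  all of \<open>Frac R\<close>, so fields are generalized Krull domains.
\<close>

definition generalized_Krull_domain :: "('a, 'm) ring_scheme \<Rightarrow> bool" where
  "generalized_Krull_domain R \<longleftrightarrow>
     domain R \<and>
     base_in_Frac R = carrier (Frac R) \<inter> (\<Inter>P \<in> Spec1 R. loc_in_Frac R P) \<and>
     (\<forall>r \<in> carrier R - {\<zero>\<^bsub>R\<^esub>}. finite {P \<in> Spec1 R. r \<in> P}) \<and>
     (\<forall>P \<in> Spec1 R. valuation_domain (localization_at R P))"


section \<open>Fragile extensions\<close>

text \<open>In \<open>eval\<close> the head of the coefficient list is the leading coefficient, so \<open>\<one> # p\<close> is monic.\<close>

definition integral_extension :: "'a set \<Rightarrow> ('a, 'm) ring_scheme \<Rightarrow> bool" where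
  "integral_extension A B \<longleftrightarrow>
     cring B \<and> subring A B \<and>
     (\<forall>b \<in> carrier B. \<exists>p. set p \<subseteq> A \<and> ring.eval B (\<one>\<^bsub>B\<^esub> # p) b = \<zero>\<^bsub>B\<^esub>)"

definition apparently_fragile :: "'a set \<Rightarrow> ('a, 'm) ring_scheme \<Rightarrow> bool" where
  "apparently_fragile A B \<longleftrightarrow>
     integral_extension A B \<and>
     (\<forall>C. subring C B \<and> A \<subset> C \<longrightarrow>
        (\<exists>p \<in> minimal_primes (B\<lparr>carrier := A\<rparr>).
         \<exists>P \<in> Spec (B\<lparr>carrier := C\<rparr>). \<exists>Q \<in> Spec (B\<lparr>carrier := C\<rparr>).
           P \<noteq> Q \<and> P \<inter> A = p \<and> Q \<inter> A = p))"

text \<open>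
  Localization is exact, so \<open>A\<^sub>P\<close> is identified with its image in the localization of \<open>B\<close>
  at \<open>A - P\<close>, namely the fractions with numerator in \<open>A\<close> and denominator in \<open>A - P\<close>.
\<close>

definition fragile :: "'a set \<Rightarrow> ('a, 'm) ring_scheme \<Rightarrow> bool" where
  "fragile A B \<longleftrightarrow>
     integral_extension A B \<and>
     (\<forall>P \<in> Spec (B\<lparr>carrier := A\<rparr>).
        apparently_fragile (fractions B (A - P) A (A - P)) (localization B (A - P)))"


section \<open>Perinormal domains\<close>

definition going_down :: "'a set \<Rightarrow> ('a, 'm) ring_scheme \<Rightarrow> bool" where
  "going_down R T \<longleftrightarrow>
     (\<forall>p1 \<in> Spec (T\<lparr>carrier := R\<rparr>). \<forall>p2 \<in> Spec (T\<lparr>carrier := R\<rparr>). \<forall>Q2 \<in> Spec T.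
        p1 \<subseteq> p2 \<and> Q2 \<inter> R = p2 \<longrightarrow> (\<exists>Q1 \<in> Spec T. Q1 \<subseteq> Q2 \<and> Q1 \<inter> R = p1))"

definition overring :: "('a, 'm) ring_scheme \<Rightarrow> ('a \<times> 'a) set set \<Rightarrow> bool" where
  "overring R L \<longleftrightarrow> subring L (Frac R) \<and> base_in_Frac R \<subseteq> L"

definition perinormal :: "('a, 'm) ring_scheme \<Rightarrow> bool" where
  "perinormal R \<longleftrightarrow>
     domain R \<and>
     (\<forall>L. overring R L \<and> local_ring (Frac R\<lparr>carrier := L\<rparr>) \<and>
          going_down (base_in_Frac R) (Frac R\<lparr>carrier := L\<rparr>)
          \<longrightarrow> (\<exists>P \<in> Spec R. L = loc_in_Frac R P))"


section \<open>The pullback\<close>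

definition pullback_ring ::
    "('a, 'm) ring_scheme \<Rightarrow> 'a set \<Rightarrow> 'a set set \<Rightarrow> ('a, 'm) ring_scheme" where
  "pullback_ring S J A = S\<lparr>carrier := {s \<in> carrier S. J +>\<^bsub>S\<^esub> s \<in> A}\<rparr>"

end

theory Submission
  imports Defs
begin

text \<open>
  The ring \<open>R\<close> shares the nonzero ideal \<open>J\<close> with \<open>S\<close>, so \<open>S\<close> embeds into the fraction field \<open>K\<close> of
  \<open>R\<close>, and \<open>R\<close> and \<open>S\<close> agree after localizing at a prime not containing \<open>J\<close>.
  A local overring \<open>L\<close> of \<open>R\<close> centered on a prime \<open>p\<close> contains \<open>R\<^sub>p\<close>; if \<open>R \<subseteq> L\<close> satisfies going-down
  then \<open>L \<subseteq> S\<^sub>P\<close> for all height one primes \<open>P\<close> of \<open>S\<close> with \<open>P \<inter> R \<subseteq> p\<close>, since the localizations \<open>S\<^sub>P\<close>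
  are valuation domains of dimension one, and therefore \<open>L\<close> lies inside the localization of \<open>S\<close> at \<open>R - p\<close>.
  For \<open>p \<supseteq> J\<close> the rings between \<open>R\<^sub>p\<close> and this localization correspond to the rings between
  \<open>A\<^sub>P\<close> and \<open>B\<^bsub>A-P\<^esub>\<close>, where \<open>B = S/J\<close> and \<open>P = p/J\<close>. All of these quotients are zero-dimensional,
  so that such an intermediate ring \<open>L\<close> is local, and then automatically satisfies
  going-down over \<open>R\<close>, unless it has two primes over \<open>p\<close>, which is what fragility demands.
\<close>

section \<open>Ideals and prime ideals\<close>

text \<open>Going-down only says which primes of \<open>R\<close> are contractions of primes of
  \<open>L\<close>, while the valuation rings belong to \<open>S\<close>. Height at least two
  bridges the gap: each height one prime of \<open>S\<close> misses some element of
  \<open>J\<close>, and multiplying by it moves an equation over \<open>S\<close> into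
  \<open>R\<close> without leaving the complement of that prime. Returning from the rings
  \<open>S_P\<close> to a localization of \<open>S\<close> is not formal, because an infinite
  intersection need not commute with localization; finite character, together with the fact that
  powers become divisible at a height one prime, supplies one common denominator. Dimension zero has
  to pass from \<open>B\<close> to localizations and to all rings above \<open>A\<close>. It is
  replaced by a condition on elements, \<open>pi_regular\<close>, which is carried along by
  computing with a monic equation. Going-down of an intermediate ring rests on a dichotomy: a prime
  of \<open>R\<close> containing \<open>J\<close> is comparable to no other such prime, and a prime
  inside \<open>p\<close> not containing \<open>J\<close> has a localization that contains
  \<open>L\<close>, from which a prime can be contracted.\<close>

lemma (in cring) ideal_iff:
  "ideal I R \<longleftrightarrow> I \<subseteq> carrier R \<and> \<zero> \<in> I \<and> (\<forall>a\<in>I. \<forall>b\<in>I. a \<oplus> b \<in> I) \<and>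
    (\<forall>a\<in>I. \<forall>r\<in>carrier R. r \<otimes> a \<in> I)" (is "_ \<longleftrightarrow> ?rhs")
proof
  assume "ideal I R"
  then interpret ideal I R .
  show ?rhs
    using a_subset I_l_closed by auto
next
  assume h: ?rhs
  show "ideal I R"
  proof (rule idealI[OF ring_axioms])
    show "subgroup I (add_monoid R)"
    proof (rule add.subgroupI)
      fix a assume "a \<in> I"
      then have "a \<in> carrier R" "(\<ominus> \<one>) \<otimes> a \<in> I"
        using h by auto
      then show "\<ominus> a \<in> I"
        by (simp add: l_minus)
    qed (use h in auto)
  next
    fix a x assume "a \<in> I" "x \<in> carrier R"
    then show "x \<otimes> a \<in> I" "a \<otimes> x \<in> I"
      using h m_comm[of a x] by auto
  qed
qed

lemma (in cring) primeideal_iff: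
  "primeideal P R \<longleftrightarrow> ideal P R \<and> \<one> \<notin> P \<and>
    (\<forall>a\<in>carrier R. \<forall>b\<in>carrier R. a \<otimes> b \<in> P \<longrightarrow> a \<in> P \<or> b \<in> P)"
  using ideal.one_imp_carrier[of P R] primeideal.I_notcarr[of P R] primeideal.I_prime[of P R]
    primeideal.axioms(1)[of P R] primeidealI[OF _ is_cring, of P]
  by (metis one_closed)

lemma (in cring) maximalideal_iff:
  "maximalideal P R \<longleftrightarrow> ideal P R \<and> \<one> \<notin> P \<and>
    (\<forall>Q. ideal Q R \<and> P \<subseteq> Q \<and> \<one> \<notin> Q \<longrightarrow> Q = P)" (is "_ \<longleftrightarrow> ?rhs")
proof
  assume "maximalideal P R"
  then interpret maximalideal P R .
  show ?rhs
    using is_ideal I_notcarr I_maximal one_imp_carrier ideal.Icarr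
    by (metis one_closed subsetI)
next
  assume ?rhs
  then show "maximalideal P R"
    using ideal.one_imp_carrier by (intro maximalidealI) auto
qed

section \<open>Existence of prime and maximal ideals\<close>

lemma (in cring) ideal_Union_chain:
  assumes "C \<noteq> {}" "\<And>I. I \<in> C \<Longrightarrow> ideal I R" "subset.chain A C"
  shows "ideal (\<Union>C) R"
proof -
  have "\<exists>I\<in>C. a \<in> I \<and> b \<in> I" if "a \<in> \<Union>C" "b \<in> \<Union>C" for a b
    using that assms(3) unfolding subset_chain_def by blast
  then have "a \<oplus> b \<in> \<Union>C" if "a \<in> \<Union>C" "b \<in> \<Union>C" for a b
    using that assms(2) unfolding ideal_iff by (meson UnionI)
  moreover have "\<Union>C \<subseteq> carrier R" "\<zero> \<in> \<Union>C"
    using assms(1,2) unfolding ideal_iff by blast+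
  moreover have "r \<otimes> a \<in> \<Union>C" if "a \<in> \<Union>C" "r \<in> carrier R" for a r
    using that assms(2) unfolding ideal_iff by (meson UnionE UnionI)
  ultimately show ?thesis
    unfolding ideal_iff by simp
qed

text \<open>The set \<open>M\<close> is arbitrary here: a multiplicative \<open>M\<close> makes the
  maximal element prime, while \<open>M = {\<one>}\<close> makes it a maximal ideal.\<close>

lemma (in cring) ideal_Zorn:
  assumes "ideal I R" "I \<inter> M = {}"
  obtains P where "ideal P R" "I \<subseteq> P" "P \<inter> M = {}"
    "\<And>Q. \<lbrakk>ideal Q R; P \<subseteq> Q; Q \<inter> M = {}\<rbrakk> \<Longrightarrow> Q = P"
proof -
  let ?A = "{P. ideal P R \<and> I \<subseteq> P \<and> P \<inter> M = {}}"
  have "\<exists>U\<in>?A. \<forall>Z\<in>C. Z \<subseteq> U" if "subset.chain ?A C" for C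
  proof (cases "C = {}")
    case True
    then show ?thesis
      using assms by auto
  next
    case False
    have C: "C \<subseteq> ?A"
      using that unfolding subset_chain_def by simp
    have "ideal (\<Union>C) R"
      using ideal_Union_chain[OF False _ that] C by blast
    then have "\<Union>C \<in> ?A"
      using False C by blast
    then show ?thesis
      by blast
  qed
  from subset_Zorn[OF this] obtain P where "P \<in> ?A" "\<forall>Z\<in>?A. P \<subseteq> Z \<longrightarrow> Z = P"
    by blast
  then show thesis
    by (intro that[of P]) auto
qed

text \<open>The set is the ideal \<open>I + (a)\<close>, spelled out by elements so that maximality
  arguments yield explicit combinations.\<close>

lemma (in cring) ideal_sup_cgenideal:
  assumes "ideal I R" "a \<in> carrier R"
  shows "ideal {i \<oplus> r \<otimes> a | i r. i \<in> I \<and> r \<in> carrier R} R" (is "ideal ?K R")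
    and "I \<subseteq> {i \<oplus> r \<otimes> a | i r. i \<in> I \<and> r \<in> carrier R}"
    and "a \<in> {i \<oplus> r \<otimes> a | i r. i \<in> I \<and> r \<in> carrier R}"
proof -
  interpret ideal I R by fact
  have mem: "i \<oplus> r \<otimes> a \<in> ?K" if "i \<in> I" "r \<in> carrier R" for i r
    using that by auto
  have zero: "\<zero> \<in> I"
    by (rule additive_subgroup.zero_closed[OF is_additive_subgroup])
  show "I \<subseteq> ?K"
  proof
    fix i assume "i \<in> I"
    then show "i \<in> ?K"
      using mem[of i \<zero>] assms(2) Icarr by simp
  qed
  then have "\<zero> \<in> ?K"
    using zero by (rule subsetD)
  show "a \<in> ?K"
    using mem[of \<zero> \<one>] zero assms(2) by simp
  have sum: "(i \<oplus> r \<otimes> a) \<oplus> (i' \<oplus> r' \<otimes> a) = (i \<oplus> i') \<oplus> (r \<oplus> r') \<otimes> a"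
    if "i \<in> I" "i' \<in> I" "r \<in> carrier R" "r' \<in> carrier R" for i i' r r'
    using that assms(2) Icarr[of i] Icarr[of i'] by algebra
  have prod: "s \<otimes> (i \<oplus> r \<otimes> a) = s \<otimes> i \<oplus> (s \<otimes> r) \<otimes> a"
    if "i \<in> I" "r \<in> carrier R" "s \<in> carrier R" for i r s
    using that assms(2) Icarr[of i] by algebra
  have "?K \<subseteq> carrier R"
    using assms(2) Icarr by auto
  moreover have "x \<oplus> y \<in> ?K" if xK: "x \<in> ?K" "y \<in> ?K" for x y
  proof -
    obtain i r i' r' where *: "i \<in> I" "i' \<in> I" "r \<in> carrier R" "r' \<in> carrier R"
      and xy: "x = i \<oplus> r \<otimes> a" "y = i' \<oplus> r' \<otimes> a"
      using xK by blast
    show ?thesis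
      unfolding xy sum[OF *] using * by (intro mem) auto
  qed
  moreover have "s \<otimes> x \<in> ?K" if xs: "x \<in> ?K" "s \<in> carrier R" for x s
  proof -
    obtain i r where *: "i \<in> I" "r \<in> carrier R" and x: "x = i \<oplus> r \<otimes> a"
      using xs by blast
    show ?thesis
      unfolding x prod[OF * xs(2)] using * xs(2) by (intro mem I_l_closed) auto
  qed
  ultimately show "ideal ?K R"
    unfolding ideal_iff using \<open>\<zero> \<in> ?K\<close> by simp
qed

text \<open>If neither factor lies in \<open>P\<close>, then \<open>P + (a)\<close> and
  \<open>P + (b)\<close> are strictly larger and meet \<open>M\<close>; the product of two such
  elements lies in \<open>M\<close>, and also in \<open>P\<close> as soon as
  \<open>a \<otimes> b\<close> does.\<close>

lemma (in cring) ideal_disjoint_maximal_prime: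
  assumes P: "ideal P R" and disj: "P \<inter> M = {}" and one: "\<one> \<in> M"
    and M: "\<And>a b. \<lbrakk>a \<in> M; b \<in> M\<rbrakk> \<Longrightarrow> a \<otimes> b \<in> M"
    and max: "\<And>Q. \<lbrakk>ideal Q R; P \<subseteq> Q; Q \<inter> M = {}\<rbrakk> \<Longrightarrow> Q = P"
  shows "primeideal P R"
proof -
  interpret ideal P R by fact
  have meet: "\<exists>i r. i \<in> P \<and> r \<in> carrier R \<and> i \<oplus> r \<otimes> a \<in> M"
    if "a \<in> carrier R" "a \<notin> P" for a
  proof (rule ccontr)
    assume "\<not> ?thesis"
    then have "{i \<oplus> r \<otimes> a | i r. i \<in> P \<and> r \<in> carrier R} \<inter> M = {}" (is "?K \<inter> M = {}")
      by blast
    then have "?K = P"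
      by (rule max[OF ideal_sup_cgenideal(1,2)[OF P that(1)]])
    then show False
      using ideal_sup_cgenideal(3)[OF P that(1)] that(2) by simp
  qed
  have "a \<in> P \<or> b \<in> P" if ab: "a \<in> carrier R" "b \<in> carrier R" "a \<otimes> b \<in> P" for a b
  proof (rule ccontr)
    assume "\<not> ?thesis"
    then have nab: "a \<notin> P" "b \<notin> P"
      by auto
    obtain i r where *: "i \<in> P" "r \<in> carrier R" "i \<oplus> r \<otimes> a \<in> M"
      using meet[OF ab(1) nab(1)] by auto
    obtain j s where **: "j \<in> P" "s \<in> carrier R" "j \<oplus> s \<otimes> b \<in> M"
      using meet[OF ab(2) nab(2)] by auto
    note * = * **
    have c: "i \<in> carrier R" "j \<in> carrier R"
      using * Icarr by auto
    have "(i \<oplus> r \<otimes> a) \<otimes> (j \<oplus> s \<otimes> b) =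
      ((j \<oplus> s \<otimes> b) \<otimes> i \<oplus> (r \<otimes> a) \<otimes> j) \<oplus> (r \<otimes> s) \<otimes> (a \<otimes> b)"
      using ab * c by algebra
    moreover have "(j \<oplus> s \<otimes> b) \<otimes> i \<in> P" "(r \<otimes> a) \<otimes> j \<in> P" "(r \<otimes> s) \<otimes> (a \<otimes> b) \<in> P"
      using ab * c I_l_closed by auto
    ultimately have "(i \<oplus> r \<otimes> a) \<otimes> (j \<oplus> s \<otimes> b) \<in> P"
      by simp
    then show False
      using M[OF *(3,6)] disj by (metis disjoint_iff)
  qed
  then show ?thesis
    unfolding primeideal_iff using P disj one by auto
qed

lemma (in cring) primeideal_disjoint:
  assumes "ideal I R" "I \<inter> M = {}" "\<one> \<in> M" "\<And>a b. \<lbrakk>a \<in> M; b \<in> M\<rbrakk> \<Longrightarrow> a \<otimes> b \<in> M"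
  obtains P where "primeideal P R" "I \<subseteq> P" "P \<inter> M = {}"
  by (metis ideal_Zorn[OF assms(1,2)] ideal_disjoint_maximal_prime[OF _ _ assms(3,4)])

lemma (in cring) maximalideal_exists:
  assumes "ideal I R" "\<one> \<notin> I"
  obtains P where "maximalideal P R" "I \<subseteq> P"
proof (rule ideal_Zorn[OF assms(1), of "{\<one>}"])
  show "I \<inter> {\<one>} = {}"
    using assms(2) by simp
next
  fix P assume "ideal P R" "I \<subseteq> P" "P \<inter> {\<one>} = {}"
    "\<And>Q. \<lbrakk>ideal Q R; P \<subseteq> Q; Q \<inter> {\<one>} = {}\<rbrakk> \<Longrightarrow> Q = P"
  then show thesis
    by (intro that[of P]) (auto simp: maximalideal_iff)
qed

lemma (in cring) nonunit_in_maximalideal: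
  assumes "x \<in> carrier R" "\<And>y. y \<in> carrier R \<Longrightarrow> y \<otimes> x \<noteq> \<one>"
  obtains P where "maximalideal P R" "x \<in> P"
proof (rule maximalideal_exists[OF cgenideal_ideal[OF assms(1)]])
  show "\<one> \<notin> PIdl x"
  proof
    assume "\<one> \<in> PIdl x"
    then obtain y where "y \<in> carrier R" "y \<otimes> x = \<one>"
      unfolding cgenideal_def by auto
    then show False
      using assms(2) by simp
  qed
qed (use cgenideal_self[OF assms(1)] that in blast)

lemma (in cring) maximalideal_comaximal:
  assumes "maximalideal P R" "x \<in> carrier R" "x \<notin> P"
  obtains i r where "i \<in> P" "r \<in> carrier R" "i \<oplus> r \<otimes> x = \<one>"
proof -
  interpret maximalideal P R by fact
  let ?K = "{i \<oplus> r \<otimes> x | i r. i \<in> P \<and> r \<in> carrier R}"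
  note K = ideal_sup_cgenideal[OF is_ideal assms(2)]
  have "\<one> \<in> ?K"
  proof (rule ccontr)
    assume "\<one> \<notin> ?K"
    then have "?K = P"
      using assms(1) K(1,2) unfolding maximalideal_iff by simp
    then show False
      using K(3) assms(3) by simp
  qed
  then show thesis
    using that by auto
qed

text \<open>Since \<open>P\<close> contains the kernel, it is saturated: \<open>h x = h p\<close>
  puts \<open>x \<ominus> p\<close> into the kernel and hence \<open>x\<close> into
  \<open>P\<close>. By the second conclusion such primes are recovered from their images.\<close>

lemma primeideal_image:
  fixes Z (structure) and T (structure)
  assumes Z: "cring Z" and T: "cring T" and h: "h \<in> ring_hom Z T" and surj: "h ` carrier Z = carrier T"
    and P: "primeideal P Z" and ker: "\<And>x. \<lbrakk>x \<in> carrier Z; h x = \<zero>\<^bsub>T\<^esub>\<rbrakk> \<Longrightarrow> x \<in> P"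
  shows "primeideal (h ` P) T" and "{x \<in> carrier Z. h x \<in> h ` P} = P"
proof -
  interpret Z: cring Z by fact
  interpret T: cring T by fact
  interpret ring_hom_cring Z T h
    using h by unfold_locales
  interpret P: primeideal P Z by fact
  have sat: "x \<in> P" if x: "x \<in> carrier Z" "p \<in> P" "h x = h p" for x p
  proof -
    have p: "p \<in> carrier Z"
      using x by auto
    then have "x \<ominus>\<^bsub>Z\<^esub> p \<in> P"
      using x by (intro ker) (auto simp: a_minus_def T.r_neg)
    then have "(x \<ominus>\<^bsub>Z\<^esub> p) \<oplus>\<^bsub>Z\<^esub> p \<in> P"
      using x by auto
    moreover have "(x \<ominus>\<^bsub>Z\<^esub> p) \<oplus>\<^bsub>Z\<^esub> p = x"
      using x p by algebra
    ultimately show ?thesis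
      by simp
  qed
  have lift: "\<exists>x\<in>carrier Z. y = h x" if "y \<in> carrier T" for y
    using that unfolding surj[symmetric] by auto
  from sat show eq: "{x \<in> carrier Z. h x \<in> h ` P} = P"
    by auto
  have 1: "ideal (h ` P) T"
    unfolding T.ideal_iff
  proof (intro conjI ballI)
    show "h ` P \<subseteq> carrier T"
      by auto
    show "\<zero>\<^bsub>T\<^esub> \<in> h ` P"
      using hom_zero P.zero_closed by (metis image_eqI)
  next
    fix a b assume "a \<in> h ` P" "b \<in> h ` P"
    then obtain p q where "p \<in> P" "q \<in> P" "a = h p" "b = h q"
      by blast
    then show "a \<oplus>\<^bsub>T\<^esub> b \<in> h ` P"
      using P.a_closed[of p q] by (metis P.Icarr hom_add image_eqI)
  next
    fix a r assume "a \<in> h ` P" "r \<in> carrier T"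
    then obtain p q where "p \<in> P" "q \<in> carrier Z" "a = h p" "r = h q"
      using lift[of r] by auto
    then show "r \<otimes>\<^bsub>T\<^esub> a \<in> h ` P"
      using P.I_l_closed[of p q] by (metis P.Icarr hom_mult image_eqI)
  qed
  moreover have "\<one>\<^bsub>T\<^esub> \<notin> h ` P"
  proof
    assume "\<one>\<^bsub>T\<^esub> \<in> h ` P"
    then have "\<one>\<^bsub>Z\<^esub> \<in> {x \<in> carrier Z. h x \<in> h ` P}"
      by simp
    then show False
      using P Z.primeideal_iff eq by simp
  qed
  moreover have "a \<in> h ` P \<or> b \<in> h ` P"
    if ab: "a \<in> carrier T" "b \<in> carrier T" "a \<otimes>\<^bsub>T\<^esub> b \<in> h ` P" for a b
  proof -
    obtain p q where pq: "p \<in> carrier Z" "q \<in> carrier Z" "a = h p" "b = h q"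
      using lift[OF ab(1)] lift[OF ab(2)] by auto
    then obtain x where "x \<in> P" "h (p \<otimes>\<^bsub>Z\<^esub> q) = h x"
      using ab(3) by auto
    then have "p \<otimes>\<^bsub>Z\<^esub> q \<in> P"
      by (rule sat[rotated 1]) (use pq in simp)
    then show ?thesis
      using P.I_prime[OF pq(1,2)] unfolding pq(3,4) by (meson imageI)
  qed
  ultimately show "primeideal (h ` P) T"
    unfolding T.primeideal_iff by simp
qed

lemma primeideal_contraction:
  assumes Z: "cring Z" and T: "cring T" and h: "h \<in> ring_hom Z T" and P: "primeideal P T"
  shows "primeideal {x \<in> carrier Z. h x \<in> P} Z"
  using ring_hom_ring.primeideal_vimage[OF ring_hom_ringI2[OF cring.axioms(1)[OF Z] cring.axioms(1)[OF T] h] Z P] .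

lemma (in cring) subring_cring: "subring H R \<Longrightarrow> cring (R\<lparr>carrier := H\<rparr>)"
  using subcringI' subcring_iff subringE(1) by blast

lemma (in cring) primeideal_subring_contraction:
  assumes "subring H R" "subring L R" "H \<subseteq> L" "primeideal P (R\<lparr>carrier := L\<rparr>)"
  shows "primeideal (P \<inter> H) (R\<lparr>carrier := H\<rparr>)"
proof -
  have "(\<lambda>x. x) \<in> ring_hom (R\<lparr>carrier := H\<rparr>) (R\<lparr>carrier := L\<rparr>)"
    using assms(3) by (auto simp: ring_hom_def)
  from primeideal_contraction[OF subring_cring[OF assms(1)] subring_cring[OF assms(2)] this assms(4)]
  show ?thesis
    by (simp add: Int_def conj_commute)
qed


section \<open>Zero-dimensional rings\<close>

text \<open>The equation reads x^n = x^(n+1) c. For commutative rings it says that no prime lies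
  strictly inside another; being a condition on elements, it passes by computation to localizations
  and to subrings over which the ring is integral.\<close>

definition pi_regular :: "('a, 'm) ring_scheme \<Rightarrow> bool" where
  "pi_regular Z \<longleftrightarrow> (\<forall>x\<in>carrier Z. \<exists>n::nat. \<exists>c\<in>carrier Z.
     x [^]\<^bsub>Z\<^esub> n \<otimes>\<^bsub>Z\<^esub> (x \<otimes>\<^bsub>Z\<^esub> c) = x [^]\<^bsub>Z\<^esub> n)"

lemma (in cring) prime_power:
  assumes "primeideal P R" "x \<in> carrier R" "x [^] (n::nat) \<in> P"
  shows "x \<in> P"
  using assms(3)
proof (induction n)
  case 0
  then show ?case
    using assms(1) primeideal_iff by simp
next
  case (Suc n)
  then show ?case
    using primeideal.I_prime[OF assms(1), of "x [^] n" x] assms(2) by auto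
qed

text \<open>The equation gives x^n (1 - x c) = 0. For \<open>x\<close> in \<open>Q\<close> but not
  in \<open>P\<close> this forces 1 - x c into \<open>P\<close>, hence into \<open>Q\<close>, which
  also contains x c.\<close>

lemma (in cring) pi_regular_prime_eq:
  assumes "pi_regular R" "primeideal P R" "primeideal Q R" "P \<subseteq> Q"
  shows "P = Q"
proof (rule ccontr)
  interpret P: primeideal P R by fact
  interpret Q: primeideal Q R by fact
  assume "P \<noteq> Q"
  then obtain x where x: "x \<in> Q" "x \<notin> P"
    using assms(4) by blast
  then have xc: "x \<in> carrier R"
    by auto
  obtain n :: nat and c where c: "c \<in> carrier R" "x [^] n \<otimes> (x \<otimes> c) = x [^] n"
    using assms(1) xc unfolding pi_regular_def by blast
  have "x [^] n \<otimes> (\<one> \<ominus> x \<otimes> c) = x [^] n \<ominus> x [^] n \<otimes> (x \<otimes> c)"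
    using xc c(1) nat_pow_closed[OF xc, of n] by algebra
  also have "\<dots> = \<zero>"
    using c xc by (simp add: a_minus_def r_neg)
  finally have "x [^] n \<in> P \<or> \<one> \<ominus> x \<otimes> c \<in> P"
    using P.I_prime[of "x [^] n" "\<one> \<ominus> x \<otimes> c"] xc c(1) by simp
  then have "\<one> \<ominus> x \<otimes> c \<in> Q"
    using prime_power[OF assms(2) xc] x assms(4) by blast
  moreover have "x \<otimes> c \<in> Q"
    using x c by (simp add: Q.I_r_closed)
  ultimately have "(\<one> \<ominus> x \<otimes> c) \<oplus> x \<otimes> c \<in> Q"
    by (rule Q.a_closed)
  moreover have "(\<one> \<ominus> x \<otimes> c) \<oplus> x \<otimes> c = \<one>"
    using xc c(1) by algebra
  ultimately show False
    using assms(3) primeideal_iff by simp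
qed

text \<open>If \<open>x\<close> violates the condition, the products x^n (1 - x c) form a
  multiplicative set avoiding zero. A prime disjoint from it is maximal by incomparability and does
  not contain \<open>x\<close>, so it contains some 1 - r x, which is one of these products.\<close>

lemma (in cring) pi_regular_if_primes_incomparable:
  assumes "\<And>P Q. \<lbrakk>primeideal P R; primeideal Q R; P \<subseteq> Q\<rbrakk> \<Longrightarrow> P = Q"
  shows "pi_regular R"
  unfolding pi_regular_def
proof (rule ballI, rule ccontr)
  fix x assume x: "x \<in> carrier R"
    and none: "\<not> (\<exists>n::nat. \<exists>c\<in>carrier R. x [^] n \<otimes> (x \<otimes> c) = x [^] n)"
  let ?M = "{x [^] n \<otimes> (\<one> \<ominus> x \<otimes> c) | (n::nat) c. c \<in> carrier R}"
  have disj: "{\<zero>} \<inter> ?M = {}"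
  proof -
    have "x [^] n \<otimes> (\<one> \<ominus> x \<otimes> c) \<noteq> \<zero>" if c: "c \<in> carrier R" for n :: nat and c
    proof
      assume "x [^] n \<otimes> (\<one> \<ominus> x \<otimes> c) = \<zero>"
      moreover have "x [^] n \<otimes> (x \<otimes> c) = x [^] n \<ominus> x [^] n \<otimes> (\<one> \<ominus> x \<otimes> c)"
        using x c nat_pow_closed[OF x, of n] by algebra
      ultimately have "x [^] n \<otimes> (x \<otimes> c) = x [^] n"
        using x by (simp add: a_minus_def)
      then show False
        using none c by blast
    qed
    then have "\<zero> \<notin> ?M"
      by (auto dest!: sym[of \<zero>])
    then show ?thesis
      by simp
  qed
  have one: "\<one> \<in> ?M"
  proof -
    have "\<one> = x [^] (0::nat) \<otimes> (\<one> \<ominus> x \<otimes> \<zero>)"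
      using x by (simp add: a_minus_def)
    then show ?thesis
      using zero_closed by blast
  qed
  have mult: "a \<otimes> b \<in> ?M" if ab: "a \<in> ?M" "b \<in> ?M" for a b
  proof -
    obtain n m :: nat and c d where cd: "c \<in> carrier R" "d \<in> carrier R"
      "a = x [^] n \<otimes> (\<one> \<ominus> x \<otimes> c)" "b = x [^] m \<otimes> (\<one> \<ominus> x \<otimes> d)"
      using ab by blast
    \<comment> \<open>From (1 - x c)(1 - x d) = 1 - x (c + d - x c d).\<close>
    have "a \<otimes> b = (x [^] n \<otimes> x [^] m) \<otimes> (\<one> \<ominus> x \<otimes> (c \<oplus> d \<ominus> x \<otimes> (c \<otimes> d)))"
      unfolding cd using x cd(1,2) nat_pow_closed[OF x, of n] nat_pow_closed[OF x, of m] by algebra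
    also have "x [^] n \<otimes> x [^] m = x [^] (n + m)"
      using x by (simp add: nat_pow_mult)
    finally show ?thesis
      using cd x by blast
  qed
  obtain P where P: "primeideal P R" "P \<inter> ?M = {}"
    by (rule primeideal_disjoint[OF zeroideal disj one mult])
  have "x \<notin> P"
  proof -
    \<comment> \<open>The product with exponent 1 and c = 0 is \<open>x\<close> itself, so
      disjointness from \<open>?M\<close> keeps \<open>x\<close> out of \<open>P\<close>.\<close>
    have "x = x [^] (1::nat) \<otimes> (\<one> \<ominus> x \<otimes> \<zero>)"
      using x by (simp add: a_minus_def)
    then show ?thesis
      using P(2) zero_closed by blast
  qed
  obtain Q where Q: "maximalideal Q R" "P \<subseteq> Q"
    using maximalideal_exists[of P] P(1) unfolding primeideal_iff by auto
  have "P = Q"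
    using assms P(1) Q maximalideal_prime by blast
  then obtain i r where ir: "i \<in> P" "r \<in> carrier R" "i \<oplus> r \<otimes> x = \<one>"
    using maximalideal_comaximal[OF Q(1) x] \<open>x \<notin> P\<close> by metis
  have ic: "i \<in> carrier R"
    by (rule ideal.Icarr[OF primeideal.axioms(1)[OF P(1)] ir(1)])
  have "i = (i \<oplus> r \<otimes> x) \<ominus> x \<otimes> r"
    using ic ir(2) x by algebra
  also have "\<dots> = x [^] (0::nat) \<otimes> (\<one> \<ominus> x \<otimes> r)"
    using ir x by simp
  finally have "i = x [^] (0::nat) \<otimes> (\<one> \<ominus> x \<otimes> r)" .
  then have "i \<in> ?M"
    using ir(2) by (intro CollectI exI conjI)
  then show False
    using ir(1) P(2) by (meson disjoint_iff)
qed

lemma prime_height_ge_1: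
  assumes "P \<in> Spec R" "Q \<in> Spec R" "Q \<subset> P"
  shows "1 \<le> prime_height R P"
proof -
  have "enat 1 \<le> prime_height R P"
    unfolding prime_height_def
    by (rule Sup_upper, rule CollectI, intro exI[of _ "1::nat"] conjI refl exI[of _ "\<lambda>i. if i = 0 then Q else P"])
      (use assms in auto)
  then show ?thesis
    by (simp add: one_enat_def)
qed

lemma pi_regular_if_krull_dim_0:
  assumes "cring B" "krull_dim B = 0"
  shows "pi_regular B"
proof (rule cring.pi_regular_if_primes_incomparable[OF assms(1)], rule ccontr)
  fix P Q assume PQ: "primeideal P B" "primeideal Q B" "P \<subseteq> Q" "P \<noteq> Q"
  then have "1 \<le> prime_height B Q"
    by (intro prime_height_ge_1) (auto simp: Spec_def)
  then have "ereal_of_enat 1 \<le> ereal_of_enat (prime_height B Q)"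
    by simp
  also have "\<dots> \<le> krull_dim B"
    unfolding krull_dim_def using PQ by (intro SUP_upper) (auto simp: Spec_def)
  finally show False
    using assms(2) by (simp add: one_enat_def zero_ereal_def)
qed

text \<open>Multiplication by x^(n+k) absorbs b^k and leaves x^n. In \<open>eval p b\<close> the
  exponents of \<open>b\<close> stay below \<open>length p\<close>, so after multiplying by x^(n +
  length p) every term keeps at least one spare factor \<open>x\<close> and a coefficient from
  \<open>C\<close>.\<close>

lemma (in cring) pi_regular_subring_aux:
  assumes C: "subring C R" and x: "x \<in> C" and b: "b \<in> carrier R"
    and xb: "x [^] (n::nat) \<otimes> (x \<otimes> b) = x [^] n" and p: "set p \<subseteq> C"
  shows "\<exists>c\<in>C. x [^] (n + length p) \<otimes> eval p b = x [^] n \<otimes> (x \<otimes> c)"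
    and "x [^] (n + k) \<otimes> b [^] k = x [^] n"
proof -
  have xc: "x \<in> carrier R"
    using subringE(1)[OF C] x by blast
  show pw: "x [^] (n + k) \<otimes> b [^] k = x [^] n" for k
  proof (induction k)
    case 0
    then show ?case
      using xc by simp
  next
    case (Suc k)
    have "x [^] (n + Suc k) \<otimes> b [^] Suc k = (x [^] (n + k) \<otimes> b [^] k) \<otimes> (x \<otimes> b)"
      using xc b nat_pow_closed[OF xc, of "n + k"] nat_pow_closed[OF b, of k]
      by (simp add: m_ac)
    then show ?case
      using Suc xb by simp
  qed
  show "\<exists>c\<in>C. x [^] (n + length p) \<otimes> eval p b = x [^] n \<otimes> (x \<otimes> c)"
    using p
  proof (induction p)
    case Nil
    then show ?case
      using xc subringE(2)[OF C] by (intro bexI[of _ \<zero>]) auto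
  next
    case (Cons a p)
    then obtain c where c: "c \<in> C" "x [^] (n + length p) \<otimes> eval p b = x [^] n \<otimes> (x \<otimes> c)"
      by auto
    have carr: "a \<in> carrier R" "c \<in> carrier R" "eval p b \<in> carrier R"
      using Cons.prems c(1) subringE(1)[OF C] b by (auto intro!: eval_in_carrier)
    define u v w where "u = x [^] (n + length p)" and "v = b [^] length p" and "w = x [^] n"
    have uvw: "u \<in> carrier R" "v \<in> carrier R" "w \<in> carrier R"
      using xc b by (auto simp: u_def v_def w_def)
    have "x [^] (n + length (a # p)) \<otimes> eval (a # p) b = (x \<otimes> a) \<otimes> (u \<otimes> v) \<oplus> x \<otimes> (u \<otimes> eval p b)"
      using xc b carr uvw by (simp flip: u_def v_def add: r_distr m_ac)
    also have "\<dots> = (x \<otimes> a) \<otimes> w \<oplus> x \<otimes> (w \<otimes> (x \<otimes> c))"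
      using pw[of "length p"] c(2) by (simp add: u_def v_def w_def)
    also have "\<dots> = w \<otimes> (x \<otimes> (a \<oplus> x \<otimes> c))"
      using carr xc uvw by algebra
    finally show ?case
      unfolding w_def using c x Cons.prems C subringE(6,7)[OF C]
      by (intro bexI[of _ "a \<oplus> x \<otimes> c"]) auto
  qed
qed

text \<open>The element \<open>b\<close> witnessing the condition in \<open>R\<close> may lie
  outside \<open>C\<close>, but it is integral over \<open>A\<close>. Multiplying its monic equation
  by x^(n + length p) turns the leading term into x^n and the rest into x^n (x c) with
  \<open>c\<close> in \<open>C\<close>, so \<open>\<ominus> c\<close> can replace
  \<open>b\<close>.\<close>

lemma (in cring) pi_regular_subring:
  assumes "pi_regular R" "integral_extension A R" "subring C R" "A \<subseteq> C"
  shows "pi_regular (R\<lparr>carrier := C\<rparr>)"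
proof -
  have "\<exists>n::nat. \<exists>c\<in>C. x [^] n \<otimes> (x \<otimes> c) = x [^] n" if x: "x \<in> C" for x
  proof -
    have xc: "x \<in> carrier R"
      using x subringE(1)[OF assms(3)] by blast
    obtain n :: nat and b where b: "b \<in> carrier R" "x [^] n \<otimes> (x \<otimes> b) = x [^] n"
      using assms(1) xc unfolding pi_regular_def by blast
    obtain p where p: "set p \<subseteq> A" "eval (\<one> # p) b = \<zero>"
      using assms(2) b(1) unfolding integral_extension_def by blast
    then have pC: "set p \<subseteq> C"
      using assms(4) by blast
    then have ev: "eval p b \<in> carrier R"
      using subringE(1)[OF assms(3)] b(1) by (intro eval_in_carrier) auto
    obtain c where c: "c \<in> C" "x [^] (n + length p) \<otimes> eval p b = x [^] n \<otimes> (x \<otimes> c)"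
      using pi_regular_subring_aux(1)[OF assms(3) x b pC] by blast
    have cc: "c \<in> carrier R"
      using c(1) subringE(1)[OF assms(3)] by blast
    have "\<zero> = x [^] (n + length p) \<otimes> eval (\<one> # p) b"
      using p(2) xc by simp
    also have "\<dots> = x [^] (n + length p) \<otimes> b [^] length p \<oplus> x [^] (n + length p) \<otimes> eval p b"
      using xc b(1) ev by (simp add: r_distr)
    also have "\<dots> = x [^] n \<oplus> x [^] n \<otimes> (x \<otimes> c)"
      using c(2) pi_regular_subring_aux(2)[OF assms(3) x b pC] by simp
    finally have "x [^] n \<otimes> (x \<otimes> (\<ominus> c)) = x [^] n"
      using xc cc by (metis m_closed minus_equality nat_pow_closed r_minus)
    then show ?thesis
      using c(1) subringE(5)[OF assms(3)] by blast
  qed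
  then show ?thesis
    unfolding pi_regular_def by (simp add: nat_pow_def)
qed


section \<open>Rings of fractions\<close>

locale multiplicative_set = cring +
  fixes M
  assumes M_subset: "M \<subseteq> carrier R" and M_one: "\<one> \<in> M"
    and M_mult: "\<And>s t. \<lbrakk>s \<in> M; t \<in> M\<rbrakk> \<Longrightarrow> s \<otimes> t \<in> M"
begin

lemma M_carrier: "s \<in> M \<Longrightarrow> s \<in> carrier R"
  using M_subset by blast

lemma loc_rel_iff:
  "((a, s), (b, t)) \<in> loc_rel R M \<longleftrightarrow> a \<in> carrier R \<and> s \<in> M \<and> b \<in> carrier R \<and> t \<in> M \<and>
     (\<exists>u\<in>M. u \<otimes> (a \<otimes> t) = u \<otimes> (b \<otimes> s))"
proof -
  have "u \<otimes> (a \<otimes> t \<ominus> b \<otimes> s) = \<zero> \<longleftrightarrow> u \<otimes> (a \<otimes> t) = u \<otimes> (b \<otimes> s)"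
    if "a \<in> carrier R" "s \<in> M" "b \<in> carrier R" "t \<in> M" "u \<in> M" for u
  proof -
    have "u \<otimes> (a \<otimes> t \<ominus> b \<otimes> s) = u \<otimes> (a \<otimes> t) \<ominus> u \<otimes> (b \<otimes> s)"
      using that M_carrier[of s] M_carrier[of t] M_carrier[of u] by algebra
    then show ?thesis
      using that M_carrier by simp
  qed
  then show ?thesis
    unfolding loc_rel_def by auto
qed

lemma loc_rel_equiv: "equiv (carrier R \<times> M) (loc_rel R M)"
proof (rule equivI)
  show "loc_rel R M \<subseteq> (carrier R \<times> M) \<times> carrier R \<times> M"
    by (auto simp: loc_rel_iff)
  show "refl_on (carrier R \<times> M) (loc_rel R M)"
    using M_one by (auto simp: refl_on_def loc_rel_iff)
  show "sym (loc_rel R M)"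
    by (rule symI) (auto simp: loc_rel_iff, metis)
  show "trans (loc_rel R M)"
  proof (rule transI, clarify)
    fix a s b t c r
    assume "((a, s), (b, t)) \<in> loc_rel R M" "((b, t), (c, r)) \<in> loc_rel R M"
    then obtain u v where
      carr: "a \<in> carrier R" "b \<in> carrier R" "c \<in> carrier R" "s \<in> M" "t \<in> M" "r \<in> M" "u \<in> M" "v \<in> M"
      and u: "u \<otimes> (a \<otimes> t) = u \<otimes> (b \<otimes> s)" and v: "v \<otimes> (b \<otimes> r) = v \<otimes> (c \<otimes> t)"
      unfolding loc_rel_iff by auto
    note mc = M_carrier[OF carr(4)] M_carrier[OF carr(5)] M_carrier[OF carr(6)]
      M_carrier[OF carr(7)] M_carrier[OF carr(8)]
    \<comment> \<open>The common multiplier includes the middle denominator \<open>t\<close>, which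
      cannot be cancelled when it is a zero divisor.\<close>
    have "((u \<otimes> v) \<otimes> t) \<otimes> (a \<otimes> r) = (u \<otimes> (a \<otimes> t)) \<otimes> (v \<otimes> r)"
      using carr(1-3) mc by algebra
    also have "\<dots> = (v \<otimes> (b \<otimes> r)) \<otimes> (u \<otimes> s)"
      unfolding u using carr(1-3) mc by algebra
    also have "\<dots> = ((u \<otimes> v) \<otimes> t) \<otimes> (c \<otimes> s)"
      unfolding v using carr(1-3) mc by algebra
    finally show "((a, s), (c, r)) \<in> loc_rel R M"
      unfolding loc_rel_iff using carr M_mult[OF M_mult[OF carr(7,8)] carr(5)] by auto
  qed
qed

lemma fraction_eq_iff:
  assumes "a \<in> carrier R" "s \<in> M" "b \<in> carrier R" "t \<in> M"
  shows "fraction R M a s = fraction R M b t \<longleftrightarrow> (\<exists>u\<in>M. u \<otimes> (a \<otimes> t) = u \<otimes> (b \<otimes> s))"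
  unfolding fraction_def using assms by (subst eq_equiv_class_iff[OF loc_rel_equiv]) (auto simp: loc_rel_iff)

lemma fraction_eqI:
  assumes "a \<in> carrier R" "s \<in> M" "b \<in> carrier R" "t \<in> M" "a \<otimes> t = b \<otimes> s"
  shows "fraction R M a s = fraction R M b t"
  using assms M_one by (subst fraction_eq_iff) auto

lemma mem_fraction_iff:
  assumes "a \<in> carrier R" "s \<in> M"
  shows "p \<in> fraction R M a s \<longleftrightarrow>
    (\<exists>b t. p = (b, t) \<and> b \<in> carrier R \<and> t \<in> M \<and> fraction R M b t = fraction R M a s)"
proof (cases p)
  case (Pair b t)
  have "(b, t) \<in> fraction R M a s \<longleftrightarrow> ((a, s), (b, t)) \<in> loc_rel R M"
    by (simp add: fraction_def)
  also have "\<dots> \<longleftrightarrow> b \<in> carrier R \<and> t \<in> M \<and> fraction R M a s = fraction R M b t"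
    using assms unfolding loc_rel_iff by (metis fraction_eq_iff)
  finally show ?thesis
    using Pair by auto
qed

text \<open>The operations of \<open>localization\<close> are unions over all representatives; once
  the inner set is independent of the representatives, the union collapses to its value at one
  pair.\<close>

lemma UN_fraction:
  assumes "a \<in> carrier R" "s \<in> M" "b \<in> carrier R" "t \<in> M"
    and "\<And>a' s' b' t'. \<lbrakk>a' \<in> carrier R; s' \<in> M; b' \<in> carrier R; t' \<in> M;
      fraction R M a' s' = fraction R M a s; fraction R M b' t' = fraction R M b t\<rbrakk> \<Longrightarrow>
      F a' s' b' t' = F a s b t"
  shows "(\<Union>(a, s) \<in> fraction R M a s. \<Union>(b, t) \<in> fraction R M b t. F a s b t) = F a s b t"
proof -
  have "(\<lambda>(a', s'). \<Union>(b', t') \<in> fraction R M b t. F a' s' b' t') p = F a s b t"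
    if p: "p \<in> fraction R M a s" for p
  proof -
    obtain a' s' where *: "p = (a', s')" "a' \<in> carrier R" "s' \<in> M" "fraction R M a' s' = fraction R M a s"
      using p unfolding mem_fraction_iff[OF assms(1,2)] by metis
    have "(\<lambda>(b', t'). F a' s' b' t') q = F a s b t" if q: "q \<in> fraction R M b t" for q
    proof -
      obtain b' t' where "q = (b', t')" "b' \<in> carrier R" "t' \<in> M" "fraction R M b' t' = fraction R M b t"
        using q unfolding mem_fraction_iff[OF assms(3,4)] by metis
      then show ?thesis
        using assms(5)[OF *(2,3) _ _ *(4)] by simp
    qed
    moreover have "(b, t) \<in> fraction R M b t"
      using assms(3,4) by (simp add: mem_fraction_iff)
    ultimately show ?thesis
      unfolding *(1) prod.case by (intro UN_constant_eq) auto
  qed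
  moreover have "(a, s) \<in> fraction R M a s"
    using assms(1,2) by (simp add: mem_fraction_iff)
  ultimately show ?thesis
    by (intro UN_constant_eq) auto
qed

lemma carrier_localization:
  "carrier (localization R M) = {fraction R M a s | a s. a \<in> carrier R \<and> s \<in> M}"
  unfolding localization_def quotient_def fraction_def by auto

lemma fraction_closed [intro]:
  "\<lbrakk>a \<in> carrier R; s \<in> M\<rbrakk> \<Longrightarrow> fraction R M a s \<in> carrier (localization R M)"
  unfolding carrier_localization by auto

lemma localizationE:
  assumes "x \<in> carrier (localization R M)"
  obtains a s where "a \<in> carrier R" "s \<in> M" "x = fraction R M a s"
  using assms unfolding carrier_localization by auto

lemma fraction_mult:
  assumes "a \<in> carrier R" "s \<in> M" "b \<in> carrier R" "t \<in> M"
  shows "fraction R M a s \<otimes>\<^bsub>localization R M\<^esub> fraction R M b t = fraction R M (a \<otimes> b) (s \<otimes> t)"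
  unfolding localization_def monoid.simps
proof (subst UN_fraction[OF assms, of "\<lambda>a s b t. fraction R M (a \<otimes> b) (s \<otimes> t)"])
  fix a' s' b' t'
  assume carr: "a' \<in> carrier R" "s' \<in> M" "b' \<in> carrier R" "t' \<in> M"
    and eq: "fraction R M a' s' = fraction R M a s" "fraction R M b' t' = fraction R M b t"
  obtain u v where uv: "u \<in> M" "u \<otimes> (a' \<otimes> s) = u \<otimes> (a \<otimes> s')" "v \<in> M" "v \<otimes> (b' \<otimes> t) = v \<otimes> (b \<otimes> t')"
    using eq carr assms by (auto simp: fraction_eq_iff)
  note mc = carr(1,3) assms(1,3) M_carrier[OF carr(2)] M_carrier[OF carr(4)] M_carrier[OF assms(2)]
    M_carrier[OF assms(4)] M_carrier[OF uv(1)] M_carrier[OF uv(3)]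
  have "(u \<otimes> v) \<otimes> ((a' \<otimes> b') \<otimes> (s \<otimes> t)) = (u \<otimes> (a' \<otimes> s)) \<otimes> (v \<otimes> (b' \<otimes> t))"
    using mc by algebra
  also have "\<dots> = (u \<otimes> v) \<otimes> ((a \<otimes> b) \<otimes> (s' \<otimes> t'))"
    unfolding uv(2,4) using mc by algebra
  finally show "fraction R M (a' \<otimes> b') (s' \<otimes> t') = fraction R M (a \<otimes> b) (s \<otimes> t)"
    using carr assms uv M_mult by (subst fraction_eq_iff) auto
qed simp

lemma fraction_add:
  assumes "a \<in> carrier R" "s \<in> M" "b \<in> carrier R" "t \<in> M"
  shows "fraction R M a s \<oplus>\<^bsub>localization R M\<^esub> fraction R M b t =
    fraction R M (a \<otimes> t \<oplus> b \<otimes> s) (s \<otimes> t)"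
  unfolding localization_def ring.simps
proof (subst UN_fraction[OF assms, of "\<lambda>a s b t. fraction R M (a \<otimes> t \<oplus> b \<otimes> s) (s \<otimes> t)"])
  fix a' s' b' t'
  assume carr: "a' \<in> carrier R" "s' \<in> M" "b' \<in> carrier R" "t' \<in> M"
    and eq: "fraction R M a' s' = fraction R M a s" "fraction R M b' t' = fraction R M b t"
  obtain u v where uv: "u \<in> M" "u \<otimes> (a' \<otimes> s) = u \<otimes> (a \<otimes> s')" "v \<in> M" "v \<otimes> (b' \<otimes> t) = v \<otimes> (b \<otimes> t')"
    using eq carr assms by (auto simp: fraction_eq_iff)
  note mc = carr(1,3) assms(1,3) M_carrier[OF carr(2)] M_carrier[OF carr(4)] M_carrier[OF assms(2)]
    M_carrier[OF assms(4)] M_carrier[OF uv(1)] M_carrier[OF uv(3)]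
  have "(u \<otimes> v) \<otimes> ((a' \<otimes> t' \<oplus> b' \<otimes> s') \<otimes> (s \<otimes> t)) =
    (u \<otimes> (a' \<otimes> s)) \<otimes> (v \<otimes> (t \<otimes> t')) \<oplus> (v \<otimes> (b' \<otimes> t)) \<otimes> (u \<otimes> (s \<otimes> s'))"
    using mc by algebra
  also have "\<dots> = (u \<otimes> v) \<otimes> ((a \<otimes> t \<oplus> b \<otimes> s) \<otimes> (s' \<otimes> t'))"
    unfolding uv(2,4) using mc by algebra
  finally have "(u \<otimes> v) \<otimes> ((a' \<otimes> t' \<oplus> b' \<otimes> s') \<otimes> (s \<otimes> t)) = (u \<otimes> v) \<otimes> ((a \<otimes> t \<oplus> b \<otimes> s) \<otimes> (s' \<otimes> t'))" .
  then show "fraction R M (a' \<otimes> t' \<oplus> b' \<otimes> s') (s' \<otimes> t') = fraction R M (a \<otimes> t \<oplus> b \<otimes> s) (s \<otimes> t)"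
    using mc M_mult[OF uv(1,3)] M_mult[OF carr(2,4)] M_mult[OF assms(2,4)]
    by (subst fraction_eq_iff) auto
qed simp

lemma localization_one: "\<one>\<^bsub>localization R M\<^esub> = fraction R M \<one> \<one>"
  and localization_zero: "\<zero>\<^bsub>localization R M\<^esub> = fraction R M \<zero> \<one>"
  unfolding localization_def by simp_all

lemma fraction_eq_zero_iff:
  assumes "a \<in> carrier R" "s \<in> M"
  shows "fraction R M a s = \<zero>\<^bsub>localization R M\<^esub> \<longleftrightarrow> (\<exists>u\<in>M. u \<otimes> a = \<zero>)"
  using assms M_carrier M_one unfolding localization_zero by (subst fraction_eq_iff) auto

lemma localization_cring: "cring (localization R M)"
proof (rule cringI)
  let ?L = "localization R M"
  note simps = fraction_add fraction_mult M_mult M_one M_carrier localization_zero localization_one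
  show "abelian_group ?L"
  proof (rule abelian_groupI)
    fix x y assume "x \<in> carrier ?L" "y \<in> carrier ?L"
    then obtain a s b t where *: "a \<in> carrier R" "s \<in> M" "x = fraction R M a s"
      "b \<in> carrier R" "t \<in> M" "y = fraction R M b t"
      by (metis localizationE)
    show "x \<oplus>\<^bsub>?L\<^esub> y \<in> carrier ?L"
      using * by (auto simp: simps)
    show "x \<oplus>\<^bsub>?L\<^esub> y = y \<oplus>\<^bsub>?L\<^esub> x"
      using * by (simp add: simps a_comm m_comm[of s t])
  next
    fix x y z assume "x \<in> carrier ?L" "y \<in> carrier ?L" "z \<in> carrier ?L"
    then obtain a s b t c r where *: "a \<in> carrier R" "s \<in> M" "x = fraction R M a s"
      "b \<in> carrier R" "t \<in> M" "y = fraction R M b t" "c \<in> carrier R" "r \<in> M" "z = fraction R M c r"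
      by (metis localizationE)
    note mc = M_carrier[OF *(2)] M_carrier[OF *(5)] M_carrier[OF *(8)]
    have "(a \<otimes> t \<oplus> b \<otimes> s) \<otimes> r \<oplus> c \<otimes> (s \<otimes> t) = a \<otimes> (t \<otimes> r) \<oplus> (b \<otimes> r \<oplus> c \<otimes> t) \<otimes> s"
      using *(1,4,7) mc by algebra
    then show "x \<oplus>\<^bsub>?L\<^esub> y \<oplus>\<^bsub>?L\<^esub> z = x \<oplus>\<^bsub>?L\<^esub> (y \<oplus>\<^bsub>?L\<^esub> z)"
      using * by (simp add: simps m_assoc)
  next
    fix x assume "x \<in> carrier ?L"
    then obtain a s where *: "a \<in> carrier R" "s \<in> M" "x = fraction R M a s"
      by (metis localizationE)
    note mc = M_carrier[OF *(2)]
    show "\<zero>\<^bsub>?L\<^esub> \<oplus>\<^bsub>?L\<^esub> x = x"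
      using * by (simp add: simps)
    have "fraction R M (\<ominus> a) s \<oplus>\<^bsub>?L\<^esub> x = \<zero>\<^bsub>?L\<^esub>"
      using * mc by (simp add: simps) (rule fraction_eqI, auto simp: simps l_minus l_neg)
    then show "\<exists>y\<in>carrier ?L. y \<oplus>\<^bsub>?L\<^esub> x = \<zero>\<^bsub>?L\<^esub>"
      using * by blast
  qed (auto simp: simps)
  show "comm_monoid ?L"
  proof (rule comm_monoidI)
    fix x y assume "x \<in> carrier ?L" "y \<in> carrier ?L"
    then obtain a s b t where *: "a \<in> carrier R" "s \<in> M" "x = fraction R M a s"
      "b \<in> carrier R" "t \<in> M" "y = fraction R M b t"
      by (metis localizationE)
    show "x \<otimes>\<^bsub>?L\<^esub> y \<in> carrier ?L"
      using * by (auto simp: simps)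
    show "x \<otimes>\<^bsub>?L\<^esub> y = y \<otimes>\<^bsub>?L\<^esub> x"
      using * by (simp add: simps m_comm[of a b] m_comm[of s t])
  next
    fix x y z assume "x \<in> carrier ?L" "y \<in> carrier ?L" "z \<in> carrier ?L"
    then obtain a s b t c r where *: "a \<in> carrier R" "s \<in> M" "x = fraction R M a s"
      "b \<in> carrier R" "t \<in> M" "y = fraction R M b t" "c \<in> carrier R" "r \<in> M" "z = fraction R M c r"
      by (metis localizationE)
    then show "x \<otimes>\<^bsub>?L\<^esub> y \<otimes>\<^bsub>?L\<^esub> z = x \<otimes>\<^bsub>?L\<^esub> (y \<otimes>\<^bsub>?L\<^esub> z)"
      by (simp add: simps m_assoc)
  next
    fix x assume "x \<in> carrier ?L"
    then obtain a s where *: "a \<in> carrier R" "s \<in> M" "x = fraction R M a s"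
      by (metis localizationE)
    then show "\<one>\<^bsub>?L\<^esub> \<otimes>\<^bsub>?L\<^esub> x = x"
      by (simp add: simps)
  qed (auto simp: simps)
  fix x y z assume "x \<in> carrier ?L" "y \<in> carrier ?L" "z \<in> carrier ?L"
  then obtain a s b t c r where *: "a \<in> carrier R" "s \<in> M" "x = fraction R M a s"
    "b \<in> carrier R" "t \<in> M" "y = fraction R M b t" "c \<in> carrier R" "r \<in> M" "z = fraction R M c r"
    by (metis localizationE)
  note mc = M_carrier[OF *(2)] M_carrier[OF *(5)] M_carrier[OF *(8)]
  have "(a \<otimes> t \<oplus> b \<otimes> s) \<otimes> c \<otimes> (s \<otimes> r \<otimes> (t \<otimes> r)) =
    (a \<otimes> c \<otimes> (t \<otimes> r) \<oplus> b \<otimes> c \<otimes> (s \<otimes> r)) \<otimes> (s \<otimes> t \<otimes> r)"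
    using *(1,4,7) mc by algebra
  then show "(x \<oplus>\<^bsub>?L\<^esub> y) \<otimes>\<^bsub>?L\<^esub> z = x \<otimes>\<^bsub>?L\<^esub> z \<oplus>\<^bsub>?L\<^esub> y \<otimes>\<^bsub>?L\<^esub> z"
    using *(1,2,4,5,7,8) mc unfolding *(3,6,9) 
    by (simp add: simps) (rule fraction_eqI, auto simp: simps)
qed

sublocale L: cring "localization R M"
  by (rule localization_cring)

lemma fraction_add_same:
  assumes "a \<in> carrier R" "b \<in> carrier R" "s \<in> M"
  shows "fraction R M a s \<oplus>\<^bsub>localization R M\<^esub> fraction R M b s = fraction R M (a \<oplus> b) s"
proof -
  note mc = M_carrier[OF assms(3)]
  have "(a \<otimes> s \<oplus> b \<otimes> s) \<otimes> s = (a \<oplus> b) \<otimes> (s \<otimes> s)"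
    using assms(1,2) mc by algebra
  then show ?thesis
    using assms mc by (simp add: fraction_add) (rule fraction_eqI, auto simp: M_mult)
qed

lemma fraction_uminus:
  assumes "a \<in> carrier R" "s \<in> M"
  shows "\<ominus>\<^bsub>localization R M\<^esub> fraction R M a s = fraction R M (\<ominus> a) s"
proof (rule L.minus_equality)
  have "fraction R M \<zero> s = \<zero>\<^bsub>localization R M\<^esub>"
    using assms M_carrier M_one by (auto simp: fraction_eq_zero_iff)
  then show "fraction R M (\<ominus> a) s \<oplus>\<^bsub>localization R M\<^esub> fraction R M a s = \<zero>\<^bsub>localization R M\<^esub>"
    using assms by (simp add: fraction_add_same l_neg)
qed (use assms in auto)

lemma fraction_cancel:
  assumes "a \<in> carrier R" "s \<in> M" "t \<in> M"
  shows "fraction R M (t \<otimes> a) (t \<otimes> s) = fraction R M a s"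
  using assms M_carrier M_mult by (intro fraction_eqI) (auto simp: m_ac)

lemma fraction_pow:
  assumes "a \<in> carrier R" "s \<in> M"
  shows "s [^] (n::nat) \<in> M"
    and "fraction R M a s [^]\<^bsub>localization R M\<^esub> n = fraction R M (a [^] n) (s [^] n)"
proof -
  show *: "s [^] n \<in> M" for n :: nat
    using assms M_mult M_one by (induction n) auto
  show "fraction R M a s [^]\<^bsub>localization R M\<^esub> n = fraction R M (a [^] n) (s [^] n)"
    using assms * by (induction n) (simp_all add: localization_one fraction_mult)
qed

text \<open>If \<open>c\<close> works for \<open>a\<close>, then c s / 1 works for a / s, since the
  factor \<open>s\<close> offsets the additional denominator.\<close>

lemma pi_regular_localization:
  assumes "pi_regular R"
  shows "pi_regular (localization R M)"
  unfolding pi_regular_def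
proof
  let ?L = "localization R M"
  fix x assume "x \<in> carrier ?L"
  then obtain a s where *: "a \<in> carrier R" "s \<in> M" "x = fraction R M a s"
    by (metis localizationE)
  obtain n :: nat and c where c: "c \<in> carrier R" "a [^] n \<otimes> (a \<otimes> c) = a [^] n"
    using assms *(1) unfolding pi_regular_def by blast
  have sc: "s \<in> carrier R"
    using * M_carrier by simp
  have "x [^]\<^bsub>?L\<^esub> n \<otimes>\<^bsub>?L\<^esub> (x \<otimes>\<^bsub>?L\<^esub> fraction R M (c \<otimes> s) \<one>) =
    fraction R M (a [^] n \<otimes> (a \<otimes> (c \<otimes> s))) (s [^] n \<otimes> s)"
    using * c(1) sc M_one fraction_pow(1)[OF *(1,2)] by (simp add: fraction_mult fraction_pow M_mult)
  also have "a [^] n \<otimes> (a \<otimes> (c \<otimes> s)) = s \<otimes> (a [^] n \<otimes> (a \<otimes> c))"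
    using *(1) c(1) sc by (simp add: m_ac)
  also have "fraction R M (s \<otimes> (a [^] n \<otimes> (a \<otimes> c))) (s [^] n \<otimes> s) = x [^]\<^bsub>?L\<^esub> n"
    unfolding c(2) using * sc fraction_pow[OF *(1,2)] by (simp add: m_comm[of _ s] fraction_cancel)
  finally show "\<exists>n::nat. \<exists>c\<in>carrier ?L. x [^]\<^bsub>?L\<^esub> n \<otimes>\<^bsub>?L\<^esub> (x \<otimes>\<^bsub>?L\<^esub> c) = x [^]\<^bsub>?L\<^esub> n"
    using c(1) sc M_one by blast
qed

lemma subring_fractions:
  assumes "subring A R" "M \<subseteq> A"
  shows "subring (fractions R M A M) (localization R M)"
proof (rule L.subringI)
  let ?L = "localization R M"
  have A: "A \<subseteq> carrier R"
    using subringE(1)[OF assms(1)] .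
  show "fractions R M A M \<subseteq> carrier ?L"
    using A unfolding fractions_def by auto
  show "\<one>\<^bsub>?L\<^esub> \<in> fractions R M A M"
    unfolding fractions_def localization_one using M_one subringE(3)[OF assms(1)] by blast
  fix x assume "x \<in> fractions R M A M"
  then obtain a s where 1: "a \<in> A" "s \<in> M" "x = fraction R M a s"
    unfolding fractions_def by blast
  then have "\<ominus>\<^bsub>?L\<^esub> x = fraction R M (\<ominus> a) s" "\<ominus> a \<in> A"
    using A fraction_uminus subringE(5)[OF assms(1)] by auto
  then show "\<ominus>\<^bsub>?L\<^esub> x \<in> fractions R M A M"
    using 1 unfolding fractions_def by blast
  fix y assume "y \<in> fractions R M A M"
  then obtain b t where 2: "b \<in> A" "t \<in> M" "y = fraction R M b t"
    unfolding fractions_def by blast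
  have "a \<in> carrier R" "b \<in> carrier R"
    using 1 2 A by auto
  then have "x \<otimes>\<^bsub>?L\<^esub> y = fraction R M (a \<otimes> b) (s \<otimes> t)"
    "x \<oplus>\<^bsub>?L\<^esub> y = fraction R M (a \<otimes> t \<oplus> b \<otimes> s) (s \<otimes> t)"
    using 1(2,3) 2(2,3) by (simp_all add: fraction_mult fraction_add)
  moreover have "a \<otimes> b \<in> A" "a \<otimes> t \<oplus> b \<otimes> s \<in> A"
    using 1 2 assms subringE(6,7)[OF assms(1)] by (auto simp: subset_iff)
  ultimately show "x \<otimes>\<^bsub>?L\<^esub> y \<in> fractions R M A M" "x \<oplus>\<^bsub>?L\<^esub> y \<in> fractions R M A M"
    using M_mult[OF 1(2) 2(2)] unfolding fractions_def by blast+
qed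

end


text \<open>Coefficients of the polynomial with root \<open>u y\<close> obtained from one with root \<open>y\<close>;
  \<open>k\<close> is the exponent of \<open>u\<close> for the head of the list.\<close>

fun scale_coeffs :: "('a, 'm) ring_scheme \<Rightarrow> 'a \<Rightarrow> nat \<Rightarrow> 'a list \<Rightarrow> 'a list" where
  "scale_coeffs T u k [] = []"
| "scale_coeffs T u k (a # p) = (u [^]\<^bsub>T\<^esub> k \<otimes>\<^bsub>T\<^esub> a) # scale_coeffs T u (Suc k) p"

lemma length_scale_coeffs [simp]: "length (scale_coeffs T u k p) = length p"
  by (induction p arbitrary: k) auto

lemma (in cring) scale_coeffs_in_subring:
  "\<lbrakk>subring A R; u \<in> A; set p \<subseteq> A\<rbrakk> \<Longrightarrow> set (scale_coeffs R u k p) \<subseteq> A"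
proof (induction p arbitrary: k)
  case (Cons a p)
  have "u [^] k \<in> A" for k :: nat
    using Cons.prems subringE(3,6)[OF Cons.prems(1)] by (induction k) auto
  then show ?case
    using Cons subringE(6)[OF Cons.prems(1)] by auto
qed auto

lemma (in cring) eval_scale_coeffs:
  assumes "u \<in> carrier R" "y \<in> carrier R" "set p \<subseteq> carrier R"
  shows "eval (scale_coeffs R u (Suc k) p) (u \<otimes> y) = u [^] (k + length p) \<otimes> eval p y"
  using assms(3)
proof (induction p arbitrary: k)
  case (Cons a p)
  have carr: "a \<in> carrier R" "eval p y \<in> carrier R"
    using Cons.prems assms by (auto intro!: eval_in_carrier)
  have "eval (scale_coeffs R u (Suc k) (a # p)) (u \<otimes> y) =
    u [^] Suc k \<otimes> a \<otimes> (u [^] length p \<otimes> y [^] length p) \<oplus> u [^] (Suc k + length p) \<otimes> eval p y"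
    using Cons assms by (simp add: nat_pow_distrib)
  also have "u [^] Suc k \<otimes> a \<otimes> (u [^] length p \<otimes> y [^] length p) =
    (u [^] Suc k \<otimes> u [^] length p) \<otimes> (a \<otimes> y [^] length p)"
    using assms(1,2) carr(1) by (simp only: nat_pow_closed m_ac m_closed)
  also have "u [^] Suc k \<otimes> u [^] length p = u [^] (Suc k + length p)"
    by (rule nat_pow_mult[OF assms(1)])
  finally show ?case
    using assms carr by (simp add: r_distr)
qed (use assms in auto)

text \<open>The monic equation of \<open>y\<close> is multiplied by the power of \<open>u\<close>
  whose exponent is the degree. The scaling of the tail \<open>p\<close> starts with exponent 1, as
  the leading coefficient has exponent 0.\<close>

lemma (in cring) integral_scale:
  assumes "subring A R" "u \<in> A" "y \<in> carrier R" "set p \<subseteq> A" "eval (\<one> # p) y = \<zero>"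
  shows "\<exists>q. set q \<subseteq> A \<and> eval (\<one> # q) (u \<otimes> y) = \<zero>"
proof (intro exI conjI)
  show "set (scale_coeffs R u 1 p) \<subseteq> A"
    using scale_coeffs_in_subring assms by blast
  have A: "u \<in> carrier R" "set p \<subseteq> carrier R"
    using assms subringE(1)[OF assms(1)] by auto
  then have ev: "eval p y \<in> carrier R"
    using assms by (auto intro!: eval_in_carrier)
  have "eval (\<one> # scale_coeffs R u 1 p) (u \<otimes> y) =
    u [^] length p \<otimes> y [^] length p \<oplus> u [^] length p \<otimes> eval p y"
    using A assms(3) eval_scale_coeffs[OF A(1) assms(3) A(2), of 0] by (simp add: nat_pow_distrib)
  also have "\<dots> = u [^] length p \<otimes> eval (\<one> # p) y"
    using A assms(3) ev by (simp add: r_distr)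
  finally show "eval (\<one> # scale_coeffs R u 1 p) (u \<otimes> y) = \<zero>"
    using assms(5) A by simp
qed

lemma eval_hom:
  assumes "ring Z" "ring T" "h \<in> ring_hom Z T" "set p \<subseteq> carrier Z" "y \<in> carrier Z"
  shows "ring.eval T (map h p) (h y) = h (ring.eval Z p y)"
proof -
  interpret ring_hom_ring Z T h
    using ring_hom_ringI2[OF assms(1-3)] .
  show ?thesis
    using assms(4)
  proof (induction p)
    case (Cons a p)
    then have "R.eval p y \<in> carrier Z"
      using assms(5) by (auto intro!: R.eval_in_carrier)
    then show ?case
      using Cons assms(5) by (simp add: hom_nat_pow)
  qed simp
qed

text \<open>Write a/s as the product of 1/s and a/1. The equation of \<open>a\<close> maps to one
  for a/1, and rescaling it by 1/s, a fraction with numerator in \<open>A\<close> and denominator in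
  \<open>M\<close>, gives one for a/s.\<close>

lemma (in multiplicative_set) integral_extension_localization:
  assumes int: "integral_extension A R" and MA: "M \<subseteq> A"
  shows "integral_extension (fractions R M A M) (localization R M)"
  unfolding integral_extension_def
proof (intro conjI ballI)
  let ?L = "localization R M" and ?A = "fractions R M A M"
  have A: "subring A R"
    using int unfolding integral_extension_def by simp
  show "cring ?L"
    by (rule localization_cring)
  show sub: "subring ?A ?L"
    by (rule subring_fractions[OF A MA])
  have hom: "(\<lambda>a. fraction R M a \<one>) \<in> ring_hom R ?L"
    using M_one by (intro ring_hom_memI) (auto simp: fraction_mult fraction_add_same localization_one)
  fix x assume "x \<in> carrier ?L"
  then obtain a s where *: "a \<in> carrier R" "s \<in> M" "x = fraction R M a s"
    by (metis localizationE)
  obtain p where p: "set p \<subseteq> A" "eval (\<one> # p) a = \<zero>"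
    using int *(1) unfolding integral_extension_def by blast
  have pc: "set (\<one> # p) \<subseteq> carrier R"
    using p(1) subringE(1)[OF A] by auto
  have "L.eval (map (\<lambda>a. fraction R M a \<one>) (\<one> # p)) (fraction R M a \<one>) = \<zero>\<^bsub>?L\<^esub>"
    using eval_hom[OF ring_axioms L.ring_axioms hom pc *(1)] p(2) by (simp add: localization_zero)
  then have ev: "L.eval (\<one>\<^bsub>?L\<^esub> # map (\<lambda>a. fraction R M a \<one>) p) (fraction R M a \<one>) = \<zero>\<^bsub>?L\<^esub>"
    by (simp only: list.map localization_one)
  have mp: "set (map (\<lambda>a. fraction R M a \<one>) p) \<subseteq> ?A"
    using p(1) M_one unfolding fractions_def by auto
  have u: "fraction R M \<one> s \<in> ?A"
    using *(2) subringE(3)[OF A] unfolding fractions_def by blast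
  have "x = fraction R M \<one> s \<otimes>\<^bsub>?L\<^esub> fraction R M a \<one>"
    using * M_one M_carrier by (simp add: fraction_mult)
  then show "\<exists>p. set p \<subseteq> ?A \<and> L.eval (\<one>\<^bsub>?L\<^esub> # p) x = \<zero>\<^bsub>?L\<^esub>"
    using L.integral_scale[OF sub u _ mp ev] *(1) M_one by auto
qed


section \<open>Fraction fields\<close>

context "domain"
begin

sublocale frac: multiplicative_set R "carrier R - {\<zero>}"
  by unfold_locales (auto simp: integral_iff)

lemma frac_eq_iff:
  assumes "a \<in> carrier R" "s \<in> carrier R - {\<zero>}" "b \<in> carrier R" "t \<in> carrier R - {\<zero>}"
  shows "fraction R (carrier R - {\<zero>}) a s = fraction R (carrier R - {\<zero>}) b t \<longleftrightarrow> a \<otimes> t = b \<otimes> s"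
proof -
  have "u \<otimes> (a \<otimes> t) = u \<otimes> (b \<otimes> s) \<longleftrightarrow> a \<otimes> t = b \<otimes> s" if "u \<in> carrier R - {\<zero>}" for u
    using that assms m_lcancel by auto
  then show ?thesis
    using assms frac.M_one by (subst frac.fraction_eq_iff) auto
qed

lemma Frac_field: "field (Frac R)"
proof -
  interpret K: cring "Frac R"
    unfolding Frac_def by (rule frac.localization_cring)
  have one_zero: "\<one>\<^bsub>Frac R\<^esub> \<noteq> \<zero>\<^bsub>Frac R\<^esub>"
    using frac.M_one by (auto simp: Frac_def frac.localization_one frac.localization_zero frac_eq_iff)
  have "x \<in> Units (Frac R)" if x: "x \<in> carrier (Frac R)" "x \<noteq> \<zero>\<^bsub>Frac R\<^esub>" for x
  proof -
    obtain a s where *: "a \<in> carrier R" "s \<in> carrier R - {\<zero>}" "x = fraction R (carrier R - {\<zero>}) a s"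
      using x(1) unfolding Frac_def by (metis frac.localizationE)
    have "a \<noteq> \<zero>"
      using x(2) * frac.M_one unfolding Frac_def by (auto simp: frac.fraction_eq_zero_iff)
    then have "fraction R (carrier R - {\<zero>}) s a \<otimes>\<^bsub>Frac R\<^esub> x = \<one>\<^bsub>Frac R\<^esub>"
      using * frac.M_mult unfolding Frac_def
      by (simp add: frac.fraction_mult frac.localization_one) (intro frac.fraction_eqI, auto simp: integral_iff m_comm)
    moreover have "fraction R (carrier R - {\<zero>}) s a \<in> carrier (Frac R)"
      using * \<open>a \<noteq> \<zero>\<close> unfolding Frac_def by (intro frac.fraction_closed) auto
    ultimately show ?thesis
      using x(1) unfolding Units_def by (auto simp: K.m_comm[of x] intro!: bexI)
  qed
  moreover have "\<zero>\<^bsub>Frac R\<^esub> \<notin> Units (Frac R)"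
  proof
    assume "\<zero>\<^bsub>Frac R\<^esub> \<in> Units (Frac R)"
    then have "\<exists>y\<in>carrier (Frac R). y \<otimes>\<^bsub>Frac R\<^esub> \<zero>\<^bsub>Frac R\<^esub> = \<one>\<^bsub>Frac R\<^esub>"
      unfolding Units_def by auto
    then show False
      using one_zero by auto
  qed
  ultimately have "Units (Frac R) = carrier (Frac R) - {\<zero>\<^bsub>Frac R\<^esub>}"
    using K.Units_closed by auto
  then show ?thesis
    by (rule K.cring_fieldI)
qed

end


section \<open>Localizing a pullback inside a field\<close>

text \<open>For a field \<open>K\<close> and a multiplicative set \<open>W\<close> in
  \<open>E\<close> without zero this is the localization of \<open>E\<close> at \<open>W\<close>,
  realized as a subset of \<open>K\<close> so that localizations of different rings can be compared
  by inclusion.\<close>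

definition fractions_within :: "('a, 'm) ring_scheme \<Rightarrow> 'a set \<Rightarrow> 'a set \<Rightarrow> 'a set" where
  "fractions_within K W E = {x \<in> carrier K. \<exists>w\<in>W. w \<otimes>\<^bsub>K\<^esub> x \<in> E}"

lemma (in cring) subring_fractions_within:
  assumes "subring E R" "W \<subseteq> E" "\<one> \<in> W" "\<And>v w. \<lbrakk>v \<in> W; w \<in> W\<rbrakk> \<Longrightarrow> v \<otimes> w \<in> W"
  shows "subring (fractions_within R W E) R"
proof (rule subringI)
  note E = subringE[OF assms(1)]
  show "fractions_within R W E \<subseteq> carrier R"
    unfolding fractions_within_def by auto
  show "\<one> \<in> fractions_within R W E"
    unfolding fractions_within_def using assms(3) E(3) by (auto intro!: bexI[of _ \<one>])
  fix x assume "x \<in> fractions_within R W E"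
  then obtain v where v: "x \<in> carrier R" "v \<in> W" "v \<otimes> x \<in> E"
    unfolding fractions_within_def by auto
  have vc: "v \<in> carrier R" "v \<in> E"
    using v(2) assms(2) E(1) by auto
  have "v \<otimes> (\<ominus> x) = \<ominus> (v \<otimes> x)"
    using v(1) vc by (simp add: r_minus)
  then show "\<ominus> x \<in> fractions_within R W E"
    unfolding fractions_within_def using v E(5) by (auto intro!: bexI[of _ v])
  fix y assume "y \<in> fractions_within R W E"
  then obtain w where w: "y \<in> carrier R" "w \<in> W" "w \<otimes> y \<in> E"
    unfolding fractions_within_def by auto
  have wc: "w \<in> carrier R" "w \<in> E"
    using w(2) assms(2) E(1) by auto
  have vw: "v \<otimes> w \<in> W"
    by (rule assms(4)[OF v(2) w(2)])
  have "(v \<otimes> w) \<otimes> (x \<otimes> y) = (v \<otimes> x) \<otimes> (w \<otimes> y)"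
    using v(1) w(1) vc(1) wc(1) by (simp add: m_ac)
  also have "\<dots> \<in> E"
    using E(6) v(3) w(3) by simp
  finally show "x \<otimes> y \<in> fractions_within R W E"
    unfolding fractions_within_def using v(1) w(1) vw by auto
  have "(v \<otimes> w) \<otimes> (x \<oplus> y) = w \<otimes> (v \<otimes> x) \<oplus> v \<otimes> (w \<otimes> y)"
    using v(1) w(1) vc(1) wc(1) by algebra
  also have "\<dots> \<in> E"
    using E(6,7) v(3) w(3) vc wc by simp
  finally show "x \<oplus> y \<in> fractions_within R W E"
    unfolding fractions_within_def using v(1) w(1) vw by auto
qed

lemma (in cring) subset_fractions_within:
  assumes "E \<subseteq> carrier R" "\<one> \<in> W"
  shows "E \<subseteq> fractions_within R W E"
  unfolding fractions_within_def using assms by (auto intro!: bexI[of _ \<one>] simp: subset_iff)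

text \<open>With \<open>S\<close> a subset of the field \<open>K\<close>, the rings \<open>R\<close>
  and \<open>S\<close>, their localizations and all overrings are literal subsets of one ring. The
  map \<open>\<psi>\<close> stands for reduction modulo \<open>J\<close>, which reappears as its
  kernel.\<close>

locale pullback_in_field = field K + B: cring B
  for K (structure) and B (structure) +
  fixes S A \<psi>
  assumes S_subring: "subring S K" and A_subring: "subring A B"
    and \<psi>_hom: "\<psi> \<in> ring_hom (K\<lparr>carrier := S\<rparr>) B" and \<psi>_surj: "\<psi> ` S = carrier B"
begin

definition R where "R = {x \<in> S. \<psi> x \<in> A}"
definition J where "J = {x \<in> S. \<psi> x = \<zero>\<^bsub>B\<^esub>}"

lemmas S_closed = subringE[OF S_subring]
lemmas A_closed = subringE[OF A_subring]

lemma \<psi>_simps: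
  "x \<in> S \<Longrightarrow> \<psi> x \<in> carrier B"
  "x \<in> S \<Longrightarrow> y \<in> S \<Longrightarrow> \<psi> (x \<otimes> y) = \<psi> x \<otimes>\<^bsub>B\<^esub> \<psi> y"
  "x \<in> S \<Longrightarrow> y \<in> S \<Longrightarrow> \<psi> (x \<oplus> y) = \<psi> x \<oplus>\<^bsub>B\<^esub> \<psi> y"
  "\<psi> \<one> = \<one>\<^bsub>B\<^esub>"
  using \<psi>_hom unfolding ring_hom_def by auto

lemma \<psi>_zero: "\<psi> \<zero> = \<zero>\<^bsub>B\<^esub>"
  using ring_hom_zero[OF \<psi>_hom] subring_is_ring[OF S_subring] B.ring_axioms by simp

lemma \<psi>_minus: "x \<in> S \<Longrightarrow> \<psi> (\<ominus> x) = \<ominus>\<^bsub>B\<^esub> \<psi> x"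
  using \<psi>_simps(1,3)[of "\<ominus> x"] \<psi>_simps(1,3)[of x] S_closed(1,5) \<psi>_zero
  by (metis B.minus_equality l_neg subsetD)

lemma S_carrier: "x \<in> S \<Longrightarrow> x \<in> carrier K"
  using S_closed(1) by blast

lemma R_subset_S: "R \<subseteq> S"
  unfolding R_def by auto

lemma R_carrier: "x \<in> R \<Longrightarrow> x \<in> carrier K"
  using R_subset_S S_carrier by blast

lemma R_subring: "subring R K"
  by (rule subringI) (auto simp: R_def S_closed A_closed \<psi>_simps \<psi>_minus S_carrier)

lemmas R_closed = subringE[OF R_subring]

lemma J_subset_R: "J \<subseteq> R"
  unfolding J_def R_def using A_closed(2) by auto

lemma J_absorb: "x \<in> J \<Longrightarrow> s \<in> S \<Longrightarrow> s \<otimes> x \<in> J"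
  unfolding J_def using S_closed(6) by (auto simp: \<psi>_simps)

lemma \<psi>_R: "\<psi> ` R = A"
proof
  show "A \<subseteq> \<psi> ` R"
  proof
    fix a assume "a \<in> A"
    then obtain s where "s \<in> S" "a = \<psi> s"
      using A_closed(1) \<psi>_surj by blast
    then show "a \<in> \<psi> ` R"
      using \<open>a \<in> A\<close> unfolding R_def by auto
  qed
qed (auto simp: R_def)

lemma \<psi>_hom_R: "\<psi> \<in> ring_hom (K\<lparr>carrier := R\<rparr>) (B\<lparr>carrier := A\<rparr>)"
  using R_subset_S by (intro ring_hom_memI) (auto simp: \<psi>_simps R_def)

text \<open>Together with \<open>prime_preimage_R\<close> this is the bijection between the primes
  of \<open>R\<close> containing \<open>J\<close> and the primes of \<open>A\<close>; it applies
  because \<open>J\<close> is the kernel of \<open>\<psi>\<close> on \<open>R\<close>.\<close>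

lemma prime_image_A:
  assumes "primeideal P (K\<lparr>carrier := R\<rparr>)" "J \<subseteq> P"
  shows "primeideal (\<psi> ` P) (B\<lparr>carrier := A\<rparr>)" "{x \<in> R. \<psi> x \<in> \<psi> ` P} = P"
proof -
  have "x \<in> P" if "x \<in> R" "\<psi> x = \<zero>\<^bsub>B\<^esub>" for x
    using that assms(2) R_subset_S unfolding J_def by auto
  with primeideal_image[OF subring_cring[OF R_subring] B.subring_cring[OF A_subring] \<psi>_hom_R _ assms(1)]
  show "primeideal (\<psi> ` P) (B\<lparr>carrier := A\<rparr>)" "{x \<in> R. \<psi> x \<in> \<psi> ` P} = P"
    using \<psi>_R by simp_all
qed

lemma prime_preimage_R:
  assumes "primeideal Q (B\<lparr>carrier := A\<rparr>)"
  shows "primeideal {x \<in> R. \<psi> x \<in> Q} (K\<lparr>carrier := R\<rparr>)" "J \<subseteq> {x \<in> R. \<psi> x \<in> Q}"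
    "\<psi> ` {x \<in> R. \<psi> x \<in> Q} = Q"
proof -
  interpret Q: primeideal Q "B\<lparr>carrier := A\<rparr>" by fact
  show "primeideal {x \<in> R. \<psi> x \<in> Q} (K\<lparr>carrier := R\<rparr>)"
    using primeideal_contraction[OF subring_cring[OF R_subring] B.subring_cring[OF A_subring] \<psi>_hom_R assms]
    by simp
  have "\<zero>\<^bsub>B\<^esub> \<in> Q" "Q \<subseteq> A"
    using Q.zeroideal additive_subgroup.zero_closed[OF Q.is_additive_subgroup] Q.a_subset by simp_all
  then show "J \<subseteq> {x \<in> R. \<psi> x \<in> Q}"
    using J_subset_R unfolding J_def by auto
  show "\<psi> ` {x \<in> R. \<psi> x \<in> Q} = Q"
  proof
    show "Q \<subseteq> \<psi> ` {x \<in> R. \<psi> x \<in> Q}"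
    proof
      fix q assume "q \<in> Q"
      then obtain x where "x \<in> R" "q = \<psi> x"
        using \<open>Q \<subseteq> A\<close> \<psi>_R by blast
      then show "q \<in> \<psi> ` {x \<in> R. \<psi> x \<in> Q}"
        using \<open>q \<in> Q\<close> by auto
    qed
  qed auto
qed

end

section \<open>The pullback square localized at a prime containing \<open>J\<close>\<close>

locale pullback_at_prime = pullback_in_field +
  fixes p
  assumes p_prime: "primeideal p (K\<lparr>carrier := R\<rparr>)" and J_subset_p: "J \<subseteq> p"
begin

definition W where "W = R - p"
definition N where "N = A - \<psi> ` p"
abbreviation Sloc where "Sloc \<equiv> fractions_within K W S"
abbreviation Rloc where "Rloc \<equiv> fractions_within K W R"
abbreviation Bloc where "Bloc \<equiv> localization B N"
abbreviation Aloc where "Aloc \<equiv> fractions B N A N"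

lemma p_props: "p \<subseteq> R" "\<zero> \<in> p" "\<one> \<notin> p" "\<And>a r. a \<in> p \<Longrightarrow> r \<in> R \<Longrightarrow> r \<otimes> a \<in> p"
  "\<And>a b. a \<in> R \<Longrightarrow> b \<in> R \<Longrightarrow> a \<otimes> b \<in> p \<Longrightarrow> a \<in> p \<or> b \<in> p"
  using p_prime unfolding cring.primeideal_iff[OF subring_cring[OF R_subring]]
    cring.ideal_iff[OF subring_cring[OF R_subring]] by auto

lemma W_props: "W \<subseteq> R" "\<one> \<in> W" "\<zero> \<notin> W" "\<And>v w. v \<in> W \<Longrightarrow> w \<in> W \<Longrightarrow> v \<otimes> w \<in> W"
proof -
  show "W \<subseteq> R" "\<one> \<in> W" "\<zero> \<notin> W"
    unfolding W_def using p_props(2,3) R_closed(3) by auto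
  show "v \<otimes> w \<in> W" if "v \<in> W" "w \<in> W" for v w
    using that p_props(5)[of v w] R_closed(6)[of v w] unfolding W_def by blast
qed

lemma W_S: "w \<in> W \<Longrightarrow> w \<in> S"
  using W_props(1) R_subset_S by blast

lemma W_carrier: "w \<in> W \<Longrightarrow> w \<in> carrier K"
  using W_S S_carrier by blast

text \<open>Membership in \<open>N\<close> can be tested on any lift: \<open>p\<close> contains the
  kernel and so is the full preimage of its image, and \<open>\<psi> w\<close> in \<open>A\<close>
  already forces \<open>w\<close> into \<open>R\<close>.\<close>

lemma \<psi>_W: "w \<in> S \<Longrightarrow> \<psi> w \<in> N \<longleftrightarrow> w \<in> W"
  using prime_image_A(2)[OF p_prime J_subset_p] unfolding N_def W_def R_def by auto

lemma N_obtain: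
  assumes "n \<in> N"
  obtains w where "w \<in> W" "n = \<psi> w"
proof -
  obtain w where "w \<in> R" "n = \<psi> w"
    using assms \<psi>_R unfolding N_def by blast
  then show thesis
    using that assms \<psi>_W R_subset_S by blast
qed

sublocale N: multiplicative_set B N
proof
  show "N \<subseteq> carrier B"
    unfolding N_def using A_closed(1) by blast
  show "\<one>\<^bsub>B\<^esub> \<in> N"
    using \<psi>_W[OF S_closed(3)] W_props(2) by (simp add: \<psi>_simps)
  show "s \<otimes>\<^bsub>B\<^esub> t \<in> N" if "s \<in> N" "t \<in> N" for s t
  proof -
    obtain v where v: "v \<in> W" "s = \<psi> v"
      by (rule N_obtain[OF \<open>s \<in> N\<close>])
    obtain w where w: "w \<in> W" "t = \<psi> w"
      by (rule N_obtain[OF \<open>t \<in> N\<close>])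
    have "s \<otimes>\<^bsub>B\<^esub> t = \<psi> (v \<otimes> w)"
      using v w W_S by (simp add: \<psi>_simps)
    then show ?thesis
      using \<psi>_W W_S W_props(4) v w by auto
  qed
qed

lemma Sloc_subring: "subring Sloc K"
  by (rule subring_fractions_within[OF S_subring]) (use W_props W_S in auto)

lemma Rloc_subring: "subring Rloc K"
  by (rule subring_fractions_within[OF R_subring]) (use W_props in auto)

lemma R_subset_Rloc: "R \<subseteq> Rloc"
  using subset_fractions_within R_closed(1) W_props(2) by blast

lemma Sloc_carrier: "x \<in> Sloc \<Longrightarrow> x \<in> carrier K"
  unfolding fractions_within_def by simp

lemma W_inverse:
  assumes "w \<in> W"
  shows "inv w \<in> Rloc" "w \<otimes> inv w = \<one>"
proof -
  have "w \<in> Units K"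
    using assms W_carrier W_props(3) field_Units by auto
  then show "w \<otimes> inv w = \<one>" "inv w \<in> Rloc"
    using assms R_closed(3) unfolding fractions_within_def by (auto intro!: bexI[of _ w])
qed

text \<open>The reduction map from the fractions of \<open>S\<close> to the fractions of \<open>B\<close>.\<close>

definition \<Theta> where
  "\<Theta> x = (let w = SOME w. w \<in> W \<and> w \<otimes> x \<in> S in fraction B N (\<psi> (w \<otimes> x)) (\<psi> w))"

text \<open>Two admissible denominators \<open>v\<close> and \<open>w\<close> give the same fraction
  because both cross products are the image of x v w; the choice made by \<open>SOME\<close> is
  therefore harmless.\<close>

lemma \<Theta>_eq:
  assumes "x \<in> carrier K" "w \<in> W" "w \<otimes> x \<in> S"
  shows "\<Theta> x = fraction B N (\<psi> (w \<otimes> x)) (\<psi> w)"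
proof -
  define v where "v = (SOME w. w \<in> W \<and> w \<otimes> x \<in> S)"
  have v: "v \<in> W" "v \<otimes> x \<in> S"
    using someI[of "\<lambda>w. w \<in> W \<and> w \<otimes> x \<in> S" w] assms unfolding v_def by auto
  have "\<psi> (v \<otimes> x) \<otimes>\<^bsub>B\<^esub> \<psi> w = \<psi> ((v \<otimes> x) \<otimes> w)"
    using v assms W_S by (simp add: \<psi>_simps)
  also have "(v \<otimes> x) \<otimes> w = (w \<otimes> x) \<otimes> v"
    using v assms W_carrier by (simp add: m_ac)
  also have "\<psi> \<dots> = \<psi> (w \<otimes> x) \<otimes>\<^bsub>B\<^esub> \<psi> v"
    using v assms W_S by (simp add: \<psi>_simps)
  finally have "fraction B N (\<psi> (v \<otimes> x)) (\<psi> v) = fraction B N (\<psi> (w \<otimes> x)) (\<psi> w)"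
    using v assms \<psi>_W W_S by (intro N.fraction_eqI) (auto simp: \<psi>_simps)
  then show ?thesis
    unfolding \<Theta>_def v_def[symmetric] by simp
qed

lemma \<Theta>_on_S:
  assumes "x \<in> S"
  shows "\<Theta> x = fraction B N (\<psi> x) \<one>\<^bsub>B\<^esub>"
  using \<Theta>_eq[of x \<one>] assms W_props(2) S_carrier by (simp add: \<psi>_simps)

lemma SlocE:
  assumes "x \<in> Sloc"
  obtains w where "x \<in> carrier K" "w \<in> W" "w \<otimes> x \<in> S" "\<Theta> x = fraction B N (\<psi> (w \<otimes> x)) (\<psi> w)"
  using assms \<Theta>_eq unfolding fractions_within_def by blast

lemma \<Theta>_hom: "\<Theta> \<in> ring_hom (K\<lparr>carrier := Sloc\<rparr>) Bloc"
proof (rule ring_hom_memI, simp_all)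
  show "\<Theta> \<one> = \<one>\<^bsub>Bloc\<^esub>"
    using \<Theta>_on_S S_closed(3) by (simp add: \<psi>_simps N.localization_one)
  fix x assume x: "x \<in> Sloc"
  obtain v where v: "x \<in> carrier K" "v \<in> W" "v \<otimes> x \<in> S" "\<Theta> x = fraction B N (\<psi> (v \<otimes> x)) (\<psi> v)"
    by (rule SlocE[OF x])
  show "\<Theta> x \<in> carrier Bloc"
    unfolding v(4) using v \<psi>_W W_S by (intro N.fraction_closed) (auto simp: \<psi>_simps)
  fix y assume y: "y \<in> Sloc"
  obtain w where w: "y \<in> carrier K" "w \<in> W" "w \<otimes> y \<in> S" "\<Theta> y = fraction B N (\<psi> (w \<otimes> y)) (\<psi> w)"
    by (rule SlocE[OF y])
  have N: "\<psi> v \<in> N" "\<psi> w \<in> N"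
    using v(2) w(2) \<psi>_W W_S by auto
  have vw: "v \<otimes> w \<in> W"
    using W_props(4) v w by simp
  have mult: "(v \<otimes> w) \<otimes> (x \<otimes> y) = (v \<otimes> x) \<otimes> (w \<otimes> y)"
    using v w W_carrier by (simp add: m_ac)
  then have "\<Theta> (x \<otimes> y) = fraction B N (\<psi> ((v \<otimes> x) \<otimes> (w \<otimes> y))) (\<psi> (v \<otimes> w))"
    using \<Theta>_eq[of "x \<otimes> y" "v \<otimes> w"] vw v(1,3) w(1,3) S_closed(6) by simp
  then show "\<Theta> (x \<otimes> y) = \<Theta> x \<otimes>\<^bsub>Bloc\<^esub> \<Theta> y"
    unfolding v(4) w(4) using v w N W_S by (simp add: N.fraction_mult \<psi>_simps)
  have add: "(v \<otimes> w) \<otimes> (x \<oplus> y) = (v \<otimes> x) \<otimes> w \<oplus> (w \<otimes> y) \<otimes> v"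
    using v(1) w(1) W_carrier[OF v(2)] W_carrier[OF w(2)] by algebra
  have inS: "(v \<otimes> x) \<otimes> w \<in> S" "(w \<otimes> y) \<otimes> v \<in> S"
    using v w W_S S_closed(6) by auto
  then have "\<Theta> (x \<oplus> y) = fraction B N (\<psi> ((v \<otimes> x) \<otimes> w \<oplus> (w \<otimes> y) \<otimes> v)) (\<psi> (v \<otimes> w))"
    using \<Theta>_eq[of "x \<oplus> y" "v \<otimes> w"] vw v(1) w(1) S_closed(7) add by simp
  then show "\<Theta> (x \<oplus> y) = \<Theta> x \<oplus>\<^bsub>Bloc\<^esub> \<Theta> y"
    unfolding v(4) w(4) using v w N W_S inS by (simp add: N.fraction_add \<psi>_simps)
qed

lemma \<Theta>_divide:
  assumes "s \<in> S" "w \<in> W"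
  shows "inv w \<otimes> s \<in> carrier K" "w \<otimes> (inv w \<otimes> s) = s" "\<Theta> (inv w \<otimes> s) = fraction B N (\<psi> s) (\<psi> w)"
proof -
  note inv = W_inverse[OF assms(2)]
  have c: "inv w \<in> carrier K" "w \<in> carrier K" "s \<in> carrier K"
    using inv(1) W_carrier assms S_carrier unfolding fractions_within_def by auto
  then show 1: "inv w \<otimes> s \<in> carrier K"
    by simp
  show 2: "w \<otimes> (inv w \<otimes> s) = s"
    using c inv(2) by (simp add: m_assoc[symmetric])
  show "\<Theta> (inv w \<otimes> s) = fraction B N (\<psi> s) (\<psi> w)"
    using \<Theta>_eq[OF 1 assms(2)] 2 assms(1) by simp
qed

lemma \<Theta>_surj: "\<Theta> ` Sloc = carrier Bloc"
proof
  show "\<Theta> ` Sloc \<subseteq> carrier Bloc"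
    using \<Theta>_hom unfolding ring_hom_def by auto
  show "carrier Bloc \<subseteq> \<Theta> ` Sloc"
  proof
    fix y assume "y \<in> carrier Bloc"
    then obtain b n where y: "b \<in> carrier B" "n \<in> N" "y = fraction B N b n"
      by (metis N.localizationE)
    obtain w where w: "w \<in> W" "n = \<psi> w"
      by (rule N_obtain[OF y(2)])
    obtain s where s: "s \<in> S" "b = \<psi> s"
      using y(1) \<psi>_surj by blast
    have "w \<otimes> (inv w \<otimes> s) \<in> S"
      using \<Theta>_divide(2)[OF s(1) w(1)] s(1) by simp
    then have "inv w \<otimes> s \<in> Sloc"
      unfolding fractions_within_def using \<Theta>_divide(1)[OF s(1) w(1)] w(1) by blast
    then show "y \<in> \<Theta> ` Sloc"
      using \<Theta>_divide(3)[OF s(1) w(1)] y(3) s w by (metis image_eqI)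
  qed
qed

text \<open>The localized square is again a pullback. If \<open>\<Theta> x\<close> equals a fraction
  over \<open>A\<close>, clearing denominators gives an equality of images in \<open>B\<close> whose
  right side lies in \<open>A\<close>; so a multiple of \<open>x\<close> by an element of
  \<open>W\<close> lies in \<open>R\<close>.\<close>

lemma \<Theta>_mem_Aloc_iff:
  assumes "x \<in> Sloc"
  shows "\<Theta> x \<in> Aloc \<longleftrightarrow> x \<in> Rloc"
proof
  assume "x \<in> Rloc"
  then obtain w where w: "x \<in> carrier K" "w \<in> W" "w \<otimes> x \<in> R"
    unfolding fractions_within_def by auto
  then have "\<Theta> x = fraction B N (\<psi> (w \<otimes> x)) (\<psi> w)"
    using \<Theta>_eq R_subset_S by blast
  moreover have "\<psi> (w \<otimes> x) \<in> A" "\<psi> w \<in> N"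
    using w \<psi>_W W_S unfolding R_def by auto
  ultimately show "\<Theta> x \<in> Aloc"
    unfolding fractions_def by blast
next
  assume "\<Theta> x \<in> Aloc"
  then obtain a n where an: "a \<in> A" "n \<in> N" "\<Theta> x = fraction B N a n"
    unfolding fractions_def by blast
  obtain r where r: "r \<in> R" "a = \<psi> r"
    using an(1) \<psi>_R by blast
  obtain v where v: "v \<in> W" "n = \<psi> v"
    by (rule N_obtain[OF an(2)])
  obtain w where w: "x \<in> carrier K" "w \<in> W" "w \<otimes> x \<in> S" "\<Theta> x = fraction B N (\<psi> (w \<otimes> x)) (\<psi> w)"
    by (rule SlocE[OF assms])
  have rS: "r \<in> S"
    using r(1) R_subset_S by blast
  have "fraction B N (\<psi> (w \<otimes> x)) (\<psi> w) = fraction B N (\<psi> r) (\<psi> v)"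
    using an(3) w(4) r v by simp
  then obtain n' where n': "n' \<in> N" "n' \<otimes>\<^bsub>B\<^esub> (\<psi> (w \<otimes> x) \<otimes>\<^bsub>B\<^esub> \<psi> v) = n' \<otimes>\<^bsub>B\<^esub> (\<psi> r \<otimes>\<^bsub>B\<^esub> \<psi> w)"
    using w v rS \<psi>_W W_S by (subst (asm) N.fraction_eq_iff) (auto simp: \<psi>_simps)
  obtain u where u: "u \<in> W" "n' = \<psi> u"
    by (rule N_obtain[OF n'(1)])
  have "\<psi> (u \<otimes> ((w \<otimes> x) \<otimes> v)) = \<psi> (u \<otimes> (r \<otimes> w))"
    using n'(2) u w(2,3) v rS W_S S_closed(6) by (simp add: \<psi>_simps)
  moreover have "u \<otimes> (r \<otimes> w) \<in> R"
    using u(1) r(1) w(2) W_props(1) R_closed(6) by (meson subsetD)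
  ultimately have "u \<otimes> ((w \<otimes> x) \<otimes> v) \<in> R"
    using u(1) w(2,3) v(1) W_S S_closed(6) unfolding R_def by auto
  also have "u \<otimes> ((w \<otimes> x) \<otimes> v) = (u \<otimes> w \<otimes> v) \<otimes> x"
    using u(1) v(1) w(1,2) W_carrier by (simp add: m_ac)
  finally show "x \<in> Rloc"
    unfolding fractions_within_def using W_props(4) u(1) v(1) w(1,2) by blast
qed

text \<open>A fraction over \<open>B\<close> vanishes if some element of \<open>N\<close> kills its
  numerator; lifting that element to \<open>W\<close> moves the numerator over \<open>S\<close> into
  \<open>J\<close>. Thus the kernel of \<open>\<Theta>\<close> is the localization of
  \<open>J\<close>.\<close>

lemma \<Theta>_kernel:
  assumes "x \<in> Sloc" "\<Theta> x = \<zero>\<^bsub>Bloc\<^esub>"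
  obtains w where "w \<in> W" "w \<otimes> x \<in> J"
proof -
  obtain w where w: "x \<in> carrier K" "w \<in> W" "w \<otimes> x \<in> S" "\<Theta> x = fraction B N (\<psi> (w \<otimes> x)) (\<psi> w)"
    by (rule SlocE[OF assms(1)])
  have "\<exists>n\<in>N. n \<otimes>\<^bsub>B\<^esub> \<psi> (w \<otimes> x) = \<zero>\<^bsub>B\<^esub>"
    using assms(2) w \<psi>_W W_S by (auto simp: N.fraction_eq_zero_iff \<psi>_simps)
  then obtain n where n: "n \<in> N" "n \<otimes>\<^bsub>B\<^esub> \<psi> (w \<otimes> x) = \<zero>\<^bsub>B\<^esub>"
    by blast
  obtain u where u: "u \<in> W" "n = \<psi> u"
    by (rule N_obtain[OF n(1)])
  have "u \<otimes> (w \<otimes> x) \<in> J"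
    using u n(2) w(3) W_S S_closed(6) unfolding J_def by (simp add: \<psi>_simps)
  then have "(u \<otimes> w) \<otimes> x \<in> J"
    using u w W_carrier by (simp add: m_ac)
  then show thesis
    using that W_props(4) u w by blast
qed

end


section \<open>Fragility in terms of the pullback\<close>

lemma (in cring) prime_in_subringD:
  assumes "subring L R" "primeideal Q (R\<lparr>carrier := L\<rparr>)"
  shows "Q \<subseteq> L" "\<zero> \<in> Q" "\<one> \<notin> Q" "\<And>a b. \<lbrakk>a \<in> Q; b \<in> Q\<rbrakk> \<Longrightarrow> a \<oplus> b \<in> Q"
    "\<And>a r. \<lbrakk>a \<in> Q; r \<in> L\<rbrakk> \<Longrightarrow> r \<otimes> a \<in> Q"
    "\<And>a b. \<lbrakk>a \<in> L; b \<in> L; a \<otimes> b \<in> Q\<rbrakk> \<Longrightarrow> a \<in> Q \<or> b \<in> Q"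
  using assms(2) unfolding cring.primeideal_iff[OF subring_cring[OF assms(1)]]
    cring.ideal_iff[OF subring_cring[OF assms(1)]] by auto

lemma (in cring) prime_in_subringI:
  assumes "subring L R" "Q \<subseteq> L" "\<zero> \<in> Q" "\<one> \<notin> Q" "\<And>a b. \<lbrakk>a \<in> Q; b \<in> Q\<rbrakk> \<Longrightarrow> a \<oplus> b \<in> Q"
    "\<And>a r. \<lbrakk>a \<in> Q; r \<in> L\<rbrakk> \<Longrightarrow> r \<otimes> a \<in> Q"
    "\<And>a b. \<lbrakk>a \<in> L; b \<in> L; a \<otimes> b \<in> Q\<rbrakk> \<Longrightarrow> a \<in> Q \<or> b \<in> Q"
  shows "primeideal Q (R\<lparr>carrier := L\<rparr>)"
  using assms(2-7) unfolding cring.primeideal_iff[OF subring_cring[OF assms(1)]]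
    cring.ideal_iff[OF subring_cring[OF assms(1)]] by simp

text \<open>The condition of fragility, transported to \<open>K\<close>: the minimal prime of the
  localized base ring is replaced by the prime \<open>p\<close> of \<open>R\<close>.\<close>

definition two_primes_over :: "('a, 'm) ring_scheme \<Rightarrow> 'a set \<Rightarrow> 'a set \<Rightarrow> 'a set \<Rightarrow> bool" where
  "two_primes_over K R L p \<longleftrightarrow>
     (\<exists>P Q. primeideal P (K\<lparr>carrier := L\<rparr>) \<and> primeideal Q (K\<lparr>carrier := L\<rparr>) \<and>
       P \<noteq> Q \<and> P \<inter> R = p \<and> Q \<inter> R = p)"

locale zero_dim_pullback = pullback_in_field +
  assumes integral: "integral_extension A B" and B_pi_regular: "pi_regular B"
begin

text \<open>Primes of \<open>R\<close> containing \<open>J\<close> are primes of \<open>A\<close>,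
  and \<open>A\<close> inherits pi-regularity from \<open>B\<close> by integrality.\<close>

lemma prime_R_eq:
  assumes "primeideal P (K\<lparr>carrier := R\<rparr>)" "primeideal Q (K\<lparr>carrier := R\<rparr>)" "J \<subseteq> P" "P \<subseteq> Q"
  shows "P = Q"
proof -
  have "pi_regular (B\<lparr>carrier := A\<rparr>)"
    using B.pi_regular_subring[OF B_pi_regular integral A_subring] by simp
  moreover have "\<psi> ` P \<subseteq> \<psi> ` Q" "J \<subseteq> Q"
    using image_mono[OF assms(4)] order_trans[OF assms(3,4)] by simp_all
  ultimately have "\<psi> ` P = \<psi> ` Q"
    by (intro cring.pi_regular_prime_eq[OF B.subring_cring[OF A_subring]] prime_image_A(1) assms)
  then show ?thesis
    using prime_image_A(2)[OF assms(1,3)] prime_image_A(2)[OF assms(2) \<open>J \<subseteq> Q\<close>] by metis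
qed

end

locale zero_dim_pullback_at_prime = zero_dim_pullback + pullback_at_prime
begin

lemma Bloc_pi_regular: "pi_regular Bloc"
  by (rule N.pi_regular_localization[OF B_pi_regular])

lemma N_subset_A: "N \<subseteq> A"
  unfolding N_def by auto

lemma integral_loc: "integral_extension Aloc Bloc"
  by (rule N.integral_extension_localization[OF integral N_subset_A])

lemma prime_disjoint_W:
  assumes "subring L K" "Rloc \<subseteq> L" "primeideal Q (K\<lparr>carrier := L\<rparr>)" "w \<in> W"
  shows "w \<notin> Q"
proof
  assume "w \<in> Q"
  then have "inv w \<otimes> w \<in> Q"
    using prime_in_subringD(5)[OF assms(1,3)] W_inverse(1)[OF assms(4)] assms(2) by blast
  moreover have "inv w \<otimes> w = \<one>"
    using W_inverse[OF assms(4)] W_carrier[OF assms(4)] subringE(1)[OF Rloc_subring]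
    by (simp add: m_comm subset_iff)
  ultimately show False
    using prime_in_subringD(3)[OF assms(1,3)] by simp
qed

context
  fixes L
  assumes L: "subring L K" and RL: "Rloc \<subseteq> L" and LS: "L \<subseteq> Sloc"
begin

lemma \<Theta>_hom_L: "\<Theta> \<in> ring_hom (K\<lparr>carrier := L\<rparr>) Bloc"
  using \<Theta>_hom LS unfolding ring_hom_def by (auto simp: subset_iff)

lemma \<Theta>_L_subring: "subring (\<Theta> ` L) Bloc"
proof -
  interpret ring_hom_ring "K\<lparr>carrier := L\<rparr>" Bloc \<Theta>
    using ring_hom_ringI2[OF subring_is_ring[OF L] N.L.ring_axioms \<Theta>_hom_L] .
  show ?thesis
    using img_is_subring[OF R.carrier_is_subring] by simp
qed

lemma Aloc_subset: "Aloc \<subseteq> \<Theta> ` L"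
proof
  fix y assume y: "y \<in> Aloc"
  then have "y \<in> carrier Bloc"
    using subringE(1)[OF N.subring_fractions[OF A_subring N_subset_A]] by blast
  then obtain x where x: "x \<in> Sloc" "y = \<Theta> x"
    using \<Theta>_surj by (metis imageE)
  then show "y \<in> \<Theta> ` L"
    using \<Theta>_mem_Aloc_iff y RL by auto
qed

lemma \<Theta>_hom_image: "\<Theta> \<in> ring_hom (K\<lparr>carrier := L\<rparr>) (Bloc\<lparr>carrier := \<Theta> ` L\<rparr>)"
  using \<Theta>_hom_L unfolding ring_hom_def by auto

text \<open>If \<open>\<Theta> x\<close> is zero, then w x lies in \<open>J\<close> for some
  \<open>w\<close> in \<open>W\<close>. As \<open>w\<close> is a unit of \<open>L\<close>, every
  prime of \<open>L\<close> containing \<open>J\<close> contains \<open>x\<close>, hence the whole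
  kernel on \<open>L\<close>.\<close>

lemma prime_image_loc:
  assumes Q: "primeideal Q (K\<lparr>carrier := L\<rparr>)" "J \<subseteq> Q"
  shows "primeideal (\<Theta> ` Q) (Bloc\<lparr>carrier := \<Theta> ` L\<rparr>)" "{x \<in> L. \<Theta> x \<in> \<Theta> ` Q} = Q"
proof -
  have ker: "x \<in> Q" if x: "x \<in> L" "\<Theta> x = \<zero>\<^bsub>Bloc\<^esub>" for x
  proof -
    obtain w where w: "w \<in> W" "w \<otimes> x \<in> J"
      using \<Theta>_kernel[of x] x LS by blast
    moreover have "w \<in> L"
      using w(1) W_props(1) R_subset_Rloc RL by blast
    ultimately show ?thesis
      using prime_in_subringD(6)[OF L Q(1), of w x] x(1) Q(2) prime_disjoint_W[OF L RL Q(1) w(1)] by blast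
  qed
  show "primeideal (\<Theta> ` Q) (Bloc\<lparr>carrier := \<Theta> ` L\<rparr>)" "{x \<in> L. \<Theta> x \<in> \<Theta> ` Q} = Q"
    using primeideal_image[OF subring_cring[OF L] N.L.subring_cring[OF \<Theta>_L_subring] \<Theta>_hom_image _ Q(1)] ker
    by simp_all
qed

lemma prime_loc_eq:
  assumes "primeideal P (K\<lparr>carrier := L\<rparr>)" "primeideal Q (K\<lparr>carrier := L\<rparr>)" "J \<subseteq> P" "P \<subseteq> Q"
  shows "P = Q"
proof -
  have "pi_regular (Bloc\<lparr>carrier := \<Theta> ` L\<rparr>)"
    by (rule N.L.pi_regular_subring[OF Bloc_pi_regular integral_loc \<Theta>_L_subring Aloc_subset])
  moreover have "\<Theta> ` P \<subseteq> \<Theta> ` Q" "J \<subseteq> Q"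
    using image_mono[OF assms(4)] order_trans[OF assms(3,4)] by simp_all
  ultimately have "\<Theta> ` P = \<Theta> ` Q"
    by (intro cring.pi_regular_prime_eq[OF N.L.subring_cring[OF \<Theta>_L_subring]] prime_image_loc(1) assms)
  then show ?thesis
    using prime_image_loc(2)[OF assms(1,3)] prime_image_loc(2)[OF assms(2) \<open>J \<subseteq> Q\<close>] by metis
qed

text \<open>Elements of \<open>W\<close> are units of \<open>L\<close>, so
  \<open>Q \<inter> R\<close> lies inside \<open>p\<close>; both contain \<open>J\<close>, and
  primes of \<open>R\<close> above \<open>J\<close> are incomparable.\<close>

lemma prime_over_p:
  assumes "primeideal Q (K\<lparr>carrier := L\<rparr>)" "J \<subseteq> Q"
  shows "Q \<inter> R = p"
proof -
  have RL': "R \<subseteq> L"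
    using R_subset_Rloc RL by blast
  have "Q \<inter> R \<subseteq> p"
    using prime_disjoint_W[OF L RL assms(1)] unfolding W_def by blast
  moreover have "J \<subseteq> Q \<inter> R"
    using assms(2) J_subset_R by blast
  ultimately show ?thesis
    using prime_R_eq[OF primeideal_subring_contraction[OF R_subring L RL' assms(1)] p_prime] by blast
qed

text \<open>The preimage contains \<open>J\<close> because \<open>\<Theta>\<close> kills
  \<open>J\<close>, and therefore it lies over \<open>p\<close>. Distinct primes of the image thus
  yield distinct primes over \<open>p\<close>.\<close>

lemma prime_preimage_loc:
  assumes Q: "primeideal Q (Bloc\<lparr>carrier := \<Theta> ` L\<rparr>)"
  shows "primeideal {x \<in> L. \<Theta> x \<in> Q} (K\<lparr>carrier := L\<rparr>)" "{x \<in> L. \<Theta> x \<in> Q} \<inter> R = p"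
    "\<Theta> ` {x \<in> L. \<Theta> x \<in> Q} = Q"
proof -
  show 1: "primeideal {x \<in> L. \<Theta> x \<in> Q} (K\<lparr>carrier := L\<rparr>)"
    using primeideal_contraction[OF subring_cring[OF L] N.L.subring_cring[OF \<Theta>_L_subring] \<Theta>_hom_image Q]
    by simp
  note QD = N.L.prime_in_subringD[OF \<Theta>_L_subring Q]
  have "J \<subseteq> {x \<in> L. \<Theta> x \<in> Q}"
  proof
    fix x assume x: "x \<in> J"
    then have "x \<in> S" "x \<in> L"
      using J_subset_R R_subset_S R_subset_Rloc RL by auto
    moreover from this have "\<Theta> x = \<zero>\<^bsub>Bloc\<^esub>"
      using \<Theta>_on_S x unfolding J_def N.localization_zero by simp
    ultimately show "x \<in> {x \<in> L. \<Theta> x \<in> Q}"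
      using QD(2) by simp
  qed
  then show "{x \<in> L. \<Theta> x \<in> Q} \<inter> R = p"
    by (rule prime_over_p[OF 1])
  show "\<Theta> ` {x \<in> L. \<Theta> x \<in> Q} = Q"
    using QD(1) by auto
qed

end

text \<open>From right to left, every prime of the image pulls back to a prime over
  \<open>p\<close>. From left to right, the contractions of the two image primes to
  \<open>Aloc\<close> have to agree; they are minimal because \<open>Aloc\<close> is
  pi-regular.\<close>

lemma two_primes_over_iff:
  assumes L: "subring L K" and RL: "Rloc \<subseteq> L" and LS: "L \<subseteq> Sloc"
  shows "two_primes_over K R L p \<longleftrightarrow>
    (\<exists>q \<in> minimal_primes (Bloc\<lparr>carrier := Aloc\<rparr>).
         \<exists>P \<in> Spec (Bloc\<lparr>carrier := \<Theta> ` L\<rparr>). \<exists>Q \<in> Spec (Bloc\<lparr>carrier := \<Theta> ` L\<rparr>).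
           P \<noteq> Q \<and> P \<inter> Aloc = q \<and> Q \<inter> Aloc = q)" (is "_ \<longleftrightarrow> ?rhs")
proof
  assume ?rhs
  then obtain P Q where PQ: "primeideal P (Bloc\<lparr>carrier := \<Theta> ` L\<rparr>)" "primeideal Q (Bloc\<lparr>carrier := \<Theta> ` L\<rparr>)"
    "P \<noteq> Q"
    unfolding Spec_def by blast
  have "{x \<in> L. \<Theta> x \<in> P} \<noteq> {x \<in> L. \<Theta> x \<in> Q}"
  proof
    assume "{x \<in> L. \<Theta> x \<in> P} = {x \<in> L. \<Theta> x \<in> Q}"
    then have "\<Theta> ` {x \<in> L. \<Theta> x \<in> P} = \<Theta> ` {x \<in> L. \<Theta> x \<in> Q}"
      by (rule arg_cong)
    then show False
      unfolding prime_preimage_loc(3)[OF assms PQ(1)] prime_preimage_loc(3)[OF assms PQ(2)]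
      using PQ(3) by contradiction
  qed
  then show "two_primes_over K R L p"
    unfolding two_primes_over_def
    using prime_preimage_loc(1,2)[OF assms PQ(1)] prime_preimage_loc(1,2)[OF assms PQ(2)] by (intro exI conjI)
next
  assume "two_primes_over K R L p"
  then obtain P Q where PQ: "primeideal P (K\<lparr>carrier := L\<rparr>)" "primeideal Q (K\<lparr>carrier := L\<rparr>)"
    "P \<noteq> Q" "P \<inter> R = p" "Q \<inter> R = p"
    unfolding two_primes_over_def by blast
  have J: "J \<subseteq> P" "J \<subseteq> Q"
    using PQ J_subset_p by auto
  have Aloc: "subring Aloc Bloc"
    by (rule N.subring_fractions[OF A_subring N_subset_A])
  \<comment> \<open>For elements of \<open>Rloc\<close>, membership in the image of a prime over
    \<open>p\<close> is decided by \<open>p\<close> alone, which makes the two contractions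
    coincide.\<close>
  have mem: "\<Theta> x \<in> \<Theta> ` E \<longleftrightarrow> (\<exists>w\<in>W. w \<otimes> x \<in> p)"
    if E: "primeideal E (K\<lparr>carrier := L\<rparr>)" "E \<inter> R = p" and x: "x \<in> Rloc" for E x
  proof -
    have "J \<subseteq> E"
      using E J_subset_p by auto
    then have "\<Theta> x \<in> \<Theta> ` E \<longleftrightarrow> x \<in> E"
      using prime_image_loc(2)[OF assms E(1)] x RL by blast
    also have "\<dots> \<longleftrightarrow> (\<exists>w\<in>W. w \<otimes> x \<in> p)"
    proof
      assume xE: "x \<in> E"
      obtain w where w: "w \<in> W" "w \<otimes> x \<in> R"
        using x unfolding fractions_within_def by blast
      then have "w \<otimes> x \<in> E"
        using prime_in_subringD(5)[OF L E(1) xE] W_props(1) R_subset_Rloc RL by blast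
      then show "\<exists>w\<in>W. w \<otimes> x \<in> p"
        using w E(2) by blast
    next
      assume "\<exists>w\<in>W. w \<otimes> x \<in> p"
      then obtain w where w: "w \<in> W" "w \<otimes> x \<in> E"
        using E(2) by blast
      moreover have "w \<in> L" "x \<in> L"
        using w(1) x W_props(1) R_subset_Rloc RL by auto
      ultimately show "x \<in> E"
        using prime_in_subringD(6)[OF L E(1)] prime_disjoint_W[OF L RL E(1)] by blast
    qed
    finally show ?thesis .
  qed
  have eq: "\<Theta> ` P \<inter> Aloc = \<Theta> ` Q \<inter> Aloc"
  proof -
    have "y \<in> \<Theta> ` P \<longleftrightarrow> y \<in> \<Theta> ` Q" if y: "y \<in> Aloc" for y
    proof -
      obtain x where x: "x \<in> L" "y = \<Theta> x"
        using y Aloc_subset[OF assms] by blast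
      then have "x \<in> Rloc"
        using y \<Theta>_mem_Aloc_iff LS by auto
      then show ?thesis
        using mem[OF PQ(1,4)] mem[OF PQ(2,5)] x(2) by simp
    qed
    then show ?thesis
      by blast
  qed
  have neq: "\<Theta> ` P \<noteq> \<Theta> ` Q"
    using prime_image_loc(2)[OF assms PQ(1) J(1)] prime_image_loc(2)[OF assms PQ(2) J(2)] PQ(3) by metis
  have prime: "primeideal (\<Theta> ` P \<inter> Aloc) (Bloc\<lparr>carrier := Aloc\<rparr>)"
    by (rule N.L.primeideal_subring_contraction[OF Aloc \<Theta>_L_subring[OF assms] Aloc_subset[OF assms]
        prime_image_loc(1)[OF assms PQ(1) J(1)]])
  have "\<Theta> ` P \<inter> Aloc \<in> minimal_primes (Bloc\<lparr>carrier := Aloc\<rparr>)"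
    using prime cring.pi_regular_prime_eq[OF N.L.subring_cring[OF Aloc]
        N.L.pi_regular_subring[OF Bloc_pi_regular integral_loc Aloc subset_refl]]
    unfolding minimal_primes_def Spec_def by blast
  then show ?rhs
    using prime_image_loc(1)[OF assms PQ(1) J(1)] prime_image_loc(1)[OF assms PQ(2) J(2)] eq neq
    unfolding Spec_def mem_Collect_eq Bex_def by (intro exI conjI) (assumption | rule refl | simp)+
qed

lemma \<Theta>_preimage_subring:
  assumes C: "subring C Bloc" "Aloc \<subseteq> C"
  obtains L where "subring L K" "Rloc \<subseteq> L" "L \<subseteq> Sloc" "\<Theta> ` L = C"
proof
  define L where "L = {x \<in> Sloc. \<Theta> x \<in> C}"
  interpret \<Theta>: ring_hom_ring "K\<lparr>carrier := Sloc\<rparr>" Bloc \<Theta>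
    using ring_hom_ringI2[OF subring_is_ring[OF Sloc_subring] N.L.ring_axioms \<Theta>_hom] .
  note S' = subringE[OF Sloc_subring] and C' = subringE[OF C(1)]
  have minus: "\<Theta> (\<ominus> x) = \<ominus>\<^bsub>Bloc\<^esub> \<Theta> x" if "x \<in> Sloc" for x
  proof -
    have "\<ominus> x \<in> Sloc"
      using that S'(5) by simp
    moreover from this have "\<Theta> (\<ominus> x) \<oplus>\<^bsub>Bloc\<^esub> \<Theta> x = \<zero>\<^bsub>Bloc\<^esub>"
      using \<Theta>.hom_add[of "\<ominus> x" x] that \<Theta>.hom_zero Sloc_carrier by (simp add: l_neg)
    ultimately show ?thesis
      using \<Theta>.hom_closed that by (intro N.L.minus_equality[symmetric]) auto
  qed
  show "subring L K"
    using \<Theta>.hom_add \<Theta>.hom_mult \<Theta>.hom_one minus S' C' unfolding L_def by (intro subringI) auto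
  have "Rloc \<subseteq> Sloc"
    using R_subset_S unfolding fractions_within_def by blast
  then show "Rloc \<subseteq> L"
    using \<Theta>_mem_Aloc_iff C(2) unfolding L_def by blast
  show "L \<subseteq> Sloc"
    unfolding L_def by simp
  show "\<Theta> ` L = C"
  proof
    show "C \<subseteq> \<Theta> ` L"
    proof
      fix y assume y: "y \<in> C"
      then have "y \<in> \<Theta> ` Sloc"
        using C'(1) \<Theta>_surj by auto
      then show "y \<in> \<Theta> ` L"
        using y unfolding L_def by auto
    qed
  qed (auto simp: L_def)
qed

text \<open>Every intermediate ring \<open>C\<close> is the image of some \<open>L\<close>, namely
  of its full preimage, and strictness of the inclusion is preserved in both directions because
  \<open>Rloc\<close> is the preimage of \<open>Aloc\<close>.\<close>

lemma apparently_fragile_loc_iff: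
  "apparently_fragile Aloc Bloc \<longleftrightarrow>
    (\<forall>L. subring L K \<and> Rloc \<subset> L \<and> L \<subseteq> Sloc \<longrightarrow> two_primes_over K R L p)"
proof (intro iffI allI impI)
  fix L assume af: "apparently_fragile Aloc Bloc" and L: "subring L K \<and> Rloc \<subset> L \<and> L \<subseteq> Sloc"
  then have L': "subring L K" "Rloc \<subseteq> L" "L \<subseteq> Sloc"
    by auto
  obtain x where x: "x \<in> L" "x \<notin> Rloc"
    using L by blast
  then have "\<Theta> x \<notin> Aloc"
    using \<Theta>_mem_Aloc_iff L' by blast
  then have "Aloc \<subset> \<Theta> ` L"
    using Aloc_subset[OF L'] x(1) by blast
  then show "two_primes_over K R L p"
    using af \<Theta>_L_subring[OF L'] unfolding two_primes_over_iff[OF L'] apparently_fragile_def by blast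
next
  assume *: "\<forall>L. subring L K \<and> Rloc \<subset> L \<and> L \<subseteq> Sloc \<longrightarrow> two_primes_over K R L p"
  show "apparently_fragile Aloc Bloc"
    unfolding apparently_fragile_def
  proof (intro conjI allI impI)
    show "integral_extension Aloc Bloc"
      by (rule integral_loc)
    fix C assume C: "subring C Bloc \<and> Aloc \<subset> C"
    then obtain L where L: "subring L K" "Rloc \<subseteq> L" "L \<subseteq> Sloc" "\<Theta> ` L = C"
      using \<Theta>_preimage_subring by (metis psubset_imp_subset)
    have "L \<noteq> Rloc"
    proof
      assume eq: "L = Rloc"
      have "C \<subseteq> Aloc"
        unfolding L(4)[symmetric] using \<Theta>_mem_Aloc_iff L(3) eq by auto
      then show False
        using C by blast
    qed
    then have "two_primes_over K R L p"
      using * L(1-3) by (simp add: psubset_eq)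
    then show "\<exists>q \<in> minimal_primes (Bloc\<lparr>carrier := Aloc\<rparr>).
         \<exists>P \<in> Spec (Bloc\<lparr>carrier := C\<rparr>). \<exists>Q \<in> Spec (Bloc\<lparr>carrier := C\<rparr>).
           P \<noteq> Q \<and> P \<inter> Aloc = q \<and> Q \<inter> Aloc = q"
      unfolding two_primes_over_iff[OF L(1-3)] L(4) .
  qed
qed

end

text \<open>The primes of \<open>A\<close> are the images of the primes of \<open>R\<close>
  containing \<open>J\<close>, so the localized equivalences cover all of them. The right side
  speaks only of subsets of \<open>K\<close>, where it can be compared with perinormality.\<close>

lemma (in zero_dim_pullback) fragile_iff:
  "fragile A B \<longleftrightarrow>
    (\<forall>p. primeideal p (K\<lparr>carrier := R\<rparr>) \<and> J \<subseteq> p \<longrightarrow>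
      (\<forall>L. subring L K \<and> fractions_within K (R - p) R \<subset> L \<and> L \<subseteq> fractions_within K (R - p) S \<longrightarrow>
        two_primes_over K R L p))"
proof -
  have at: "apparently_fragile (fractions B (A - \<psi> ` p) A (A - \<psi> ` p)) (localization B (A - \<psi> ` p)) \<longleftrightarrow>
    (\<forall>L. subring L K \<and> fractions_within K (R - p) R \<subset> L \<and> L \<subseteq> fractions_within K (R - p) S \<longrightarrow>
        two_primes_over K R L p)"
    if "primeideal p (K\<lparr>carrier := R\<rparr>)" "J \<subseteq> p" for p
  proof -
    interpret zero_dim_pullback_at_prime K B S A \<psi> p
      by (intro zero_dim_pullback_at_prime.intro pullback_at_prime.intro pullback_at_prime_axioms.intro
          zero_dim_pullback_axioms pullback_in_field_axioms that)
    show ?thesis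
      using apparently_fragile_loc_iff unfolding N_def W_def .
  qed
  have "fragile A B \<longleftrightarrow> (\<forall>P. primeideal P (B\<lparr>carrier := A\<rparr>) \<longrightarrow>
     apparently_fragile (fractions B (A - P) A (A - P)) (localization B (A - P)))"
    unfolding fragile_def Spec_def using integral by auto
  also have "\<dots> \<longleftrightarrow> (\<forall>p. primeideal p (K\<lparr>carrier := R\<rparr>) \<and> J \<subseteq> p \<longrightarrow>
     apparently_fragile (fractions B (A - \<psi> ` p) A (A - \<psi> ` p)) (localization B (A - \<psi> ` p)))"
  proof (intro iffI allI impI)
    fix P assume *: "\<forall>p. primeideal p (K\<lparr>carrier := R\<rparr>) \<and> J \<subseteq> p \<longrightarrow>
        apparently_fragile (fractions B (A - \<psi> ` p) A (A - \<psi> ` p)) (localization B (A - \<psi> ` p))"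
      and P: "primeideal P (B\<lparr>carrier := A\<rparr>)"
    show "apparently_fragile (fractions B (A - P) A (A - P)) (localization B (A - P))"
      using *[rule_format, OF conjI[OF prime_preimage_R(1,2)[OF P]]] unfolding prime_preimage_R(3)[OF P] .
  qed (use prime_image_A(1) in simp)
  finally show ?thesis
    using at by simp
qed


section \<open>Perinormality of the pullback\<close>

lemma going_downD:
  assumes "going_down R (K\<lparr>carrier := L\<rparr>)" "primeideal p1 (K\<lparr>carrier := R\<rparr>)"
    "primeideal p2 (K\<lparr>carrier := R\<rparr>)" "primeideal Q2 (K\<lparr>carrier := L\<rparr>)" "p1 \<subseteq> p2" "Q2 \<inter> R = p2"
  obtains Q1 where "primeideal Q1 (K\<lparr>carrier := L\<rparr>)" "Q1 \<subseteq> Q2" "Q1 \<inter> R = p1"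
proof -
  have "\<forall>p1 p2 Q2. primeideal p1 (K\<lparr>carrier := R\<rparr>) \<longrightarrow> primeideal p2 (K\<lparr>carrier := R\<rparr>) \<longrightarrow>
      primeideal Q2 (K\<lparr>carrier := L\<rparr>) \<longrightarrow> p1 \<subseteq> p2 \<longrightarrow> Q2 \<inter> R = p2 \<longrightarrow>
      (\<exists>Q1. primeideal Q1 (K\<lparr>carrier := L\<rparr>) \<and> Q1 \<subseteq> Q2 \<and> Q1 \<inter> R = p1)"
    using assms(1) unfolding going_down_def Spec_def by simp
  from this[rule_format, OF assms(2-6)] that show thesis
    by blast
qed

text \<open>By the incomparability assumption each prime over \<open>p\<close> coincides with a
  maximal ideal containing it, so two of them are two maximal ideals.\<close>

lemma (in cring) two_primes_over_not_local:
  assumes "subring L R"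
    and "\<And>P Q. \<lbrakk>primeideal P (R\<lparr>carrier := L\<rparr>); primeideal Q (R\<lparr>carrier := L\<rparr>); P \<inter> H = p; P \<subseteq> Q\<rbrakk> \<Longrightarrow> P = Q"
    and "two_primes_over R H L p"
  shows "\<not> local_ring (R\<lparr>carrier := L\<rparr>)"
proof
  interpret L: cring "R\<lparr>carrier := L\<rparr>"
    by (rule subring_cring[OF assms(1)])
  assume "local_ring (R\<lparr>carrier := L\<rparr>)"
  then obtain m where m: "\<And>n. maximalideal n (R\<lparr>carrier := L\<rparr>) \<Longrightarrow> n = m"
    unfolding local_ring_def by metis
  have "P = m" if P: "primeideal P (R\<lparr>carrier := L\<rparr>)" "P \<inter> H = p" for P
  proof -
    obtain n where n: "maximalideal n (R\<lparr>carrier := L\<rparr>)" "P \<subseteq> n"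
      using L.maximalideal_exists[of P] P(1) unfolding L.primeideal_iff by metis
    then have "P = n"
      using assms(2)[OF P(1) L.maximalideal_prime[OF n(1)] P(2)] by simp
    then show ?thesis
      using m[OF n(1)] by simp
  qed
  then show False
    using assms(3) unfolding two_primes_over_def by metis
qed

section \<open>From fragility to perinormality\<close>

context zero_dim_pullback
begin

lemma prime_complement_closed:
  assumes "primeideal q (K\<lparr>carrier := R\<rparr>)"
  shows "R - q \<subseteq> R" "\<one> \<in> R - q" "\<zero> \<notin> R - q" "\<And>v w. v \<in> R - q \<Longrightarrow> w \<in> R - q \<Longrightarrow> v \<otimes> w \<in> R - q"
proof -
  note D = prime_in_subringD[OF R_subring assms]
  show "R - q \<subseteq> R" "\<one> \<in> R - q" "\<zero> \<notin> R - q"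
    using D(2,3) R_closed(3) by auto
  show "v \<otimes> w \<in> R - q" if "v \<in> R - q" "w \<in> R - q" for v w
    using that D(6)[of v w] R_closed(6)[of v w] by blast
qed

text \<open>A conductor argument: multiplying a denominator by \<open>j\<close> keeps it outside
  \<open>q\<close> and turns a numerator in \<open>S\<close> into one in \<open>J\<close>, hence in
  \<open>R\<close>.\<close>

lemma localizations_eq_if_not_J_subset:
  assumes q: "primeideal q (K\<lparr>carrier := R\<rparr>)" and j: "j \<in> J" "j \<notin> q"
  shows "fractions_within K (R - q) S = fractions_within K (R - q) R"
proof
  show "fractions_within K (R - q) R \<subseteq> fractions_within K (R - q) S"
    using R_subset_S unfolding fractions_within_def by blast
  show "fractions_within K (R - q) S \<subseteq> fractions_within K (R - q) R"
  proof
    fix x assume "x \<in> fractions_within K (R - q) S"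
    then obtain w where w: "x \<in> carrier K" "w \<in> R - q" "w \<otimes> x \<in> S"
      unfolding fractions_within_def by blast
    have jw: "j \<otimes> w \<in> R - q"
      using prime_complement_closed(4)[OF q] w(2) j J_subset_R by blast
    have "(j \<otimes> w) \<otimes> x = (w \<otimes> x) \<otimes> j"
      using w j(1) J_subset_R R_carrier by (simp add: m_ac subset_iff)
    also have "\<dots> \<in> R"
      using J_absorb[OF j(1) w(3)] J_subset_R by blast
    finally show "x \<in> fractions_within K (R - q) R"
      unfolding fractions_within_def using w(1) jw by blast
  qed
qed

text \<open>The hypothesis \<open>bound\<close> isolates what the Krull property of \<open>S\<close>
  has to deliver: an overring in which all primes of \<open>R\<close> inside \<open>q\<close> are
  contractions is confined to the localization of \<open>S\<close> at \<open>R - q\<close>. The rest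
  is decided by the primes over the centre \<open>p\<close>: above \<open>J\<close>, a ring strictly
  larger than the localization of \<open>R\<close> would have two of them, both maximal.\<close>

lemma perinormal_if_two_primes:
  assumes bound: "\<And>L q. \<lbrakk>subring L K; R \<subseteq> L; primeideal q (K\<lparr>carrier := R\<rparr>);
      \<And>q'. \<lbrakk>primeideal q' (K\<lparr>carrier := R\<rparr>); q' \<subseteq> q\<rbrakk> \<Longrightarrow>
        \<exists>Q. primeideal Q (K\<lparr>carrier := L\<rparr>) \<and> Q \<inter> R = q'\<rbrakk> \<Longrightarrow> L \<subseteq> fractions_within K (R - q) S"
    and frag: "\<And>p L. \<lbrakk>primeideal p (K\<lparr>carrier := R\<rparr>); J \<subseteq> p; subring L K;
      fractions_within K (R - p) R \<subset> L; L \<subseteq> fractions_within K (R - p) S\<rbrakk> \<Longrightarrow> two_primes_over K R L p"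
    and L: "subring L K" "R \<subseteq> L" "local_ring (K\<lparr>carrier := L\<rparr>)" "going_down R (K\<lparr>carrier := L\<rparr>)"
  shows "\<exists>q. primeideal q (K\<lparr>carrier := R\<rparr>) \<and> L = fractions_within K (R - q) R"
proof -
  interpret L: cring "K\<lparr>carrier := L\<rparr>"
    by (rule subring_cring[OF L(1)])
  obtain m where m: "maximalideal m (K\<lparr>carrier := L\<rparr>)" "\<And>n. maximalideal n (K\<lparr>carrier := L\<rparr>) \<Longrightarrow> n = m"
    using L(3) unfolding local_ring_def by metis
  have mp: "primeideal m (K\<lparr>carrier := L\<rparr>)"
    by (rule L.maximalideal_prime[OF m(1)])
  define p where "p = m \<inter> R"
  have p: "primeideal p (K\<lparr>carrier := R\<rparr>)"
    unfolding p_def by (rule primeideal_subring_contraction[OF R_subring L(1,2) mp])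
  \<comment> \<open>An element of \<open>R\<close> outside \<open>p\<close> avoids the only maximal
    ideal \<open>m\<close> and is a unit of \<open>L\<close>.\<close>
  have RL: "fractions_within K (R - p) R \<subseteq> L"
  proof
    fix x assume "x \<in> fractions_within K (R - p) R"
    then obtain w where w: "x \<in> carrier K" "w \<in> R - p" "w \<otimes> x \<in> R"
      unfolding fractions_within_def by blast
    have wL: "w \<in> L" "w \<notin> m"
      using w(2) L(2) unfolding p_def by auto
    have "\<exists>y\<in>L. y \<otimes> w = \<one>"
    proof (rule ccontr)
      assume none: "\<not> (\<exists>y\<in>L. y \<otimes> w = \<one>)"
      show False
        by (rule L.nonunit_in_maximalideal[of w, simplified]) (use none wL m(2) in auto)
    qed
    then obtain y where y: "y \<in> L" "y \<otimes> w = \<one>"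
      by blast
    have "x = y \<otimes> (w \<otimes> x)"
      using y w(1) wL(1) subringE(1)[OF L(1)] by (simp add: m_assoc[symmetric] subset_iff)
    also have "\<dots> \<in> L"
      using subringE(6)[OF L(1) y(1)] w(3) L(2) by blast
    finally show "x \<in> L" .
  qed
  \<comment> \<open>Going-down started at \<open>m\<close>, which lies over \<open>p\<close>,
    reaches every prime of \<open>R\<close> inside \<open>p\<close>.\<close>
  have "\<exists>Q. primeideal Q (K\<lparr>carrier := L\<rparr>) \<and> Q \<inter> R = q'"
    if q': "primeideal q' (K\<lparr>carrier := R\<rparr>)" "q' \<subseteq> p" for q'
  proof -
    obtain Q where "primeideal Q (K\<lparr>carrier := L\<rparr>)" "Q \<inter> R = q'"
      by (rule going_downD[OF L(4) q'(1) p mp q'(2)]) (simp_all add: p_def)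
    then show ?thesis
      by blast
  qed
  then have LS: "L \<subseteq> fractions_within K (R - p) S"
    by (rule bound[OF L(1,2) p])
  have "L = fractions_within K (R - p) R"
  proof (cases "J \<subseteq> p")
    case True
    interpret zero_dim_pullback_at_prime K B S A \<psi> p
      by (intro zero_dim_pullback_at_prime.intro pullback_at_prime.intro pullback_at_prime_axioms.intro
          zero_dim_pullback_axioms pullback_in_field_axioms p True)
    have RL': "Rloc \<subseteq> L" and LS': "L \<subseteq> Sloc"
      using RL LS unfolding W_def by auto
    show ?thesis
    proof (rule ccontr)
      assume "L \<noteq> fractions_within K (R - p) R"
      then have "two_primes_over K R L p"
        using frag[OF p True L(1)] RL LS by (simp add: psubset_eq)
      moreover have "P = Q"
        if "primeideal P (K\<lparr>carrier := L\<rparr>)" "primeideal Q (K\<lparr>carrier := L\<rparr>)" "P \<inter> R = p" "P \<subseteq> Q" for P Q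
        using prime_loc_eq[OF L(1) RL' LS' that(1,2) _ that(4)] that(3) True by blast
      ultimately show False
        using two_primes_over_not_local[OF L(1)] L(3) by metis
    qed
  next
    case False
    then show ?thesis
      using localizations_eq_if_not_J_subset[OF p] RL LS by blast
  qed
  then show ?thesis
    using p by metis
qed

end

section \<open>From perinormality to fragility: intermediate rings with at most one prime over
  \<open>p\<close>\<close>

context zero_dim_pullback_at_prime
begin

context
  fixes L
  assumes L: "subring L K" and RL: "Rloc \<subseteq> L" and LS: "L \<subseteq> Sloc"
begin

lemma R_subset_L: "R \<subseteq> L"
  using R_subset_Rloc RL by (rule order_trans)

text \<open>\<open>J\<close> lies in the Jacobson radical of \<open>L\<close>. Otherwise i + r j = 1
  with \<open>i\<close> in a maximal ideal \<open>n\<close>. A denominator \<open>w\<close> of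
  \<open>r\<close> makes w r j an element of \<open>J\<close>, so w i = w - w r j lies in
  \<open>R\<close> and in \<open>n\<close>, hence in \<open>p\<close>; then \<open>w\<close> itself
  lies in \<open>p\<close>, a contradiction.\<close>

lemma maximal_over_p:
  assumes n: "maximalideal n (K\<lparr>carrier := L\<rparr>)"
  shows "n \<inter> R = p"
proof -
  interpret L: cring "K\<lparr>carrier := L\<rparr>"
    by (rule subring_cring[OF L])
  have np: "primeideal n (K\<lparr>carrier := L\<rparr>)"
    by (rule L.maximalideal_prime[OF n])
  note nD = prime_in_subringD[OF L np]
  have "J \<subseteq> n"
  proof (rule subsetI, rule ccontr)
    fix j assume j: "j \<in> J" "j \<notin> n"
    have jR: "j \<in> R" "j \<in> L" "j \<in> p"
      using j(1) J_subset_R R_subset_L J_subset_p by auto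
    obtain i r where ir: "i \<in> n" "r \<in> L" "i \<oplus> r \<otimes> j = \<one>"
      using L.maximalideal_comaximal[OF n, of j] jR(2) j(2) by auto
    obtain w where w: "w \<in> W" "w \<otimes> r \<in> S"
      using ir(2) LS unfolding fractions_within_def by blast
    have c: "i \<in> carrier K" "r \<in> carrier K" "w \<in> carrier K" "j \<in> carrier K"
      using ir nD(1) subringE(1)[OF L] W_carrier[OF w(1)] jR by auto
    have wrj: "(w \<otimes> r) \<otimes> j \<in> J"
      by (rule J_absorb[OF j(1) w(2)])
    have w_eq: "w \<otimes> i \<oplus> (w \<otimes> r) \<otimes> j = w"
    proof -
      have "w \<otimes> i \<oplus> (w \<otimes> r) \<otimes> j = w \<otimes> (i \<oplus> r \<otimes> j)"
        using c by algebra
      then show ?thesis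
        using ir(3) c by simp
    qed
    have "w \<otimes> i = w \<oplus> \<ominus> ((w \<otimes> r) \<otimes> j)"
    proof -
      have "w \<otimes> i = (w \<otimes> i \<oplus> (w \<otimes> r) \<otimes> j) \<oplus> \<ominus> ((w \<otimes> r) \<otimes> j)"
        using c by algebra
      then show ?thesis
        unfolding w_eq .
    qed
    also have "\<dots> \<in> R"
      using w(1) W_props(1) wrj J_subset_R R_closed(5,7) by (meson subsetD)
    finally have "w \<otimes> i \<in> R" .
    moreover have "w \<otimes> i \<in> n"
      using nD(5)[OF ir(1)] w(1) W_props(1) R_subset_L by blast
    ultimately have "w \<otimes> i \<in> p"
      using prime_disjoint_W[OF L RL np] unfolding W_def by blast
    then have "w \<in> p"
      using prime_in_subringD(4)[OF R_subring p_prime, of "w \<otimes> i" "(w \<otimes> r) \<otimes> j"] wrj J_subset_p w_eq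
      by auto
    then show False
      using w(1) unfolding W_def by simp
  qed
  then show ?thesis
    by (rule prime_over_p[OF L RL LS np])
qed

context
  assumes unique: "\<And>P Q. \<lbrakk>primeideal P (K\<lparr>carrier := L\<rparr>); primeideal Q (K\<lparr>carrier := L\<rparr>);
    P \<inter> R = p; Q \<inter> R = p\<rbrakk> \<Longrightarrow> P = Q"
begin

lemma local_L: "local_ring (K\<lparr>carrier := L\<rparr>)"
proof -
  interpret L: cring "K\<lparr>carrier := L\<rparr>"
    by (rule subring_cring[OF L])
  obtain n where n: "maximalideal n (K\<lparr>carrier := L\<rparr>)"
    using L.maximalideal_exists[OF L.zeroideal] by auto
  moreover have "n' = n" if "maximalideal n' (K\<lparr>carrier := L\<rparr>)" for n'
    by (rule unique[OF L.maximalideal_prime[OF that] L.maximalideal_prime[OF n]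
        maximal_over_p[OF that] maximal_over_p[OF n]])
  ultimately show ?thesis
    unfolding local_ring_def using L.is_cring by blast
qed

lemma prime_subset_prime_over_p:
  assumes "primeideal Q (K\<lparr>carrier := L\<rparr>)" "primeideal Q' (K\<lparr>carrier := L\<rparr>)" "Q' \<inter> R = p"
  shows "Q \<subseteq> Q'"
proof -
  interpret L: cring "K\<lparr>carrier := L\<rparr>"
    by (rule subring_cring[OF L])
  obtain n where n: "maximalideal n (K\<lparr>carrier := L\<rparr>)" "Q \<subseteq> n"
    using L.maximalideal_exists[of Q] assms(1) unfolding L.primeideal_iff by metis
  have "n = Q'"
    by (rule unique[OF L.maximalideal_prime[OF n(1)] assms(2) maximal_over_p[OF n(1)] assms(3)])
  then show ?thesis
    using n(2) by simp
qed

text \<open>The set is the contraction to \<open>L\<close> of the maximal ideal of \<open>R\<close>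
  localized at \<open>q\<close>. That localization contains \<open>L\<close>, because
  \<open>L \<subseteq> Sloc\<close> and the localizations of \<open>S\<close> and \<open>R\<close>
  at \<open>R - q\<close> agree when \<open>q\<close> misses an element of \<open>J\<close>.\<close>

lemma prime_extension:
  assumes q: "primeideal q (K\<lparr>carrier := R\<rparr>)" "q \<subseteq> p" and j: "j \<in> J" "j \<notin> q"
  shows "primeideal {x \<in> L. \<exists>b\<in>R - q. b \<otimes> x \<in> q} (K\<lparr>carrier := L\<rparr>)" (is "primeideal ?Q _")
    and "{x \<in> L. \<exists>b\<in>R - q. b \<otimes> x \<in> q} \<inter> R = q"
proof -
  note qD = prime_in_subringD[OF R_subring q(1)]
  note M = prime_complement_closed[OF q(1)]
  have Lc: "x \<in> carrier K" if "x \<in> L" for x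
    using that subringE(1)[OF L] by blast
  have den: "\<exists>d\<in>R - q. d \<otimes> r \<in> R" if r: "r \<in> L" for r
  proof -
    have "W \<subseteq> R - q"
      using q(2) unfolding W_def by blast
    then have "r \<in> fractions_within K (R - q) S"
      using r LS unfolding fractions_within_def by blast
    then show ?thesis
      unfolding localizations_eq_if_not_J_subset[OF q(1) j] unfolding fractions_within_def by blast
  qed
  show "primeideal ?Q (K\<lparr>carrier := L\<rparr>)"
  proof (rule prime_in_subringI[OF L])
    show "?Q \<subseteq> L"
      by blast
    show "\<zero> \<in> ?Q"
      using subringE(2)[OF L] M(2) qD(2) by (auto intro!: bexI[of _ \<one>])
    show "\<one> \<notin> ?Q"
      using R_carrier by auto
  next
    fix x y assume "x \<in> ?Q" "y \<in> ?Q"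
    then obtain b c where b: "x \<in> L" "b \<in> R - q" "b \<otimes> x \<in> q" and c: "y \<in> L" "c \<in> R - q" "c \<otimes> y \<in> q"
      by blast
    have bc: "b \<in> R" "c \<in> R" "b \<in> carrier K" "c \<in> carrier K"
      using b(2) c(2) R_carrier by auto
    have "(b \<otimes> c) \<otimes> (x \<oplus> y) = c \<otimes> (b \<otimes> x) \<oplus> b \<otimes> (c \<otimes> y)"
      using bc(3,4) Lc[OF b(1)] Lc[OF c(1)] by algebra
    also have "\<dots> \<in> q"
      using qD(4)[OF qD(5)[OF b(3) bc(2)] qD(5)[OF c(3) bc(1)]] .
    finally show "x \<oplus> y \<in> ?Q"
      using M(4)[OF b(2) c(2)] subringE(7)[OF L b(1) c(1)] by blast
  next
    fix x r assume "x \<in> ?Q" and r: "r \<in> L"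
    then obtain b where b: "x \<in> L" "b \<in> R - q" "b \<otimes> x \<in> q"
      by blast
    obtain d where d: "d \<in> R - q" "d \<otimes> r \<in> R"
      using den[OF r] by blast
    have bd: "b \<in> carrier K" "d \<in> carrier K"
      using b(2) d(1) R_carrier by auto
    have "(b \<otimes> d) \<otimes> (r \<otimes> x) = (d \<otimes> r) \<otimes> (b \<otimes> x)"
      using bd Lc[OF b(1)] Lc[OF r] by (simp add: m_ac)
    also have "\<dots> \<in> q"
      by (rule qD(5)[OF b(3) d(2)])
    finally show "r \<otimes> x \<in> ?Q"
      using M(4)[OF b(2) d(1)] subringE(6)[OF L r b(1)] by blast
  next
    fix x y assume xy: "x \<in> L" "y \<in> L" and "x \<otimes> y \<in> ?Q"
    then obtain b where b: "b \<in> R - q" "b \<otimes> (x \<otimes> y) \<in> q"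
      by blast
    obtain d where d: "d \<in> R - q" "d \<otimes> x \<in> R"
      using den[OF xy(1)] by blast
    obtain e where e: "e \<in> R - q" "e \<otimes> y \<in> R"
      using den[OF xy(2)] by blast
    have c: "b \<in> R" "d \<in> R" "e \<in> R"
      using b(1) d(1) e(1) by auto
    have "((d \<otimes> x) \<otimes> (e \<otimes> y)) \<otimes> b = (d \<otimes> e) \<otimes> (b \<otimes> (x \<otimes> y))"
      using c R_carrier Lc xy by (simp add: m_ac)
    also have "\<dots> \<in> q"
      by (rule qD(5)[OF b(2) R_closed(6)[OF c(2,3)]])
    finally have "(d \<otimes> x) \<otimes> (e \<otimes> y) \<in> q"
      using qD(6)[OF R_closed(6)[OF d(2) e(2)] c(1)] b(1) by blast
    then have "d \<otimes> x \<in> q \<or> e \<otimes> y \<in> q"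
      by (rule qD(6)[OF d(2) e(2)])
    then show "x \<in> ?Q \<or> y \<in> ?Q"
      using xy d(1) e(1) by blast
  qed
  show "?Q \<inter> R = q"
  proof
    show "?Q \<inter> R \<subseteq> q"
      using qD(6) by blast
    show "q \<subseteq> ?Q \<inter> R"
    proof
      fix x assume x: "x \<in> q"
      then have "x \<in> R" "x \<in> L" "\<one> \<otimes> x \<in> q"
        using qD(1) R_subset_L R_carrier by auto
      then show "x \<in> ?Q \<inter> R"
        using M(2) by blast
    qed
  qed
qed

text \<open>If \<open>p1\<close> contains \<open>J\<close>, it equals \<open>p2\<close>. Otherwise
  the candidate is the prime of \<open>prime_extension\<close>. It lies in \<open>Q2\<close> either
  because \<open>p2 = p\<close>, so that \<open>Q2\<close> contains every prime of \<open>L\<close>,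
  or because elements of \<open>L\<close> have denominators in \<open>R\<close> outside
  \<open>p2\<close>.\<close>

lemma going_down_L: "going_down R (K\<lparr>carrier := L\<rparr>)"
  unfolding going_down_def Spec_def mem_Collect_eq
proof (intro ballI impI)
  fix p1 p2 Q2
  assume "p1 \<in> {P. primeideal P (K\<lparr>carrier := L, carrier := R\<rparr>)}"
    and "p2 \<in> {P. primeideal P (K\<lparr>carrier := L, carrier := R\<rparr>)}"
    and "Q2 \<in> {P. primeideal P (K\<lparr>carrier := L\<rparr>)}" and p12: "p1 \<subseteq> p2 \<and> Q2 \<inter> R = p2"
  then have p1: "primeideal p1 (K\<lparr>carrier := R\<rparr>)" and p2: "primeideal p2 (K\<lparr>carrier := R\<rparr>)"
    and Q2: "primeideal Q2 (K\<lparr>carrier := L\<rparr>)"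
    by simp_all
  have p2p: "p2 \<subseteq> p"
    using prime_disjoint_W[OF L RL Q2] p12 unfolding W_def by blast
  have "\<exists>Q1. primeideal Q1 (K\<lparr>carrier := L\<rparr>) \<and> Q1 \<subseteq> Q2 \<and> Q1 \<inter> R = p1"
  proof (cases "J \<subseteq> p1")
    case True
    then have "p1 = p2"
      using prime_R_eq[OF p1 p2] p12 by simp
    then show ?thesis
      using Q2 p12 by blast
  next
    case False
    then obtain j1 where j1: "j1 \<in> J" "j1 \<notin> p1"
      by blast
    define Q1 where "Q1 = {x \<in> L. \<exists>b\<in>R - p1. b \<otimes> x \<in> p1}"
    have Q1: "primeideal Q1 (K\<lparr>carrier := L\<rparr>)" "Q1 \<inter> R = p1"
      using prime_extension[OF p1 _ j1] p12 p2p unfolding Q1_def by auto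
    have "Q1 \<subseteq> Q2"
    proof (cases "J \<subseteq> p2")
      case True
      then have "p2 = p"
        by (rule prime_R_eq[OF p2 p_prime _ p2p])
      then show ?thesis
        using prime_subset_prime_over_p[OF Q1(1) Q2] p12 by simp
    next
      case False
      then obtain j where j: "j \<in> J" "j \<notin> p2"
        by blast
      show ?thesis
      proof
        fix x assume x: "x \<in> Q1"
        then have xL: "x \<in> L"
          unfolding Q1_def by simp
        then have "x \<in> fractions_within K (R - p2) S"
          using LS p2p unfolding fractions_within_def W_def by blast
        then obtain d where d: "d \<in> R - p2" "d \<otimes> x \<in> R"
          unfolding localizations_eq_if_not_J_subset[OF p2 j] unfolding fractions_within_def by blast
        have dL: "d \<in> L" "d \<notin> Q2"
          using d(1) R_subset_L p12 by auto
        have "d \<otimes> x \<in> Q1"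
          by (rule prime_in_subringD(5)[OF L Q1(1) x dL(1)])
        then have "d \<otimes> x \<in> Q2"
          using d(2) Q1(2) p12 by blast
        then show "x \<in> Q2"
          using prime_in_subringD(6)[OF L Q2 dL(1) xL] dL(2) by blast
      qed
    qed
    then show ?thesis
      using Q1 by blast
  qed
  then show "\<exists>Q1\<in>{P. primeideal P (K\<lparr>carrier := L\<rparr>)}. Q1 \<subseteq> Q2 \<and> Q1 \<inter> R = p1"
    by blast
qed

text \<open>An element of \<open>p\<close> outside \<open>q\<close> would be invertible in
  \<open>L\<close> and yet lie in every maximal ideal of \<open>L\<close>. Hence
  \<open>p \<subseteq> q\<close>, and denominators outside \<open>q\<close> are denominators outside
  \<open>p\<close>.\<close>

lemma localization_imp_Rloc:
  assumes q: "primeideal q (K\<lparr>carrier := R\<rparr>)" and eq: "L = fractions_within K (R - q) R"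
  shows "L = Rloc"
proof -
  interpret L: cring "K\<lparr>carrier := L\<rparr>"
    by (rule subring_cring[OF L])
  obtain n where n: "maximalideal n (K\<lparr>carrier := L\<rparr>)"
    using L.maximalideal_exists[OF L.zeroideal] by auto
  note nD = prime_in_subringD[OF L L.maximalideal_prime[OF n]]
  have "p \<subseteq> q"
  proof (rule subsetI, rule ccontr)
    fix x assume x: "x \<in> p" "x \<notin> q"
    have xn: "x \<in> n" "x \<in> R"
      using maximal_over_p[OF n] x(1) by auto
    have "x \<noteq> \<zero>"
      using prime_in_subringD(2)[OF R_subring q] x(2) by blast
    then have u: "x \<in> Units K"
      using xn(2) R_carrier field_Units by simp
    then have "x \<otimes> inv x \<in> R"
      using R_closed(3) by simp
    then have "inv x \<in> L"
      unfolding eq fractions_within_def using u xn(2) x(2) by blast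
    then have "inv x \<otimes> x \<in> n"
      by (rule nD(5)[OF xn(1)])
    then show False
      using u nD(3) by simp
  qed
  then have "L \<subseteq> Rloc"
    unfolding eq W_def fractions_within_def by blast
  then show ?thesis
    using RL by blast
qed

end

end

end

text \<open>An intermediate ring with at most one prime over \<open>p\<close> would be local with
  going-down, hence a localization of \<open>R\<close>, hence equal to \<open>Rloc\<close>, against
  the strict inclusion.\<close>

lemma (in zero_dim_pullback) two_primes_if_perinormal:
  assumes peri: "\<And>L. \<lbrakk>subring L K; R \<subseteq> L; local_ring (K\<lparr>carrier := L\<rparr>); going_down R (K\<lparr>carrier := L\<rparr>)\<rbrakk> \<Longrightarrow>
      \<exists>q. primeideal q (K\<lparr>carrier := R\<rparr>) \<and> L = fractions_within K (R - q) R"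
    and p: "primeideal p (K\<lparr>carrier := R\<rparr>)" "J \<subseteq> p"
    and L: "subring L K" "fractions_within K (R - p) R \<subset> L" "L \<subseteq> fractions_within K (R - p) S"
  shows "two_primes_over K R L p"
proof (rule ccontr)
  interpret zero_dim_pullback_at_prime K B S A \<psi> p
    by (intro zero_dim_pullback_at_prime.intro pullback_at_prime.intro pullback_at_prime_axioms.intro
        zero_dim_pullback_axioms pullback_in_field_axioms p)
  assume "\<not> two_primes_over K R L p"
  then have unique: "P = Q" if "primeideal P (K\<lparr>carrier := L\<rparr>)" "primeideal Q (K\<lparr>carrier := L\<rparr>)"
    "P \<inter> R = p" "Q \<inter> R = p" for P Q
    using that unfolding two_primes_over_def by blast
  have L': "subring L K" "Rloc \<subseteq> L" "L \<subseteq> Sloc"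
    using L unfolding W_def by auto
  have "local_ring (K\<lparr>carrier := L\<rparr>)"
    by (rule local_L[OF L']) (rule unique)
  moreover have "going_down R (K\<lparr>carrier := L\<rparr>)"
    by (rule going_down_L[OF L']) (rule unique)
  ultimately obtain q where q: "primeideal q (K\<lparr>carrier := R\<rparr>)" "L = fractions_within K (R - q) R"
    using peri[OF L(1) R_subset_L[OF L']] by metis
  have "L = Rloc"
    by (rule localization_imp_Rloc[OF L' _ q]) (rule unique)
  then show False
    using L(2) unfolding W_def by simp
qed


section \<open>Generalized Krull domains\<close>

lemma (in domain) prime_height_zero: "prime_height R {\<zero>} = 0"
proof -
  have "n = 0" if c: "\<forall>i\<le>n. c i \<in> Spec R" "\<forall>i<n. c i \<subset> c (Suc i)" "c n = {\<zero>}" for n c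
  proof (rule ccontr)
    assume "n \<noteq> 0"
    then obtain k where k: "n = Suc k"
      using not0_implies_Suc by blast
    then have "c k \<in> Spec R" "c k \<subset> {\<zero>}"
      using c by auto
    then show False
      unfolding Spec_def primeideal_iff ideal_iff by blast
  qed
  then have "{enat n | n. \<exists>c. (\<forall>i\<le>n. c i \<in> Spec R) \<and> (\<forall>i<n. c i \<subset> c (Suc i)) \<and> c n = {\<zero>}} \<subseteq> {0}"
    by (auto simp: zero_enat_def)
  then have "prime_height R {\<zero>} \<le> Sup {0}"
    unfolding prime_height_def by (rule Sup_subset_mono)
  then show ?thesis
    by simp
qed

context "domain"
begin

lemma Spec1_prime:
  assumes "P \<in> Spec1 R"
  shows "primeideal P R" "P \<subseteq> carrier R" "\<zero> \<in> P" "\<one> \<notin> P"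
    "\<And>a b. \<lbrakk>a \<in> carrier R; b \<in> carrier R; a \<otimes> b \<in> P\<rbrakk> \<Longrightarrow> a \<in> P \<or> b \<in> P"
    "\<And>a r. \<lbrakk>a \<in> P; r \<in> carrier R\<rbrakk> \<Longrightarrow> r \<otimes> a \<in> P"
proof -
  show "primeideal P R"
    using assms unfolding Spec1_def Spec_def by simp
  then show "P \<subseteq> carrier R" "\<zero> \<in> P" "\<one> \<notin> P"
    "\<And>a b. \<lbrakk>a \<in> carrier R; b \<in> carrier R; a \<otimes> b \<in> P\<rbrakk> \<Longrightarrow> a \<in> P \<or> b \<in> P"
    "\<And>a r. \<lbrakk>a \<in> P; r \<in> carrier R\<rbrakk> \<Longrightarrow> r \<otimes> a \<in> P"
    unfolding primeideal_iff ideal_iff by auto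
qed

lemma Spec1_no_prime_between:
  assumes P: "P \<in> Spec1 R" and Q: "primeideal Q R" "Q \<subseteq> P" "Q \<noteq> {\<zero>}"
  shows "Q = P"
proof (rule ccontr)
  assume "Q \<noteq> P"
  have "{\<zero>} \<subset> Q"
    using Q(1,3) unfolding primeideal_iff ideal_iff by blast
  moreover have "Q \<subset> P"
    using \<open>Q \<noteq> P\<close> Q(2) by blast
  ultimately have "enat 2 \<le> prime_height R P"
    unfolding prime_height_def using zeroprimeideal Q(1) Spec1_prime(1)[OF P]
    by (intro Sup_upper CollectI exI[of _ "2::nat"] conjI refl
        exI[of _ "\<lambda>i::nat. if i = 0 then {\<zero>} else if i = 1 then Q else P"])
      (auto simp: Spec_def)
  moreover have "prime_height R P = enat 1"
    using P unfolding Spec1_def by (simp add: one_enat_def)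
  ultimately show False
    by simp
qed

text \<open>The localization at \<open>P\<close> has only the primes zero and its maximal ideal, so
  a power of \<open>w\<close> is divisible there by any nonzero \<open>b\<close>. A failure would
  produce a prime that contains \<open>b\<close>, lies inside \<open>P\<close> and misses
  \<open>w\<close>.\<close>

lemma Spec1_power_divisible:
  assumes P: "P \<in> Spec1 R" and b: "b \<in> carrier R" "b \<noteq> \<zero>" and w: "w \<in> P"
  shows "\<exists>(n::nat). \<exists>t\<in>carrier R - P. \<exists>c\<in>carrier R. t \<otimes> w [^] n = c \<otimes> b"
proof (rule ccontr)
  assume none: "\<not> ?thesis"
  note PD = Spec1_prime[OF P]
  have wc: "w \<in> carrier R"
    using w PD(2) by blast
  let ?M = "{t \<otimes> w [^] (n::nat) | t n. t \<in> carrier R - P}"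
  have disj: "PIdl b \<inter> ?M = {}"
    using none unfolding cgenideal_def by fastforce
  have tM: "t \<in> ?M" if "t \<in> carrier R - P" for t
  proof -
    have "t = t \<otimes> w [^] (0::nat)"
      using that by simp
    then show ?thesis
      using that by blast
  qed
  have one: "\<one> \<in> ?M"
    using PD(4) by (intro tM) auto
  have mult: "x \<otimes> y \<in> ?M" if xy: "x \<in> ?M" "y \<in> ?M" for x y
  proof -
    obtain s t and n m :: nat where *: "s \<in> carrier R - P" "t \<in> carrier R - P" "x = s \<otimes> w [^] n" "y = t \<otimes> w [^] m"
      using xy by blast
    have "x \<otimes> y = (s \<otimes> t) \<otimes> (w [^] n \<otimes> w [^] m)"
      using * wc by (simp add: m_ac)
    also have "w [^] n \<otimes> w [^] m = w [^] (n + m)"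
      by (rule nat_pow_mult[OF wc])
    finally have "x \<otimes> y = (s \<otimes> t) \<otimes> w [^] (n + m)" .
    moreover have "s \<otimes> t \<in> carrier R - P"
      using * PD(5) by auto
    ultimately show ?thesis
      by blast
  qed
  obtain Q where Q: "primeideal Q R" "PIdl b \<subseteq> Q" "Q \<inter> ?M = {}"
    by (rule primeideal_disjoint[OF cgenideal_ideal[OF b(1)] disj one mult])
  have Qc: "Q \<subseteq> carrier R"
    using Q(1) unfolding primeideal_iff ideal_iff by blast
  have "Q \<subseteq> P"
  proof
    fix x assume "x \<in> Q"
    then have "x \<notin> ?M" "x \<in> carrier R"
      using Q(3) Qc by (meson disjoint_iff, blast)
    then show "x \<in> P"
      using tM by blast
  qed
  moreover have "b \<in> Q"
    using Q(2) cgenideal_self[OF b(1)] by blast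
  ultimately have "Q = P"
    using Spec1_no_prime_between[OF P Q(1)] b(2) by blast
  moreover have "w = \<one> \<otimes> w [^] (1::nat)"
    using wc by simp
  then have "w \<in> ?M"
    using PD(4) by blast
  ultimately show False
    using w Q(3) by (meson disjoint_iff)
qed

end

locale generalized_Krull = "domain" +
  assumes gKd: "generalized_Krull_domain R"
begin

text \<open>The intersection axiom for the fraction a/b, with denominators cleared so that
  \<open>Frac R\<close> no longer appears.\<close>

lemma intersection:
  assumes ab: "a \<in> carrier R" "b \<in> carrier R" "b \<noteq> \<zero>"
    and loc: "\<And>P. P \<in> Spec1 R \<Longrightarrow> \<exists>t\<in>carrier R - P. \<exists>c\<in>carrier R. t \<otimes> a = c \<otimes> b"
  shows "\<exists>c\<in>carrier R. a = c \<otimes> b"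
proof -
  let ?D = "carrier R - {\<zero>}"
  have "fraction R ?D a b \<in> loc_in_Frac R P" if P: "P \<in> Spec1 R" for P
  proof -
    obtain t c where t: "t \<in> carrier R - P" "c \<in> carrier R" "t \<otimes> a = c \<otimes> b"
      using loc[OF P] by blast
    have "t \<in> ?D"
      using t(1) Spec1_prime(3)[OF P] by auto
    then have "fraction R ?D a b = fraction R ?D c t"
      using ab t by (subst frac_eq_iff) (auto simp: m_comm)
    then show ?thesis
      unfolding loc_in_Frac_def fractions_def using t by blast
  qed
  moreover have "fraction R ?D a b \<in> carrier (Frac R)"
    unfolding Frac_def using ab by (intro frac.fraction_closed) auto
  ultimately have "fraction R ?D a b \<in> base_in_Frac R"
    using gKd unfolding generalized_Krull_domain_def by blast
  then obtain c where "c \<in> carrier R" "fraction R ?D a b = fraction R ?D c \<one>"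
    unfolding base_in_Frac_def fractions_def by blast
  then show ?thesis
    using ab frac.M_one by (subst (asm) frac_eq_iff) auto
qed

text \<open>The valuation axiom with denominators cleared: a/b or b/a can be written with a
  denominator \<open>t\<close> outside \<open>P\<close>.\<close>

lemma valuation:
  assumes P: "P \<in> Spec1 R" and ab: "a \<in> carrier R" "b \<in> carrier R"
  shows "\<exists>t\<in>carrier R - P. \<exists>c\<in>carrier R. t \<otimes> a = c \<otimes> b \<or> t \<otimes> b = c \<otimes> a"
proof -
  note PD = Spec1_prime[OF P]
  interpret M: multiplicative_set R "carrier R - P"
    using PD(4,5) by unfold_locales auto
  have div: "\<exists>t\<in>carrier R - P. \<exists>c\<in>carrier R. t \<otimes> y = c \<otimes> x"
    if xy: "x \<in> carrier R" "y \<in> carrier R"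
      and dvd: "fraction R (carrier R - P) x \<one> divides\<^bsub>localization_at R P\<^esub> fraction R (carrier R - P) y \<one>" for x y
  proof -
    obtain z where z: "z \<in> carrier (localization R (carrier R - P))"
      "fraction R (carrier R - P) y \<one> = fraction R (carrier R - P) x \<one> \<otimes>\<^bsub>localization R (carrier R - P)\<^esub> z"
      using dvd unfolding factor_def localization_at_def by blast
    obtain c t where ct: "c \<in> carrier R" "t \<in> carrier R - P" "z = fraction R (carrier R - P) c t"
      using z(1) by (metis M.localizationE)
    have "fraction R (carrier R - P) y \<one> = fraction R (carrier R - P) (x \<otimes> c) t"
      using z(2) ct xy M.M_one by (simp add: M.fraction_mult)
    then obtain u where u: "u \<in> carrier R - P" "u \<otimes> (y \<otimes> t) = u \<otimes> (x \<otimes> c \<otimes> \<one>)"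
      using xy ct M.M_one by (subst (asm) M.fraction_eq_iff) auto
    have "u \<noteq> \<zero>"
      using u(1) PD(3) by auto
    then have "y \<otimes> t = x \<otimes> c"
      using u xy ct m_lcancel[of u "y \<otimes> t" "x \<otimes> c"] by simp
    then have "t \<otimes> y = c \<otimes> x"
      using xy ct by (simp add: m_comm)
    then show ?thesis
      using ct by blast
  qed
  have "valuation_domain (localization_at R P)"
    using gKd P unfolding generalized_Krull_domain_def by blast
  moreover have "fraction R (carrier R - P) a \<one> \<in> carrier (localization_at R P)"
    "fraction R (carrier R - P) b \<one> \<in> carrier (localization_at R P)"
    unfolding localization_at_def using ab M.M_one by auto
  ultimately have "fraction R (carrier R - P) a \<one> divides\<^bsub>localization_at R P\<^esub> fraction R (carrier R - P) b \<one> \<or>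
      fraction R (carrier R - P) b \<one> divides\<^bsub>localization_at R P\<^esub> fraction R (carrier R - P) a \<one>"
    unfolding valuation_domain_def by blast
  then show ?thesis
    using div ab by blast
qed

text \<open>Only finitely many height one primes contain \<open>b\<close> and meet \<open>W\<close>; multiplying \<open>a\<close> with a suitable
  element of \<open>W\<close> neutralizes them.\<close>

lemma localized_intersection:
  assumes W: "W \<subseteq> carrier R" "\<one> \<in> W" "\<And>v w. \<lbrakk>v \<in> W; w \<in> W\<rbrakk> \<Longrightarrow> v \<otimes> w \<in> W"
    and ab: "a \<in> carrier R" "b \<in> carrier R" "b \<noteq> \<zero>"
    and loc: "\<And>P. \<lbrakk>P \<in> Spec1 R; P \<inter> W = {}\<rbrakk> \<Longrightarrow> \<exists>t\<in>carrier R - P. \<exists>c\<in>carrier R. t \<otimes> a = c \<otimes> b"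
  shows "\<exists>w\<in>W. \<exists>c\<in>carrier R. w \<otimes> a = c \<otimes> b"
proof -
  define F where "F = {P \<in> Spec1 R. b \<in> P \<and> P \<inter> W \<noteq> {}}"
  have "finite {P \<in> Spec1 R. b \<in> P}"
    using gKd ab unfolding generalized_Krull_domain_def by blast
  then have "finite F"
    unfolding F_def by (rule rev_finite_subset) blast
  moreover have "F \<subseteq> Spec1 R" "\<And>P. P \<in> F \<Longrightarrow> P \<inter> W \<noteq> {}"
    unfolding F_def by auto
  \<comment> \<open>The element \<open>w\<close> is a product of powers, one for each prime in
    \<open>F\<close>; at each of these primes one factor is divisible by \<open>b\<close>, and the
    others do no harm.\<close>
  ultimately have "\<exists>w\<in>W. \<forall>P\<in>F. \<exists>t\<in>carrier R - P. \<exists>c\<in>carrier R. t \<otimes> w = c \<otimes> b"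
  proof (induction F rule: finite_induct)
    case empty
    then show ?case
      using W(2) by blast
  next
    case (insert P F)
    then obtain w where w: "w \<in> W" "\<And>Q. Q \<in> F \<Longrightarrow> \<exists>t\<in>carrier R - Q. \<exists>c\<in>carrier R. t \<otimes> w = c \<otimes> b"
      by auto
    obtain v where v: "v \<in> P" "v \<in> W"
      using insert.prems(2)[of P] by blast
    have PS: "P \<in> Spec1 R"
      using insert.prems(1) by simp
    obtain n :: nat and t c where n: "t \<in> carrier R - P" "c \<in> carrier R" "t \<otimes> v [^] n = c \<otimes> b"
      using Spec1_power_divisible[OF PS ab(2,3) v(1)] by blast
    have vn: "v [^] n \<in> W"
      using W(2,3) v(2) by (induction n) auto
    have carr: "v [^] n \<in> carrier R" "w \<in> carrier R"
      using vn w(1) W(1) by auto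
    have "\<exists>t\<in>carrier R - Q. \<exists>c\<in>carrier R. t \<otimes> (v [^] n \<otimes> w) = c \<otimes> b" if Q: "Q \<in> insert P F" for Q
    proof (cases "Q = P")
      case True
      have "t \<otimes> (v [^] n \<otimes> w) = (t \<otimes> v [^] n) \<otimes> w"
        using n(1) carr by (simp add: m_assoc)
      also have "\<dots> = (w \<otimes> c) \<otimes> b"
        unfolding n(3) using n(2) ab(2) carr by (simp add: m_ac)
      finally show ?thesis
        using n(1,2) carr True by blast
    next
      case False
      then obtain s d where s: "s \<in> carrier R - Q" "d \<in> carrier R" "s \<otimes> w = d \<otimes> b"
        using w(2) Q by blast
      have "s \<otimes> (v [^] n \<otimes> w) = v [^] n \<otimes> (s \<otimes> w)"
        using s(1) carr by (simp add: m_ac)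
      also have "\<dots> = (v [^] n \<otimes> d) \<otimes> b"
        unfolding s(3) using s(2) ab(2) carr by (simp add: m_assoc)
      finally show ?thesis
        using s(1,2) carr by blast
    qed
    then show ?case
      using W(3)[OF vn w(1)] by blast
  qed
  then obtain w where w: "w \<in> W" "\<And>P. P \<in> F \<Longrightarrow> \<exists>t\<in>carrier R - P. \<exists>c\<in>carrier R. t \<otimes> w = c \<otimes> b"
    by blast
  have wc: "w \<in> carrier R"
    using w(1) W(1) by blast
  have "\<exists>t\<in>carrier R - P. \<exists>c\<in>carrier R. t \<otimes> (w \<otimes> a) = c \<otimes> b" if P: "P \<in> Spec1 R" for P
  proof -
    \<comment> \<open>Primes in \<open>F\<close> are handled by \<open>w\<close>, primes disjoint
      from \<open>W\<close> by the assumption \<open>loc\<close>, and for primes not containing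
      \<open>b\<close> the element \<open>b\<close> itself serves as the factor outside the
      prime.\<close>
    consider "P \<in> F" | "P \<inter> W = {}" | "b \<notin> P"
      using P unfolding F_def by blast
    then show ?thesis
    proof cases
      case 1
      then obtain t c where t: "t \<in> carrier R - P" "c \<in> carrier R" "t \<otimes> w = c \<otimes> b"
        using w(2) by blast
      have "t \<otimes> (w \<otimes> a) = (t \<otimes> w) \<otimes> a"
        using t(1) wc ab by (simp add: m_assoc)
      also have "\<dots> = (c \<otimes> a) \<otimes> b"
        unfolding t(3) using t(2) ab by (simp add: m_ac)
      finally show ?thesis
        using t(1,2) ab(1) by blast
    next
      case 2
      then obtain t c where t: "t \<in> carrier R - P" "c \<in> carrier R" "t \<otimes> a = c \<otimes> b"
        using loc[OF P] by blast
      have "t \<otimes> (w \<otimes> a) = w \<otimes> (t \<otimes> a)"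
        using t(1) wc ab by (simp add: m_ac)
      also have "\<dots> = (w \<otimes> c) \<otimes> b"
        unfolding t(3) using t(2) ab wc by (simp add: m_assoc)
      finally show ?thesis
        using t(1,2) wc by blast
    next
      case 3
      have "b \<otimes> (w \<otimes> a) = (w \<otimes> a) \<otimes> b"
        using ab wc by (simp add: m_comm)
      then show ?thesis
        using 3 ab wc by blast
    qed
  qed
  then have "\<exists>c\<in>carrier R. w \<otimes> a = c \<otimes> b"
    using intersection[of "w \<otimes> a" b] ab wc by simp
  then show ?thesis
    using w(1) by blast
qed

end


section \<open>The pullback inside its fraction field\<close>

text \<open>Height at least two enters through two facts assumed here: \<open>J\<close> lies in no
  height one prime, and it has a nonzero element \<open>j\<close>, which serves as a universal
  denominator for \<open>S\<close> over the pullback.\<close>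

locale Krull_pullback = generalized_Krull S for S (structure) +
  fixes J A j
  assumes J_ideal: "ideal J S" and A_subring: "subring A (S Quot J)"
    and J_not_Spec1: "\<And>P. P \<in> Spec1 S \<Longrightarrow> \<not> J \<subseteq> P"
    and j: "j \<in> J" "j \<noteq> \<zero>"
begin

definition P where "P = {s \<in> carrier S. J +> s \<in> A}"
abbreviation PR where "PR \<equiv> pullback_ring S J A"
abbreviation K where "K \<equiv> Frac PR"
abbreviation D where "D \<equiv> P - {\<zero>}"
abbreviation B where "B \<equiv> S Quot J"

lemma PR_eq: "PR = S\<lparr>carrier := P\<rparr>"
  unfolding pullback_ring_def P_def ..

lemma B_cring: "cring B"
  by (rule ideal.quotient_is_cring[OF J_ideal is_cring])

lemma quot_hom: "(+>) J \<in> ring_hom S B"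
  by (rule ideal.rcos_ring_hom[OF J_ideal])

lemma J_carrier: "x \<in> J \<Longrightarrow> x \<in> carrier S"
  using ideal.Icarr[OF J_ideal] .

lemma J_absorb: "x \<in> J \<Longrightarrow> s \<in> carrier S \<Longrightarrow> s \<otimes> x \<in> J"
  using ideal.I_l_closed[OF J_ideal] .

lemma quot_zero_iff: "s \<in> carrier S \<Longrightarrow> J +> s = \<zero>\<^bsub>B\<^esub> \<longleftrightarrow> s \<in> J"
  using ideal.rcos_const_imp_mem[OF J_ideal, of s] a_rcos_zero[OF J_ideal, of s]
  unfolding FactRing_def by auto

lemma P_subring: "subring P S"
proof -
  interpret q: ring_hom_ring S B "(+>) J"
    by (rule ring_hom_ringI2[OF ring_axioms cring.axioms(1)[OF B_cring] quot_hom])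
  note A = subringE[OF A_subring]
  show ?thesis
    by (rule subringI) (use A in \<open>auto simp: P_def\<close>)
qed

lemmas P_closed = subringE[OF P_subring]

lemma P_carrier: "x \<in> P \<Longrightarrow> x \<in> carrier S"
  using P_closed(1) by blast

lemma J_subset_P: "J \<subseteq> P"
proof
  fix x assume x: "x \<in> J"
  then have "J +> x = \<zero>\<^bsub>B\<^esub>"
    using quot_zero_iff J_carrier by simp
  then show "x \<in> P"
    using subringE(2)[OF A_subring] J_carrier[OF x] unfolding P_def by simp
qed

sublocale PR: "domain" PR
  unfolding PR_eq by (rule subring_is_domain[OF P_subring])

sublocale K: field K
  by (rule PR.Frac_field)

lemma PR_simps: "carrier PR = P" "monoid.mult PR = monoid.mult S" "monoid.one PR = monoid.one S" "ring.zero PR = ring.zero S" "ring.add PR = ring.add S"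
  unfolding PR_eq by simp_all

abbreviation fr where "fr a s \<equiv> fraction PR D a s"

lemma fr_eq_iff:
  "\<lbrakk>a \<in> P; s \<in> D; b \<in> P; t \<in> D\<rbrakk> \<Longrightarrow> fr a s = fr b t \<longleftrightarrow> a \<otimes> t = b \<otimes> s"
  using PR.frac_eq_iff unfolding PR_simps .

lemma fr_closed: "\<lbrakk>a \<in> P; s \<in> D\<rbrakk> \<Longrightarrow> fr a s \<in> carrier K"
  using PR.frac.fraction_closed unfolding Frac_def PR_simps .

lemma frE:
  assumes "x \<in> carrier K"
  obtains a s where "a \<in> P" "s \<in> D" "x = fr a s"
  using PR.frac.localizationE[of x] assms that unfolding Frac_def PR_simps by metis

lemma fr_mult: "\<lbrakk>a \<in> P; s \<in> D; b \<in> P; t \<in> D\<rbrakk> \<Longrightarrow> fr a s \<otimes>\<^bsub>K\<^esub> fr b t = fr (a \<otimes> b) (s \<otimes> t)"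
  using PR.frac.fraction_mult unfolding Frac_def PR_simps .

lemma fr_add_same: "\<lbrakk>a \<in> P; b \<in> P; s \<in> D\<rbrakk> \<Longrightarrow> fr a s \<oplus>\<^bsub>K\<^esub> fr b s = fr (a \<oplus> b) s"
  using PR.frac.fraction_add_same unfolding Frac_def PR_simps .

lemma fr_one: "\<one>\<^bsub>K\<^esub> = fr \<one> \<one>"
  using PR.frac.localization_one unfolding Frac_def PR_simps .

lemma D_mult: "s \<in> D \<Longrightarrow> t \<in> D \<Longrightarrow> s \<otimes> t \<in> D"
  using PR.frac.M_mult unfolding PR_simps .

lemma D_one: "\<one> \<in> D"
  using PR.frac.M_one unfolding PR_simps .

lemma jD: "j \<in> D"
  using j J_subset_P by blast

lemma J_mult: "s \<in> carrier S \<Longrightarrow> s \<otimes> j \<in> P"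
  using J_absorb[OF j(1)] J_subset_P by blast

text \<open>The embedding of \<open>S\<close> into the fraction field of the pullback, possible since \<open>J\<close> is a common ideal.\<close>

definition \<phi> where "\<phi> s = fr (s \<otimes> j) j"

lemma \<phi>_P: "r \<in> P \<Longrightarrow> \<phi> r = fr r \<one>"
  unfolding \<phi>_def using jD D_one J_mult P_carrier by (subst fr_eq_iff) auto

lemma \<phi>_closed: "s \<in> carrier S \<Longrightarrow> \<phi> s \<in> carrier K"
  unfolding \<phi>_def using jD J_mult by (intro fr_closed) auto

lemma \<phi>_hom: "\<phi> \<in> ring_hom S K"
proof (rule ring_hom_memI)
  have jc: "j \<in> carrier S"
    using j(1) J_carrier by simp
  fix s assume s: "s \<in> carrier S"
  show "\<phi> s \<in> carrier K"
    by (rule \<phi>_closed[OF s])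
  fix t assume t: "t \<in> carrier S"
  have "(s \<otimes> j) \<oplus> (t \<otimes> j) = (s \<oplus> t) \<otimes> j"
    using s t jc by (simp add: l_distr)
  then show "\<phi> (s \<oplus> t) = \<phi> s \<oplus>\<^bsub>K\<^esub> \<phi> t"
    unfolding \<phi>_def using s t J_mult jD fr_add_same by simp
  have "(s \<otimes> t \<otimes> j) \<otimes> (j \<otimes> j) = (s \<otimes> j) \<otimes> (t \<otimes> j) \<otimes> j"
    using s t jc by (simp add: m_ac)
  then have "fr (s \<otimes> t \<otimes> j) j = fr ((s \<otimes> j) \<otimes> (t \<otimes> j)) (j \<otimes> j)"
    using J_mult s t jD D_mult P_closed(6) by (subst fr_eq_iff) auto
  then show "\<phi> (s \<otimes> t) = \<phi> s \<otimes>\<^bsub>K\<^esub> \<phi> t"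
    unfolding \<phi>_def using s t J_mult jD fr_mult by simp
next
  show "\<phi> \<one> = \<one>\<^bsub>K\<^esub>"
    using \<phi>_P[OF P_closed(3)] fr_one by simp
qed

sublocale \<phi>: ring_hom_ring S K \<phi>
  by (rule ring_hom_ringI2[OF ring_axioms K.ring_axioms \<phi>_hom])

lemma \<phi>_inj: "inj_on \<phi> (carrier S)"
proof (rule inj_onI)
  fix s t assume st: "s \<in> carrier S" "t \<in> carrier S" "\<phi> s = \<phi> t"
  have jc: "j \<in> carrier S"
    using j(1) J_carrier by simp
  have "(s \<otimes> j) \<otimes> j = (t \<otimes> j) \<otimes> j"
    using st J_mult jD unfolding \<phi>_def by (subst (asm) fr_eq_iff) auto
  then show "s = t"
    using st(1,2) jc j(2) by (simp add: m_rcancel)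
qed

lemma \<phi>_eq_iff: "\<lbrakk>s \<in> carrier S; t \<in> carrier S\<rbrakk> \<Longrightarrow> \<phi> s = \<phi> t \<longleftrightarrow> s = t"
  using \<phi>_inj by (auto dest: inj_onD)

lemma \<phi>_mem_iff: "\<lbrakk>s \<in> carrier S; E \<subseteq> carrier S\<rbrakk> \<Longrightarrow> \<phi> s \<in> \<phi> ` E \<longleftrightarrow> s \<in> E"
  using \<phi>_inj by (rule inj_on_image_mem_iff)

lemma \<phi>_eq_zero_iff: "s \<in> carrier S \<Longrightarrow> \<phi> s = \<zero>\<^bsub>K\<^esub> \<longleftrightarrow> s = \<zero>"
  using \<phi>_eq_iff[of s \<zero>] \<phi>.hom_zero by simp

lemma fr_denominator:
  assumes "a \<in> P" "s \<in> D"
  shows "\<phi> s \<otimes>\<^bsub>K\<^esub> fr a s = \<phi> a"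
proof -
  have c: "a \<in> carrier S" "s \<in> carrier S" "s \<in> P"
    using assms P_carrier by auto
  have "\<phi> s \<otimes>\<^bsub>K\<^esub> fr a s = fr (s \<otimes> a) (\<one> \<otimes> s)"
    using assms c D_one by (simp add: \<phi>_P fr_mult)
  also have "\<dots> = fr a \<one>"
    using assms c D_one P_closed(6) by (subst fr_eq_iff) (auto simp: m_comm)
  finally show ?thesis
    using assms(1) by (simp add: \<phi>_P)
qed

lemma base_in_Frac_eq: "base_in_Frac PR = \<phi> ` P"
  unfolding base_in_Frac_def fractions_def PR_simps using \<phi>_P by force

text \<open>The embedding is undone before reducing, so that \<open>\<psi>\<close> lives on the copy
  of \<open>S\<close> in \<open>K\<close>, as \<open>pullback_in_field\<close> asks.\<close>

definition \<psi> where "\<psi> y = J +> (inv_into (carrier S) \<phi> y)"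

lemma \<psi>_\<phi>: "s \<in> carrier S \<Longrightarrow> \<psi> (\<phi> s) = J +> s"
  unfolding \<psi>_def using \<phi>_inj by (simp add: inv_into_f_f)

sublocale pb: pullback_in_field K B "\<phi> ` carrier S" A \<psi>
proof -
  interpret q: ring_hom_ring S B "(+>) J"
    by (rule ring_hom_ringI2[OF ring_axioms cring.axioms(1)[OF B_cring] quot_hom])
  interpret B: cring B
    by (rule B_cring)
  show "pullback_in_field K B (\<phi> ` carrier S) A \<psi>"
  proof (intro pullback_in_field.intro pullback_in_field_axioms.intro K.field_axioms B_cring A_subring)
    show "subring (\<phi> ` carrier S) K"
      by (rule \<phi>.img_is_subring[OF carrier_is_subring])
    show "\<psi> \<in> ring_hom (K\<lparr>carrier := \<phi> ` carrier S\<rparr>) B"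
    proof (rule ring_hom_memI)
      show "\<psi> \<one>\<^bsub>K\<lparr>carrier := \<phi> ` carrier S\<rparr>\<^esub> = \<one>\<^bsub>B\<^esub>"
        using \<psi>_\<phi>[of \<one>] by simp
    next
      fix x assume "x \<in> carrier (K\<lparr>carrier := \<phi> ` carrier S\<rparr>)"
      then obtain s where s: "s \<in> carrier S" "x = \<phi> s"
        by auto
      show "\<psi> x \<in> carrier B"
        using s \<psi>_\<phi> by simp
      fix y assume "y \<in> carrier (K\<lparr>carrier := \<phi> ` carrier S\<rparr>)"
      then obtain t where t: "t \<in> carrier S" "y = \<phi> t"
        by auto
      show "\<psi> (x \<otimes>\<^bsub>K\<lparr>carrier := \<phi> ` carrier S\<rparr>\<^esub> y) = \<psi> x \<otimes>\<^bsub>B\<^esub> \<psi> y"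
        using s t \<psi>_\<phi>[of s] \<psi>_\<phi>[of t] \<psi>_\<phi>[of "s \<otimes> t"] by simp
      show "\<psi> (x \<oplus>\<^bsub>K\<lparr>carrier := \<phi> ` carrier S\<rparr>\<^esub> y) = \<psi> x \<oplus>\<^bsub>B\<^esub> \<psi> y"
        using s t \<psi>_\<phi>[of s] \<psi>_\<phi>[of t] \<psi>_\<phi>[of "s \<oplus> t"] by simp
    qed
    have "\<psi> ` \<phi> ` carrier S = (+>) J ` carrier S"
      unfolding image_image using \<psi>_\<phi> by (intro image_cong) auto
    also have "\<dots> = carrier B"
      unfolding FactRing_def A_RCOSETS_def' by auto
    finally show "\<psi> ` \<phi> ` carrier S = carrier B" .
  qed
qed

lemma pb_R_eq: "pb.R = \<phi> ` P"
  unfolding pb.R_def P_def using \<psi>_\<phi> by auto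

lemma pb_R_base: "base_in_Frac PR = pb.R"
  unfolding base_in_Frac_eq pb_R_eq ..

lemma Frac_rep:
  assumes "x \<in> carrier K"
  obtains a b where "a \<in> P" "b \<in> D" "\<phi> b \<otimes>\<^bsub>K\<^esub> x = \<phi> a" "x = fr a b"
proof -
  obtain a b where "a \<in> P" "b \<in> D" "x = fr a b"
    by (rule frE[OF assms])
  then show thesis
    using that fr_denominator by simp
qed

section \<open>Primes, localizations and overrings of the pullback inside its fraction field\<close>

lemma prime_\<phi>_image:
  assumes "primeideal p PR"
  shows "primeideal (\<phi> ` p) (K\<lparr>carrier := pb.R\<rparr>)"
proof (rule primeideal_image(1)[OF PR.is_cring K.subring_cring[OF pb.R_subring] _ _ assms])
  show "\<phi> \<in> ring_hom PR (K\<lparr>carrier := pb.R\<rparr>)"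
    using P_carrier unfolding pb_R_eq by (intro ring_hom_memI) (auto simp: PR_simps)
  show "\<phi> ` carrier PR = carrier (K\<lparr>carrier := pb.R\<rparr>)"
    by (simp add: PR_simps pb_R_eq)
  fix x assume "x \<in> carrier PR" "\<phi> x = \<zero>\<^bsub>K\<lparr>carrier := pb.R\<rparr>\<^esub>"
  then have "x = \<zero>"
    using \<phi>_eq_zero_iff P_carrier by (simp add: PR_simps)
  then show "x \<in> p"
    using assms unfolding PR.primeideal_iff PR.ideal_iff by (simp add: PR_simps)
qed

lemma prime_\<phi>_preimage:
  assumes "primeideal q (K\<lparr>carrier := pb.R\<rparr>)"
  obtains p where "primeideal p PR" "\<phi> ` p = q"
proof
  have "\<phi> \<in> ring_hom PR (K\<lparr>carrier := pb.R\<rparr>)"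
    using P_carrier unfolding pb_R_eq by (intro ring_hom_memI) (auto simp: PR_simps)
  from primeideal_contraction[OF PR.is_cring K.subring_cring[OF pb.R_subring] this assms]
  show "primeideal {x \<in> P. \<phi> x \<in> q} PR"
    by (simp add: PR_simps)
  have "q \<subseteq> \<phi> ` P"
    using K.prime_in_subringD(1)[OF pb.R_subring assms] unfolding pb_R_eq .
  then show "\<phi> ` {x \<in> P. \<phi> x \<in> q} = q"
    by blast
qed

text \<open>One side is built from pairs, the other from multipliers in \<open>K\<close>; they agree
  because an element of a field is determined by its product with a nonzero element.\<close>

lemma loc_in_Frac_eq:
  assumes p: "primeideal p PR"
  shows "loc_in_Frac PR p = fractions_within K (pb.R - \<phi> ` p) pb.R"
proof
  have pP: "p \<subseteq> P" "\<zero> \<in> p"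
    using p unfolding PR.primeideal_iff PR.ideal_iff by (auto simp: PR_simps)
  have pc: "p \<subseteq> carrier S"
    using pP P_carrier by blast
  show "loc_in_Frac PR p \<subseteq> fractions_within K (pb.R - \<phi> ` p) pb.R"
  proof
    fix x assume "x \<in> loc_in_Frac PR p"
    then obtain a s where as: "a \<in> P" "s \<in> P" "s \<notin> p" "x = fr a s"
      unfolding loc_in_Frac_def fractions_def PR_simps by blast
    then have "s \<in> D"
      using pP by auto
    then have "\<phi> s \<otimes>\<^bsub>K\<^esub> x = \<phi> a" "x \<in> carrier K"
      using fr_denominator fr_closed as by auto
    moreover have "\<phi> s \<in> pb.R - \<phi> ` p"
      using as \<phi>_mem_iff[OF P_carrier pc] unfolding pb_R_eq by blast
    moreover have "\<phi> a \<in> pb.R"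
      using as unfolding pb_R_eq by blast
    ultimately show "x \<in> fractions_within K (pb.R - \<phi> ` p) pb.R"
      unfolding fractions_within_def by (auto intro!: bexI[of _ "\<phi> s"])
  qed
  show "fractions_within K (pb.R - \<phi> ` p) pb.R \<subseteq> loc_in_Frac PR p"
  proof
    fix x assume "x \<in> fractions_within K (pb.R - \<phi> ` p) pb.R"
    then obtain y z where yz: "x \<in> carrier K" "y \<in> \<phi> ` P - \<phi> ` p" "y \<otimes>\<^bsub>K\<^esub> x = z" "z \<in> \<phi> ` P"
      unfolding fractions_within_def pb_R_eq by blast
    then obtain s a where s: "s \<in> P" "s \<notin> p" "a \<in> P" "\<phi> s \<otimes>\<^bsub>K\<^esub> x = \<phi> a"
      by blast
    have sD: "s \<in> D"
      using s pP by auto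
    have "\<phi> s \<otimes>\<^bsub>K\<^esub> x = \<phi> s \<otimes>\<^bsub>K\<^esub> fr a s"
      using fr_denominator[OF s(3) sD] s(4) by simp
    then have "x = fr a s"
      using K.m_lcancel[of "\<phi> s" x "fr a s"] \<phi>_eq_zero_iff[of s] sD P_carrier \<phi>_closed yz(1) fr_closed[OF s(3) sD]
      by auto
    then show "x \<in> loc_in_Frac PR p"
      unfolding loc_in_Frac_def fractions_def PR_simps using s by blast
  qed
qed

text \<open>Overrings and localizations become subsets of \<open>K\<close>, the form in which the
  results on \<open>pullback_in_field\<close> apply.\<close>

lemma perinormal_iff:
  "perinormal PR \<longleftrightarrow>
    (\<forall>L. subring L K \<and> pb.R \<subseteq> L \<and> local_ring (K\<lparr>carrier := L\<rparr>) \<and> going_down pb.R (K\<lparr>carrier := L\<rparr>) \<longrightarrow>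
      (\<exists>q. primeideal q (K\<lparr>carrier := pb.R\<rparr>) \<and> L = fractions_within K (pb.R - q) pb.R))"
proof -
  have "(\<exists>p\<in>Spec PR. L = loc_in_Frac PR p) \<longleftrightarrow>
    (\<exists>q. primeideal q (K\<lparr>carrier := pb.R\<rparr>) \<and> L = fractions_within K (pb.R - q) pb.R)" for L
  proof
    assume "\<exists>p\<in>Spec PR. L = loc_in_Frac PR p"
    then obtain p where p: "primeideal p PR" "L = loc_in_Frac PR p"
      unfolding Spec_def by blast
    then show "\<exists>q. primeideal q (K\<lparr>carrier := pb.R\<rparr>) \<and> L = fractions_within K (pb.R - q) pb.R"
      using prime_\<phi>_image[OF p(1)] loc_in_Frac_eq[OF p(1)] by metis
  next
    assume "\<exists>q. primeideal q (K\<lparr>carrier := pb.R\<rparr>) \<and> L = fractions_within K (pb.R - q) pb.R"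
    then obtain q where q: "primeideal q (K\<lparr>carrier := pb.R\<rparr>)" "L = fractions_within K (pb.R - q) pb.R"
      by blast
    obtain p where p: "primeideal p PR" "\<phi> ` p = q"
      by (rule prime_\<phi>_preimage[OF q(1)])
    then show "\<exists>p\<in>Spec PR. L = loc_in_Frac PR p"
      using q(2) loc_in_Frac_eq[OF p(1)] unfolding Spec_def by auto
  qed
  then show ?thesis
    unfolding perinormal_def overring_def pb_R_base using PR.domain_axioms by simp
qed

text \<open>Write \<open>x\<close> as a/b. For a height one prime \<open>p\<close> of
  \<open>S\<close> whose trace lies in \<open>q\<close>, some prime \<open>Q\<close> of
  \<open>L\<close> has the same trace. If \<open>x\<close> were outside the localization of
  \<open>S\<close> at \<open>p\<close>, the valuation property would give t = c x with
  \<open>c\<close> in \<open>p\<close> and \<open>t\<close> outside, and \<open>Q\<close> would have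
  too large a trace. Finite character then turns these local denominators into a single one outside
  \<open>q\<close>.\<close>

lemma overring_bound:
  assumes L: "subring L K" "pb.R \<subseteq> L" and q: "primeideal q (K\<lparr>carrier := pb.R\<rparr>)"
    and over: "\<And>q'. \<lbrakk>primeideal q' (K\<lparr>carrier := pb.R\<rparr>); q' \<subseteq> q\<rbrakk> \<Longrightarrow>
        \<exists>Q. primeideal Q (K\<lparr>carrier := L\<rparr>) \<and> Q \<inter> pb.R = q'"
  shows "L \<subseteq> fractions_within K (pb.R - q) (\<phi> ` carrier S)"
proof
  fix x assume x: "x \<in> L"
  note qD = K.prime_in_subringD[OF pb.R_subring q]
  have xc: "x \<in> carrier K"
    using x subringE(1)[OF L(1)] by blast
  obtain a b where ab: "a \<in> P" "b \<in> D" "\<phi> b \<otimes>\<^bsub>K\<^esub> x = \<phi> a"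
    by (rule Frac_rep[OF xc])
  \<comment> \<open>A height one prime is disjoint from \<open>W\<close> exactly if the image of its
    trace on the pullback lies in \<open>q\<close>, and these are the primes that
    \<open>over\<close> lifts to \<open>L\<close>.\<close>
  define W where "W = {w \<in> P. \<phi> w \<notin> q}"
  have W: "W \<subseteq> carrier S" "\<one> \<in> W" "\<And>v w. v \<in> W \<Longrightarrow> w \<in> W \<Longrightarrow> v \<otimes> w \<in> W"
  proof -
    show "W \<subseteq> carrier S"
      unfolding W_def using P_carrier by blast
    show "\<one> \<in> W"
      unfolding W_def using P_closed(3) qD(3) by simp
    show "v \<otimes> w \<in> W" if "v \<in> W" "w \<in> W" for v w
      using that P_closed(6)[of v w] qD(6)[of "\<phi> v" "\<phi> w"] P_carrier unfolding W_def pb_R_eq by auto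
  qed
  have "\<exists>t\<in>carrier S - p. \<exists>c\<in>carrier S. t \<otimes> a = c \<otimes> b" if p: "p \<in> Spec1 S" "p \<inter> W = {}" for p
  proof -
    note pD = Spec1_prime[OF p(1)]
    have "primeideal (p \<inter> P) PR"
      unfolding PR_eq using primeideal_subring_contraction[OF P_subring carrier_is_subring _ , of p] pD(1) P_closed(1)
      by simp
    then have "primeideal (\<phi> ` (p \<inter> P)) (K\<lparr>carrier := pb.R\<rparr>)"
      by (rule prime_\<phi>_image)
    moreover have "\<phi> ` (p \<inter> P) \<subseteq> q"
      using p(2) unfolding W_def by blast
    ultimately obtain Q where Q: "primeideal Q (K\<lparr>carrier := L\<rparr>)" "Q \<inter> pb.R = \<phi> ` (p \<inter> P)"
      using over by blast
    note QD = K.prime_in_subringD[OF L(1) Q(1)]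
    have carr: "a \<in> carrier S" "b \<in> carrier S" "b \<noteq> \<zero>" "b \<in> P"
      using ab(1,2) P_carrier by auto
    obtain t c where t: "t \<in> carrier S - p" "c \<in> carrier S" "t \<otimes> a = c \<otimes> b \<or> t \<otimes> b = c \<otimes> a"
      using valuation[OF p(1) carr(1,2)] by blast
    show ?thesis
    proof (cases "t \<otimes> a = c \<otimes> b \<or> c \<notin> p")
      case True
      then show ?thesis
        \<comment> \<open>If \<open>c\<close> is outside \<open>p\<close>, then t b = c a exhibits
          a/b with denominator \<open>c\<close>.\<close>
        using t by (metis DiffD1 DiffI)
    next
      case False
      then have tb: "t \<otimes> b = c \<otimes> a" and cp: "c \<in> p"
        using t(3) by auto
      \<comment> \<open>\<open>t\<close> and \<open>c\<close> are only known to lie in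
        \<open>S\<close>; multiplying by \<open>i\<close> moves both into the pullback, where
        \<open>Q\<close> can detect them, and keeps t i outside \<open>p\<close>.\<close>
      obtain i where i: "i \<in> J" "i \<notin> p"
        using J_not_Spec1[OF p(1)] by blast
      have ic: "i \<in> carrier S"
        using i(1) J_carrier by simp
      have iP: "t \<otimes> i \<in> P" "c \<otimes> i \<in> P"
        using J_absorb[OF i(1)] t J_subset_P by auto
      have cip: "c \<otimes> i \<in> p"
        using pD(6)[OF cp ic] ic t(2) by (simp add: m_comm)
      have "\<phi> b \<otimes>\<^bsub>K\<^esub> \<phi> (t \<otimes> i) = \<phi> (c \<otimes> i) \<otimes>\<^bsub>K\<^esub> \<phi> a"
      proof -
        have "b \<otimes> (t \<otimes> i) = (t \<otimes> b) \<otimes> i"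
          using carr t(1) ic by (simp add: m_ac)
        also have "\<dots> = (c \<otimes> i) \<otimes> a"
          unfolding tb using carr t(2) ic by (simp add: m_ac)
        finally have "\<phi> (b \<otimes> (t \<otimes> i)) = \<phi> ((c \<otimes> i) \<otimes> a)"
          by simp
        then show ?thesis
          using carr t(1,2) ic by simp
      qed
      also have "\<dots> = \<phi> b \<otimes>\<^bsub>K\<^esub> (\<phi> (c \<otimes> i) \<otimes>\<^bsub>K\<^esub> x)"
        unfolding ab(3)[symmetric] using carr t(2) ic xc \<phi>_closed by (simp add: K.m_ac)
      finally have "\<phi> (t \<otimes> i) = \<phi> (c \<otimes> i) \<otimes>\<^bsub>K\<^esub> x"
        using K.m_lcancel[of "\<phi> b"] \<phi>_eq_zero_iff[OF carr(2)] carr t(1,2) ic xc \<phi>_closed by simp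
      also have "\<dots> = x \<otimes>\<^bsub>K\<^esub> \<phi> (c \<otimes> i)"
        using t(2) ic xc \<phi>_closed by (simp add: K.m_comm)
      \<comment> \<open>The image of c i lies in \<open>Q\<close>, and t i becomes a multiple of it
        in \<open>L\<close>; so t i falls into the trace of \<open>Q\<close>, which is that of
        \<open>p\<close>.\<close>
      also have "\<dots> \<in> Q"
        using QD(5)[of "\<phi> (c \<otimes> i)" x] x Q(2) cip iP(2) by blast
      finally have "\<phi> (t \<otimes> i) \<in> \<phi> ` (p \<inter> P)"
        using iP(1) Q(2) unfolding pb_R_eq by blast
      then have "t \<otimes> i \<in> p"
        using \<phi>_mem_iff[of "t \<otimes> i" "p \<inter> P"] pD(2) t(1) ic by auto
      then show ?thesis
        using pD(5)[of t i] t(1) ic i(2) by blast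
    qed
  qed
  then obtain w c where wc: "w \<in> W" "c \<in> carrier S" "w \<otimes> a = c \<otimes> b"
    using localized_intersection[OF W, of a b] ab(1,2) P_carrier by auto
  have carr: "a \<in> carrier S" "b \<in> carrier S" "b \<noteq> \<zero>" "w \<in> carrier S"
    using ab(1,2) P_carrier wc(1) W(1) by auto
  have "\<phi> b \<otimes>\<^bsub>K\<^esub> (\<phi> w \<otimes>\<^bsub>K\<^esub> x) = \<phi> w \<otimes>\<^bsub>K\<^esub> \<phi> a"
    unfolding ab(3)[symmetric] using carr xc \<phi>_closed by (simp add: K.m_ac)
  also have "\<dots> = \<phi> (w \<otimes> a)"
    using carr by simp
  also have "\<dots> = \<phi> b \<otimes>\<^bsub>K\<^esub> \<phi> c"
    unfolding wc(3) using carr wc(2) \<phi>_closed by (simp add: K.m_comm)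
  finally have "\<phi> w \<otimes>\<^bsub>K\<^esub> x = \<phi> c"
    using K.m_lcancel[of "\<phi> b"] \<phi>_eq_zero_iff[OF carr(2)] carr wc(2) xc \<phi>_closed by simp
  moreover have "\<phi> w \<in> pb.R - q"
    using wc(1) unfolding W_def pb_R_eq by blast
  ultimately show "x \<in> fractions_within K (pb.R - q) (\<phi> ` carrier S)"
    unfolding fractions_within_def using xc wc(2) by blast
qed

end

lemma (in domain) ideal_height_zero_if_zero_ideal: "ideal_height R {\<zero>} = 0"
proof -
  have "ideal_height R {\<zero>} \<le> prime_height R {\<zero>}"
    unfolding ideal_height_def primes_over_def Spec_def using zeroprimeideal by (intro INF_lower) simp
  then show ?thesis
    using prime_height_zero by simp
qed

theorem proposition3p13:
  fixes S :: "('a, 'm) ring_scheme" and J :: "'a set" and A :: "'a set set"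
  assumes "generalized_Krull_domain S"
    and "ideal J S"
    and "ideal_height S J \<ge> 2"
    and "krull_dim (S Quot J) = 0"
    and "finite (minimal_primes_over S J)"
    and "subring A (S Quot J)"
    and "integral_extension A (S Quot J)"
  shows "perinormal (pullback_ring S J A) \<longleftrightarrow> fragile A (S Quot J)"
proof -
  interpret S: generalized_Krull S
    using assms(1) unfolding generalized_Krull_domain_def
    by (intro generalized_Krull.intro generalized_Krull_axioms.intro assms(1)) simp
  \<comment> \<open>The zero ideal of a domain has height 0.\<close>
  have "J \<noteq> {\<zero>\<^bsub>S\<^esub>}"
    using assms(3) S.ideal_height_zero_if_zero_ideal by auto
  then obtain j where j: "j \<in> J" "j \<noteq> \<zero>\<^bsub>S\<^esub>"
    using additive_subgroup.zero_closed[OF ideal.axioms(1)[OF assms(2)]] by blast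
  have height: "\<not> J \<subseteq> P" if P: "P \<in> Spec1 S" for P
  proof
    assume "J \<subseteq> P"
    then have "ideal_height S J \<le> prime_height S P"
      unfolding ideal_height_def primes_over_def using P unfolding Spec1_def by (intro INF_lower) simp
    then have "2 \<le> prime_height S P"
      using assms(3) by (rule order_trans[rotated])
    then show False
      using P unfolding Spec1_def by (auto simp: one_enat_def numeral_eq_enat)
  qed
  interpret Krull_pullback S J A j
    by (intro Krull_pullback.intro Krull_pullback_axioms.intro S.generalized_Krull_axioms assms(2,6) height j)
  interpret zero_dim_pullback K B "\<phi> ` carrier S" A \<psi>
    by (intro zero_dim_pullback.intro zero_dim_pullback_axioms.intro pb.pullback_in_field_axioms assms(7)
        pi_regular_if_krull_dim_0[OF B_cring assms(4)])
  show ?thesis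
    unfolding perinormal_iff fragile_iff
  proof (intro iffI allI impI)
    fix p L
    assume "\<forall>L. subring L K \<and> pb.R \<subseteq> L \<and> local_ring (K\<lparr>carrier := L\<rparr>) \<and> going_down pb.R (K\<lparr>carrier := L\<rparr>) \<longrightarrow>
      (\<exists>q. primeideal q (K\<lparr>carrier := pb.R\<rparr>) \<and> L = fractions_within K (pb.R - q) pb.R)"
      and "primeideal p (K\<lparr>carrier := pb.R\<rparr>) \<and> pb.J \<subseteq> p"
      and "subring L K \<and> fractions_within K (pb.R - p) pb.R \<subset> L \<and> L \<subseteq> fractions_within K (pb.R - p) (\<phi> ` carrier S)"
    then show "two_primes_over K pb.R L p"
      by (intro two_primes_if_perinormal) blast+
  next
    fix L
    assume frag: "\<forall>p. primeideal p (K\<lparr>carrier := pb.R\<rparr>) \<and> pb.J \<subseteq> p \<longrightarrow>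
      (\<forall>L. subring L K \<and> fractions_within K (pb.R - p) pb.R \<subset> L \<and> L \<subseteq> fractions_within K (pb.R - p) (\<phi> ` carrier S) \<longrightarrow>
        two_primes_over K pb.R L p)"
      and L: "subring L K \<and> pb.R \<subseteq> L \<and> local_ring (K\<lparr>carrier := L\<rparr>) \<and> going_down pb.R (K\<lparr>carrier := L\<rparr>)"
    show "\<exists>q. primeideal q (K\<lparr>carrier := pb.R\<rparr>) \<and> L = fractions_within K (pb.R - q) pb.R"
    proof (rule perinormal_if_two_primes)
      show "L \<subseteq> fractions_within K (pb.R - q) (\<phi> ` carrier S)"
        if "subring L K" "pb.R \<subseteq> L" "primeideal q (K\<lparr>carrier := pb.R\<rparr>)"
          "\<And>q'. \<lbrakk>primeideal q' (K\<lparr>carrier := pb.R\<rparr>); q' \<subseteq> q\<rbrakk> \<Longrightarrow>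
            \<exists>Q. primeideal Q (K\<lparr>carrier := L\<rparr>) \<and> Q \<inter> pb.R = q'" for L q
        by (rule overring_bound[OF that(1-3)]) (rule that(4))
    qed (use L frag in blast)+
  qed
qed

end
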